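(* Let $W$ be a Weyl group of type $Y_{a,b,c}$ ($a,b,c\ge1$). The canonical basis $\mathcal{B}$ is a sign-coherent basis for the module $M$. With respect to this basis, every element $w\in W$ is represented by a sign-coherent matrix of integers.
   Context: $Y_{a,b,c}$ ($a,b,c\ge1$) is the tree with $n=a+b+c+1$ vertices consisting of three paths with $a$, $b$ and $c$ vertices, each joined by one of its endpoints to a common trivalent branch vertex. Its Cartan matrix $A$ has $A_{ii}=2$, $A_{ij}=-1$ if $i,j$ are adjacent, and $A_{ij}=0$ otherwise. $W$ is the group generated by $s_1,\dots,s_n$ subject to $s_i^2=1$, $s_is_j=s_js_i$ if $A_{ij}=0$, and $s_is_js_i=s_js_is_j$ if $A_{ij}=-1$. $V$ is the real vector space with basis the simple roots $\Pi=\{\alpha_1,\dots,\alpha_n\}$, with symmetric bilinear form $B(\alpha_i,\alpha_j)=A_{ij}$, on which $W$ acts by $s_i(v)=v-B(\alpha_i,v)\alpha_i$. For $\alpha,\beta\in V$, $\alpha\vee\beta=\alpha\otimes\beta+\beta\otimes\alpha$; $S^2(V)\subseteq V\otimes V$ is the span of these elements, with the diagonal $W$-action. $M\subseteq S^2(V)$ is the kernel of the linear map $S^2(V)\to\mathbb{R}$ obtained by restricting $v\otimes v'\mapsto B(v,v')$; it is a $W$-submodule. Elementary roots. The highest root of a type $D_m$ ($m\ge4$) root system is the sum of the simple roots with coefficient $1$ at the endpoints of the diagram and $2$ at all other vertices. For a simple root $\alpha_i$, a positive root $\beta$ is called elementary with respect to $\alpha_i$ if one of the following holds: (1) $\beta=\alpha_j$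 is a simple root with $A_{ij}=0$; (2) $\beta=\alpha_h+\alpha_i+\alpha_j$ for a path $h$--$i$--$j$ in $Y_{a,b,c}$ (with middle vertex $i$); (3) $i$ is not the branch vertex and $\beta=\theta_i$, where $\theta_i$ is the highest root of the standard parabolic subsystem of type $D_m$ ($m\ge 4$) whose simple roots are those on the path from $i$ to the branch vertex together with all neighbours of the branch vertex. The canonical basis $\mathcal{B}=\mathcal{B}(a,b,c)$ is the set of all $\alpha_i\vee\beta$ with $\alpha_i\in\Pi$ and $\beta$ elementary with respect to $\alpha_i$; it is a basis of $M$. A matrix is (column) sign-coherent if any two nonzero entries in the same column have the same sign. A basis of a finite-dimensional group representation is a sign-coherent basis if every group element acts by a sign-coherent matrix with respect to it (columns being the coordinates of the images of basis vectors). *)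

theory Defs
  imports Complex_Main "HOL-Library.Function_Algebras" "HOL-Algebra.Group"
begin

text \<open>
  The coordinate space \<open>'i \<Rightarrow> real\<close> as a real vector space, with pointwise operations
  (addition is pointwise by \<open>Function_Algebras\<close>).
\<close>

instantiation "fun" :: (type, real_vector) real_vector
begin

definition scaleR_fun :: "real \<Rightarrow> ('a \<Rightarrow> 'b) \<Rightarrow> 'a \<Rightarrow> 'b"
  where "scaleR_fun r f = (\<lambda>x. r *\<^sub>R f x)"

instance
  by standard (simp_all add: scaleR_fun_def plus_fun_def fun_eq_iff algebra_simps)

end

section \<open>Sign-coherent bases\<close>

definition group_representation ::
  "('g, 'm) monoid_scheme \<Rightarrow> ('g \<Rightarrow> 'v::real_vector \<Rightarrow> 'v) \<Rightarrow> 'v set \<Rightarrow> bool"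
  where "group_representation G \<rho> U \<longleftrightarrow>
    group G \<and> subspace U \<and>
    (\<forall>g\<in>carrier G. \<rho> g ` U \<subseteq> U \<and>
       (\<forall>x\<in>U. \<forall>y\<in>U. \<rho> g (x + y) = \<rho> g x + \<rho> g y) \<and>
       (\<forall>r. \<forall>x\<in>U. \<rho> g (r *\<^sub>R x) = r *\<^sub>R \<rho> g x)) \<and>
    (\<forall>x\<in>U. \<rho> \<one>\<^bsub>G\<^esub> x = x) \<and>
    (\<forall>g\<in>carrier G. \<forall>h\<in>carrier G. \<forall>x\<in>U. \<rho> (g \<otimes>\<^bsub>G\<^esub> h) x = \<rho> g (\<rho> h x))"

definition is_basis :: "'v::real_vector set \<Rightarrow> 'v set \<Rightarrow> bool"
  where "is_basis E U \<longleftrightarrow> independent E \<and> span E = U"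

text \<open>
  Matrices with respect to a basis \<open>E\<close> have rows and columns indexed by the elements of \<open>E\<close>;
  column \<open>y\<close> holds the coordinates of \<open>f y\<close>.
\<close>

definition matrix_wrt :: "'v::real_vector set \<Rightarrow> ('v \<Rightarrow> 'v) \<Rightarrow> 'v \<Rightarrow> 'v \<Rightarrow> real"
  where "matrix_wrt E f = (\<lambda>x y. representation E (f y) x)"

definition sign_coherent_matrix :: "'i set \<Rightarrow> ('i \<Rightarrow> 'i \<Rightarrow> real) \<Rightarrow> bool"
  where "sign_coherent_matrix I X \<longleftrightarrow>
    (\<forall>j\<in>I. \<forall>i\<in>I. \<forall>k\<in>I. X i j \<noteq> 0 \<longrightarrow> X k j \<noteq> 0 \<longrightarrow> sgn (X i j) = sgn (X k j))"

definition integer_matrix :: "'i set \<Rightarrow> ('i \<Rightarrow> 'i \<Rightarrow> real) \<Rightarrow> bool"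
  where "integer_matrix I X \<longleftrightarrow> (\<forall>i\<in>I. \<forall>j\<in>I. X i j \<in> \<int>)"

definition sign_coherent_basis ::
  "('g, 'm) monoid_scheme \<Rightarrow> ('g \<Rightarrow> 'v::real_vector \<Rightarrow> 'v) \<Rightarrow> 'v set \<Rightarrow> 'v set \<Rightarrow> bool"
  where "sign_coherent_basis G \<rho> U E \<longleftrightarrow>
    group_representation G \<rho> U \<and> finite E \<and> is_basis E U \<and>
    (\<forall>g\<in>carrier G. sign_coherent_matrix E (matrix_wrt E (\<rho> g)))"

section \<open>The tree and its Cartan matrix\<close>

text \<open>
  \<open>Node k p\<close> is the vertex of arm \<open>k\<close> at distance \<open>p + 1\<close> from the branch vertex. Adjacency and
  the Cartan matrix are defined on the infinite tree with three rays; the tree with arms of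
  \<open>a\<close>, \<open>b\<close>, \<open>c\<close> vertices is the full subtree on \<open>verts a b c\<close>.
\<close>

datatype arm = Arm1 | Arm2 | Arm3

datatype vertex = Branch | Node arm nat

fun arm_length :: "nat \<Rightarrow> nat \<Rightarrow> nat \<Rightarrow> arm \<Rightarrow> nat" where
  "arm_length a b c Arm1 = a"
| "arm_length a b c Arm2 = b"
| "arm_length a b c Arm3 = c"

definition verts :: "nat \<Rightarrow> nat \<Rightarrow> nat \<Rightarrow> vertex set"
  where "verts a b c = insert Branch {Node k p | k p. p < arm_length a b c k}"

fun adj :: "vertex \<Rightarrow> vertex \<Rightarrow> bool" where
  "adj Branch Branch \<longleftrightarrow> False"
| "adj Branch (Node k p) \<longleftrightarrow> p = 0"
| "adj (Node k p) Branch \<longleftrightarrow> p = 0"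
| "adj (Node k p) (Node l q) \<longleftrightarrow> k = l \<and> (q = Suc p \<or> p = Suc q)"

definition cartan :: "vertex \<Rightarrow> vertex \<Rightarrow> real"
  where "cartan i j = (if i = j then 2 else if adj i j then - 1 else 0)"

section \<open>The Weyl group by generators and relations\<close>

text \<open>
  Words in the generators modulo the congruence generated by the Coxeter relations. Since every
  generator is an involution, inverse letters are not needed: the monoid with this presentation
  is the group with this presentation.
\<close>

inductive word_eq :: "nat \<Rightarrow> nat \<Rightarrow> nat \<Rightarrow> vertex list \<Rightarrow> vertex list \<Rightarrow> bool"
  for a b c :: nat where
  involution: "i \<in> verts a b c \<Longrightarrow> word_eq a b c [i, i] []"
| commutation: "i \<in> verts a b c \<Longrightarrow> j \<in> verts a b c \<Longrightarrow> cartan i j = 0 \<Longrightarrow>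
    word_eq a b c [i, j] [j, i]"
| braid: "i \<in> verts a b c \<Longrightarrow> j \<in> verts a b c \<Longrightarrow> cartan i j = - 1 \<Longrightarrow>
    word_eq a b c [i, j, i] [j, i, j]"
| refl: "xs \<in> lists (verts a b c) \<Longrightarrow> word_eq a b c xs xs"
| sym: "word_eq a b c xs ys \<Longrightarrow> word_eq a b c ys xs"
| trans: "word_eq a b c xs ys \<Longrightarrow> word_eq a b c ys zs \<Longrightarrow> word_eq a b c xs zs"
| append: "word_eq a b c xs xs' \<Longrightarrow> word_eq a b c ys ys' \<Longrightarrow> word_eq a b c (xs @ ys) (xs' @ ys')"

definition word_rel :: "nat \<Rightarrow> nat \<Rightarrow> nat \<Rightarrow> (vertex list \<times> vertex list) set"
  where "word_rel a b c = {(xs, ys). word_eq a b c xs ys}"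

definition weyl_group :: "nat \<Rightarrow> nat \<Rightarrow> nat \<Rightarrow> vertex list set monoid"
  where "weyl_group a b c =
    \<lparr>carrier = lists (verts a b c) // word_rel a b c,
     monoid.mult = (\<lambda>X Y. \<Union>xs\<in>X. \<Union>ys\<in>Y. word_rel a b c `` {xs @ ys}),
     one = word_rel a b c `` {[]}\<rparr>"

lemma word_eq_lists:
  "word_eq a b c xs ys \<Longrightarrow> xs \<in> lists (verts a b c) \<and> ys \<in> lists (verts a b c)"
  by (induction rule: word_eq.induct) auto

lemma equiv_word_rel: "equiv (lists (verts a b c)) (word_rel a b c)"
proof (rule equivI)
  show "word_rel a b c \<subseteq> lists (verts a b c) \<times> lists (verts a b c)"
    using word_eq_lists unfolding word_rel_def by blast
  show "refl_on (lists (verts a b c)) (word_rel a b c)"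
    by (rule refl_onI) (auto simp: word_rel_def intro!: word_eq.refl)
  show "sym_on UNIV (word_rel a b c)"
    unfolding sym_on_def word_rel_def using word_eq.sym by blast
  show "Relation.trans (word_rel a b c)"
    unfolding Relation.trans_def word_rel_def using word_eq.trans by blast
qed

lemma weyl_group_mult_class:
  assumes "xs \<in> lists (verts a b c)" "ys \<in> lists (verts a b c)"
  shows "word_rel a b c `` {xs} \<otimes>\<^bsub>weyl_group a b c\<^esub> word_rel a b c `` {ys}
    = word_rel a b c `` {xs @ ys}"
proof -
  have "word_rel a b c `` {xs' @ ys'} = word_rel a b c `` {xs @ ys}"
    if "word_eq a b c xs xs'" "word_eq a b c ys ys'" for xs' ys'
    using word_eq.append[OF that] equiv_class_eq[OF equiv_word_rel, of "xs @ ys" "xs' @ ys'" a b c]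
    by (auto simp: word_rel_def)
  then have "(\<Union>xs'\<in>word_rel a b c `` {xs}. \<Union>ys'\<in>word_rel a b c `` {ys}.
      word_rel a b c `` {xs' @ ys'}) = (\<Union>xs'\<in>word_rel a b c `` {xs}.
      \<Union>ys'\<in>word_rel a b c `` {ys}. word_rel a b c `` {xs @ ys})"
    by (intro SUP_cong HOL.refl) (simp add: word_rel_def)
  moreover have "word_rel a b c `` {xs} \<noteq> {}" "word_rel a b c `` {ys} \<noteq> {}"
    using equiv_class_self[OF equiv_word_rel] assms by blast+
  ultimately show ?thesis
    by (simp add: weyl_group_def)
qed

lemma word_eq_rev_cancel:
  "xs \<in> lists (verts a b c) \<Longrightarrow> word_eq a b c (rev xs @ xs) []"
proof (induction xs)
  case Nil
  then show ?case by (auto intro: word_eq.refl)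
next
  case (Cons i xs)
  then have i: "i \<in> verts a b c" and xs: "xs \<in> lists (verts a b c)" by auto
  have r: "word_eq a b c (rev xs) (rev xs)" "word_eq a b c xs xs"
    using xs by (auto intro!: word_eq.refl)
  have "word_eq a b c (rev xs @ [i, i] @ xs) (rev xs @ [] @ xs)"
    by (intro word_eq.append r word_eq.involution i)
  then have "word_eq a b c (rev (i # xs) @ i # xs) (rev xs @ xs)" by simp
  then show ?case using Cons.IH[OF xs] by (rule word_eq.trans)
qed

lemma weyl_group_group: "group (weyl_group a b c)"
proof -
  let ?L = "lists (verts a b c)" and ?c = "\<lambda>xs. word_rel a b c `` {xs}"
  have rep: "\<exists>xs\<in>?L. x = ?c xs" if "x \<in> carrier (weyl_group a b c)" for x
    using that by (auto simp: weyl_group_def elim!: quotientE)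
  have cl: "?c xs \<in> carrier (weyl_group a b c)" if "xs \<in> ?L" for xs
    using that by (auto simp: weyl_group_def intro: quotientI)
  have one: "\<one>\<^bsub>weyl_group a b c\<^esub> = ?c []" by (simp add: weyl_group_def)
  have app: "xs @ ys \<in> ?L" if "xs \<in> ?L" "ys \<in> ?L" for xs ys using that by auto
  have nil: "[] \<in> ?L" by simp
  show ?thesis
  proof (rule groupI)
    fix x y assume "x \<in> carrier (weyl_group a b c)" "y \<in> carrier (weyl_group a b c)"
    then obtain xs ys where "xs \<in> ?L" "ys \<in> ?L" "x = ?c xs" "y = ?c ys" using rep by meson
    then show "x \<otimes>\<^bsub>weyl_group a b c\<^esub> y \<in> carrier (weyl_group a b c)"
      using cl[OF app] by (simp only: weyl_group_mult_class)
  next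
    show "\<one>\<^bsub>weyl_group a b c\<^esub> \<in> carrier (weyl_group a b c)"
      unfolding one by (rule cl[OF nil])
  next
    fix x y z assume "x \<in> carrier (weyl_group a b c)" "y \<in> carrier (weyl_group a b c)"
      "z \<in> carrier (weyl_group a b c)"
    then obtain xs ys zs where "xs \<in> ?L" "ys \<in> ?L" "zs \<in> ?L" "x = ?c xs" "y = ?c ys" "z = ?c zs"
      using rep by meson
    then show "x \<otimes>\<^bsub>weyl_group a b c\<^esub> y \<otimes>\<^bsub>weyl_group a b c\<^esub> z
        = x \<otimes>\<^bsub>weyl_group a b c\<^esub> (y \<otimes>\<^bsub>weyl_group a b c\<^esub> z)"
      by (simp only: weyl_group_mult_class app append_assoc)
  next
    fix x assume "x \<in> carrier (weyl_group a b c)"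
    then obtain xs where xs: "xs \<in> ?L" "x = ?c xs" using rep by meson
    then show "\<one>\<^bsub>weyl_group a b c\<^esub> \<otimes>\<^bsub>weyl_group a b c\<^esub> x = x"
      unfolding one by (simp only: weyl_group_mult_class nil append_Nil)
    have r: "rev xs \<in> ?L" using xs by auto
    have "?c (rev xs) \<otimes>\<^bsub>weyl_group a b c\<^esub> x = ?c (rev xs @ xs)"
      using xs r by (simp only: weyl_group_mult_class)
    also have "\<dots> = ?c []"
      using word_eq_rev_cancel[OF xs(1)]
      by (intro equiv_class_eq[OF equiv_word_rel]) (simp add: word_rel_def)
    finally show "\<exists>y\<in>carrier (weyl_group a b c). y \<otimes>\<^bsub>weyl_group a b c\<^esub> x = \<one>\<^bsub>weyl_group a b c\<^esub>"
      using cl[OF r] unfolding one by blast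
  qed
qed

section \<open>The reflection representation\<close>

definition simple_root :: "vertex \<Rightarrow> vertex \<Rightarrow> real"
  where "simple_root i = (\<lambda>p. if p = i then 1 else 0)"

definition root_space :: "nat \<Rightarrow> nat \<Rightarrow> nat \<Rightarrow> (vertex \<Rightarrow> real) set"
  where "root_space a b c = span (simple_root ` verts a b c)"

definition cartan_form :: "nat \<Rightarrow> nat \<Rightarrow> nat \<Rightarrow> (vertex \<Rightarrow> real) \<Rightarrow> (vertex \<Rightarrow> real) \<Rightarrow> real"
  where "cartan_form a b c v w = (\<Sum>p\<in>verts a b c. \<Sum>q\<in>verts a b c. cartan p q * v p * w q)"

definition reflection ::
  "nat \<Rightarrow> nat \<Rightarrow> nat \<Rightarrow> vertex \<Rightarrow> (vertex \<Rightarrow> real) \<Rightarrow> vertex \<Rightarrow> real"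
  where "reflection a b c i v = v - cartan_form a b c (simple_root i) v *\<^sub>R simple_root i"

definition word_act ::
  "nat \<Rightarrow> nat \<Rightarrow> nat \<Rightarrow> vertex list \<Rightarrow> (vertex \<Rightarrow> real) \<Rightarrow> vertex \<Rightarrow> real"
  where "word_act a b c xs = foldr (reflection a b c) xs"

text \<open>
  All words in a class \<open>w\<close> act in the same way, so \<open>weyl_act\<close> is well defined; see
  \<open>weyl_act_class\<close> below.
\<close>

definition weyl_act ::
  "nat \<Rightarrow> nat \<Rightarrow> nat \<Rightarrow> vertex list set \<Rightarrow> (vertex \<Rightarrow> real) \<Rightarrow> vertex \<Rightarrow> real"
  where "weyl_act a b c w = the_elem (word_act a b c ` w)"

lemma finite_verts [simp]: "finite (verts a b c)"
proof -
  have "finite (UNIV :: arm set)"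
  proof (rule finite_subset)
    show "(UNIV :: arm set) \<subseteq> {Arm1, Arm2, Arm3}" using arm.nchotomy by blast
  qed simp
  then have "finite (SIGMA k:(UNIV::arm set). {..<arm_length a b c k})" by blast
  moreover have "{Node k p | k p. p < arm_length a b c k}
      = (\<lambda>(k, p). Node k p) ` (SIGMA k:UNIV. {..<arm_length a b c k})" by auto
  ultimately show ?thesis unfolding verts_def by simp
qed

lemma adj_sym: "adj i j \<longleftrightarrow> adj j i"
  by (cases i; cases j) auto

lemma cartan_sym: "cartan i j = cartan j i"
  unfolding cartan_def using adj_sym by auto

lemma cartan_form_simple_left:
  "i \<in> verts a b c \<Longrightarrow>
    cartan_form a b c (simple_root i) v = (\<Sum>q\<in>verts a b c. cartan i q * v q)"
proof -
  assume i: "i \<in> verts a b c"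
  have "cartan_form a b c (simple_root i) v
    = (\<Sum>p\<in>verts a b c. if p = i then \<Sum>q\<in>verts a b c. cartan i q * v q else 0)"
    unfolding cartan_form_def simple_root_def by (intro sum.cong) (auto intro!: sum.cong)
  then show ?thesis using i by simp
qed

lemma cartan_form_simple_simple:
  "i \<in> verts a b c \<Longrightarrow> j \<in> verts a b c \<Longrightarrow>
    cartan_form a b c (simple_root i) (simple_root j) = cartan i j"
  by (simp add: cartan_form_simple_left) (simp add: simple_root_def if_distrib cong: if_cong)

lemma cartan_form_diff_right:
  "cartan_form a b c u (v - w) = cartan_form a b c u v - cartan_form a b c u w"
  by (simp add: cartan_form_def algebra_simps sum_subtractf)

lemma cartan_form_scaleR_right:
  "cartan_form a b c u (r *\<^sub>R v) = r * cartan_form a b c u v"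
  by (simp add: cartan_form_def scaleR_fun_def sum_distrib_left mult.assoc mult.left_commute)

lemma cartan_form_reflection:
  assumes "i \<in> verts a b c" "j \<in> verts a b c"
  shows "cartan_form a b c (simple_root j) (reflection a b c i v)
    = cartan_form a b c (simple_root j) v - cartan_form a b c (simple_root i) v * cartan j i"
  using assms
  by (simp add: reflection_def cartan_form_diff_right cartan_form_scaleR_right
      cartan_form_simple_simple)

lemma word_act_cong: "word_eq a b c xs ys \<Longrightarrow> word_act a b c xs = word_act a b c ys"
proof (induction rule: word_eq.induct)
  case (involution i)
  have "reflection a b c i (reflection a b c i v) = v" for v
  proof -
    have "cartan_form a b c (simple_root i) (reflection a b c i v)
        = - cartan_form a b c (simple_root i) v"
      using involution by (simp add: cartan_form_reflection cartan_def)
    then show ?thesis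
      unfolding reflection_def[of a b c i "reflection a b c i v"]
      by (simp add: reflection_def)
  qed
  then show ?case by (simp add: word_act_def fun_eq_iff)
next
  case (commutation i j)
  then have "cartan j i = 0" using cartan_sym by metis
  with commutation show ?case
    by (simp add: word_act_def fun_eq_iff cartan_form_reflection
        reflection_def[of a b c _ "reflection a b c _ _"])
       (simp add: reflection_def algebra_simps)
next
  case (braid i j)
  then have *: "cartan j i = - 1" using cartan_sym by metis
  have three: "reflection a b c k (reflection a b c l (reflection a b c k v)) =
      v - (x + y) *\<^sub>R simple_root k - (x + y) *\<^sub>R simple_root l"
    if "k \<in> verts a b c" "l \<in> verts a b c" "cartan k l = - 1" "cartan l k = - 1"
      and x: "x = cartan_form a b c (simple_root k) v"
      and y: "y = cartan_form a b c (simple_root l) v" for k l v x y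
  proof -
    have "cartan k k = 2" by (simp add: cartan_def)
    then have 1: "cartan_form a b c (simple_root l) (reflection a b c k v) = x + y"
      and 2: "cartan_form a b c (simple_root k) (reflection a b c l (reflection a b c k v)) = y"
      using that by (simp_all add: cartan_form_reflection)
    have 3: "reflection a b c k (reflection a b c l (reflection a b c k v)) =
        reflection a b c l (reflection a b c k v) - y *\<^sub>R simple_root k"
      by (subst reflection_def) (simp only: 2)
    have 4: "reflection a b c l (reflection a b c k v) =
        reflection a b c k v - (x + y) *\<^sub>R simple_root l"
      by (subst reflection_def) (simp only: 1)
    have 5: "reflection a b c k v = v - x *\<^sub>R simple_root k"
      by (subst reflection_def) (simp only: x)
    show ?thesis by (subst 3, subst 4, subst 5) (simp add: scaleR_left_distrib algebra_simps)
  qed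
  have "reflection a b c i (reflection a b c j (reflection a b c i v)) =
    reflection a b c j (reflection a b c i (reflection a b c j v))" for v
    using three[of i j _ v, OF _ _ _ _ HOL.refl HOL.refl]
      three[of j i _ v, OF _ _ _ _ HOL.refl HOL.refl] braid *
    by (simp add: add.commute)
  then show ?case by (simp add: word_act_def fun_eq_iff)
next
  case (append xs xs' ys ys')
  then show ?case by (intro ext) (simp add: word_act_def)
qed auto

lemma weyl_act_class:
  assumes "xs \<in> lists (verts a b c)"
  shows "weyl_act a b c (word_rel a b c `` {xs}) = word_act a b c xs"
proof -
  let ?w = "word_rel a b c `` {xs}"
  have "word_act a b c ys = word_act a b c xs" if "ys \<in> ?w" for ys
    using that word_act_cong[of a b c xs ys] by (simp add: word_rel_def)
  moreover have "xs \<in> ?w" using word_eq.refl[OF assms] by (simp add: word_rel_def)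
  ultimately have "word_act a b c ` ?w = {word_act a b c xs}"
    using image_cong[OF HOL.refl, of ?w "word_act a b c" "\<lambda>_. word_act a b c xs"]
      image_constant[of xs ?w "word_act a b c xs"] by metis
  then show ?thesis unfolding weyl_act_def by simp
qed

definition positive_root :: "nat \<Rightarrow> nat \<Rightarrow> nat \<Rightarrow> (vertex \<Rightarrow> real) \<Rightarrow> bool"
  where "positive_root a b c \<beta> \<longleftrightarrow>
    (\<exists>w\<in>carrier (weyl_group a b c). \<exists>i\<in>verts a b c. \<beta> = weyl_act a b c w (simple_root i)) \<and>
    (\<forall>p. \<beta> p \<ge> 0)"

section \<open>The module\<close>

text \<open>
  \<open>V \<otimes> V\<close> is modelled by its coordinates with respect to the basis of all
  \<open>\<alpha>\<^sub>p \<otimes> \<alpha>\<^sub>q\<close>.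
\<close>

definition tensor :: "(vertex \<Rightarrow> real) \<Rightarrow> (vertex \<Rightarrow> real) \<Rightarrow> vertex \<times> vertex \<Rightarrow> real"
    (infixr "\<otimes>\<^sub>V" 70)
  where "v \<otimes>\<^sub>V w = (\<lambda>(p, q). v p * w q)"

definition sym_prod :: "(vertex \<Rightarrow> real) \<Rightarrow> (vertex \<Rightarrow> real) \<Rightarrow> vertex \<times> vertex \<Rightarrow> real"
    (infixr "\<or>\<^sub>V" 68)
  where "v \<or>\<^sub>V w = v \<otimes>\<^sub>V w + w \<otimes>\<^sub>V v"

definition sym_square :: "nat \<Rightarrow> nat \<Rightarrow> nat \<Rightarrow> (vertex \<times> vertex \<Rightarrow> real) set"
  where "sym_square a b c = span {v \<or>\<^sub>V w | v w. v \<in> root_space a b c \<and> w \<in> root_space a b c}"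

text \<open>
  The linear map with \<open>v \<otimes> w \<mapsto> B(v, w)\<close> (see \<open>contraction_tensor\<close> below), given on basis
  vectors.
\<close>

definition contraction :: "nat \<Rightarrow> nat \<Rightarrow> nat \<Rightarrow> (vertex \<times> vertex \<Rightarrow> real) \<Rightarrow> real"
  where "contraction a b c t =
    (\<Sum>p\<in>verts a b c. \<Sum>q\<in>verts a b c. t (p, q) * cartan_form a b c (simple_root p) (simple_root q))"

definition module_M :: "nat \<Rightarrow> nat \<Rightarrow> nat \<Rightarrow> (vertex \<times> vertex \<Rightarrow> real) set"
  where "module_M a b c = {t \<in> sym_square a b c. contraction a b c t = 0}"

text \<open>
  The linear map with \<open>v \<otimes> v' \<mapsto> w v \<otimes> w v'\<close> (see \<open>diagonal_act_tensor\<close> below), given on basis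
  vectors.
\<close>

definition diagonal_act ::
  "nat \<Rightarrow> nat \<Rightarrow> nat \<Rightarrow> vertex list set \<Rightarrow> (vertex \<times> vertex \<Rightarrow> real) \<Rightarrow> vertex \<times> vertex \<Rightarrow> real"
  where "diagonal_act a b c w t =
    (\<Sum>p\<in>verts a b c. \<Sum>q\<in>verts a b c.
      t (p, q) *\<^sub>R (weyl_act a b c w (simple_root p) \<otimes>\<^sub>V weyl_act a b c w (simple_root q)))"

lemma contraction_tensor: "contraction a b c (v \<otimes>\<^sub>V w) = cartan_form a b c v w"
  unfolding contraction_def cartan_form_def[of a b c v w]
  by (intro sum.cong) (auto simp: cartan_form_simple_simple tensor_def)

lemma sum_fun_apply: "(\<Sum>i\<in>I. f i) x = (\<Sum>i\<in>I. f i x)"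
  by (induction I rule: infinite_finite_induct) auto

lemma root_space_expand:
  assumes "v \<in> root_space a b c"
  shows "v = (\<Sum>p\<in>verts a b c. v p *\<^sub>R simple_root p)"
proof -
  have "span (simple_root ` verts a b c) \<subseteq> {v. \<forall>x. x \<notin> verts a b c \<longrightarrow> v x = 0}"
  proof (rule span_minimal)
    show "subspace {v :: vertex \<Rightarrow> real. \<forall>x. x \<notin> verts a b c \<longrightarrow> v x = 0}"
      by (rule subspaceI) (auto simp: scaleR_fun_def)
  qed (auto simp: simple_root_def)
  then have 0: "v x = 0" if "x \<notin> verts a b c" for x
    using that assms unfolding root_space_def by blast
  have "(\<Sum>p\<in>verts a b c. v p *\<^sub>R simple_root p) x = v x" for x
  proof -
    have "(\<Sum>p\<in>verts a b c. v p *\<^sub>R simple_root p) x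
      = (\<Sum>p\<in>verts a b c. if x = p then v p else 0)"
      unfolding sum_fun_apply
      by (intro sum.cong) (auto simp: scaleR_fun_def simple_root_def)
    then show ?thesis using 0[of x] by simp
  qed
  then show ?thesis by (intro ext) (rule HOL.sym)
qed

lemma linear_reflection: "linear (reflection a b c i)"
proof (rule linearI)
  fix v w :: "vertex \<Rightarrow> real" and r :: real
  have "cartan_form a b c u (v + w) = cartan_form a b c u v + cartan_form a b c u w" for u
    by (simp add: cartan_form_def algebra_simps sum.distrib)
  then show "reflection a b c i (v + w) = reflection a b c i v + reflection a b c i w"
    by (simp add: reflection_def scaleR_left_distrib)
  show "reflection a b c i (r *\<^sub>R v) = r *\<^sub>R reflection a b c i v"
    by (simp add: reflection_def cartan_form_scaleR_right scaleR_right_diff_distrib)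
qed

lemma linear_word_act: "linear (word_act a b c xs)"
proof (induction xs)
  case Nil
  then show ?case using linear_id by (simp add: word_act_def id_def)
next
  case (Cons i xs)
  then show ?case
    using linear_compose[OF Cons linear_reflection] by (simp add: word_act_def o_def)
qed

lemma linear_weyl_act:
  assumes "w \<in> carrier (weyl_group a b c)"
  shows "linear (weyl_act a b c w)"
proof -
  obtain xs where "xs \<in> lists (verts a b c)" "w = word_rel a b c `` {xs}"
    using assms unfolding weyl_group_def by (auto elim!: quotientE)
  then show ?thesis by (simp only: weyl_act_class linear_word_act)
qed

lemma diagonal_act_tensor:
  assumes w: "w \<in> carrier (weyl_group a b c)"
    and v: "v \<in> root_space a b c" and v': "v' \<in> root_space a b c"
  shows "diagonal_act a b c w (v \<otimes>\<^sub>V v') = weyl_act a b c w v \<otimes>\<^sub>V weyl_act a b c w v'"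
proof -
  let ?g = "weyl_act a b c w"
  have expand: "?g u x = (\<Sum>p\<in>verts a b c. u p * ?g (simple_root p) x)"
    if "u \<in> root_space a b c" for u x
  proof -
    have "?g u = ?g (\<Sum>p\<in>verts a b c. u p *\<^sub>R simple_root p)"
      using root_space_expand[OF that] by simp
    also have "\<dots> = (\<Sum>p\<in>verts a b c. u p *\<^sub>R ?g (simple_root p))"
      using linear_weyl_act[OF w] by (simp add: linear_sum linear_cmul)
    finally show ?thesis by (simp add: sum_fun_apply scaleR_fun_def)
  qed
  show ?thesis
  proof (rule ext)
    fix z :: "vertex \<times> vertex"
    obtain x y where z: "z = (x, y)" by (cases z)
    show "diagonal_act a b c w (v \<otimes>\<^sub>V v') z = (?g v \<otimes>\<^sub>V ?g v') z"
      by (simp add: z tensor_def expand[OF v] expand[OF v'] sum_product diagonal_act_def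
          sum_fun_apply scaleR_fun_def mult_ac)
  qed
qed

section \<open>The canonical basis\<close>

text \<open>
  For \<open>i = Node k p\<close>, the vertices of the type \<open>D\<close> subdiagram having the path from \<open>i\<close> to the
  branch vertex as its long arm.
\<close>

definition D_verts :: "nat \<Rightarrow> nat \<Rightarrow> nat \<Rightarrow> arm \<Rightarrow> nat \<Rightarrow> vertex set"
  where "D_verts a b c k p =
    insert Branch {Node k q | q. q \<le> p} \<union> {j \<in> verts a b c. adj j Branch}"

definition endpoint :: "vertex set \<Rightarrow> vertex \<Rightarrow> bool"
  where "endpoint D j \<longleftrightarrow> j \<in> D \<and> card {h \<in> D. adj h j} = 1"

definition D_highest_root :: "vertex set \<Rightarrow> vertex \<Rightarrow> real"
  where "D_highest_root D = (\<Sum>j\<in>D. (if endpoint D j then 1 else 2) *\<^sub>R simple_root j)"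

definition elementary :: "nat \<Rightarrow> nat \<Rightarrow> nat \<Rightarrow> vertex \<Rightarrow> (vertex \<Rightarrow> real) \<Rightarrow> bool"
  where "elementary a b c i \<beta> \<longleftrightarrow>
    positive_root a b c \<beta> \<and>
    ((\<exists>j\<in>verts a b c. cartan i j = 0 \<and> \<beta> = simple_root j) \<or>
     (\<exists>h\<in>verts a b c. \<exists>j\<in>verts a b c. h \<noteq> j \<and> adj h i \<and> adj i j \<and>
        \<beta> = simple_root h + simple_root i + simple_root j) \<or>
     (\<exists>k p. i = Node k p \<and> \<beta> = D_highest_root (D_verts a b c k p)))"

definition canonical_basis :: "nat \<Rightarrow> nat \<Rightarrow> nat \<Rightarrow> (vertex \<times> vertex \<Rightarrow> real) set"
  where "canonical_basis a b c =
    {simple_root i \<or>\<^sub>V \<beta> | i \<beta>. i \<in> verts a b c \<and> elementary a b c i \<beta>}"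

end

theory Submission
  imports Defs
begin

text \<open>
  The columns of the matrix of \<open>w\<close> are the coordinates of the images of basis elements. Each basis
  element is \<open>\<alpha> \<or> \<beta>\<close> for two orthogonal real roots (\<open>CB_roots\<close>), and its image \<open>w \<alpha> \<or> w \<beta>\<close> is again
  of this kind. A real root is positive or negative (\<open>real_root_sign\<close>), so up to a sign the image
  is a product of two orthogonal positive roots. Sign coherence and integrality both follow from one
  positivity statement, \<open>orthogonal_positive_roots_in_nat_cone\<close>: for orthogonal positive real
  roots, \<open>\<alpha> \<or> \<beta>\<close> is a combination of the canonical basis with nonnegative integer coefficients.

  To prove it, let \<open>a\<^sub>k\<close> and \<open>b\<^sub>k\<close> be the coefficients of \<open>\<alpha>\<close> and \<open>\<beta>\<close> at distance \<open>k\<close> from the branch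
  vertex along an arm, and let \<open>x\<^sub>k = a\<^sub>k - a\<^sub>k\<^sub>+\<^sub>1\<close> and \<open>y\<^sub>k = b\<^sub>k - b\<^sub>k\<^sub>+\<^sub>1\<close> be their drops. On every arm the
  drops of \<open>\<alpha>\<close> add up to the branch coefficient \<open>a\<^sub>0\<close>; the form is
  \<open>B(\<alpha>, \<beta>) = \<Sum> x\<^sub>k y\<^sub>k - a\<^sub>0 b\<^sub>0\<close>, summed over all arms (\<open>B_eq_drops\<close>); and the reflections in
  the vertices of an arm permute its drops. If \<open>a\<^sub>0 > 0\<close>, this symmetry moves any drop to the leaf,
  where it is a coefficient of a positive root; so all drops are nonnegative (\<open>drop_nonneg\<close>).

  Comparing coefficients at equal and at adjacent vertices determines the expansion of \<open>\<alpha> \<or> \<beta>\<close>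
  up to products of orthogonal simple roots. The coefficient of \<open>\<alpha>\<^sub>i \<or> \<theta>\<^sub>i\<close>, for \<open>i\<close> at distance \<open>k\<close>, is
  \<open>\<Sum>\<^sub>l\<^sub>\<ge>\<^sub>k x\<^sub>l y\<^sub>l\<close>; that of the path with middle vertex \<open>i\<close> is \<open>a\<^sub>k b\<^sub>k - \<Sum>\<^sub>l\<^sub>\<ge>\<^sub>k x\<^sub>l y\<^sub>l\<close>, a sum of products
  \<open>x\<^sub>l y\<^sub>m\<close> with \<open>l \<noteq> m\<close>; that of a path through the branch vertex is \<open>\<Sum> x\<^sub>l y\<^sub>l\<close> over the arm which
  the path avoids. These are visibly nonnegative. For products of orthogonal simple roots on two
  different arms one more fact is needed: the sum of two drops on different arms is at most \<open>a\<^sub>0\<close>,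
  unless \<open>a\<^sub>0\<close> and both drops are \<open>1\<close> (\<open>exceptional\<close>), and in that case orthogonality turns the
  inequality in question into an equality or gives it directly (\<open>exceptional_orthogonal\<close>). Roots with
  \<open>a\<^sub>0 = 0\<close> live on one arm and have just two nonzero drops, so they can be treated explicitly.

  That the canonical basis is a basis of \<open>M\<close> is shown without counting dimensions. It is independent
  because suitable coordinates make it triangular (\<open>independent_CB\<close>). It spans because, modulo its
  span, \<open>\<alpha>\<^sub>i \<or> \<alpha>\<^sub>j\<close> is \<open>B(\<alpha>\<^sub>i, \<alpha>\<^sub>j) / 2\<close> times the square of the branch root, so that a symmetric
  tensor is congruent to a quarter of its contraction times that square (\<open>span_CB\<close>).
\<close>

section \<open>Preliminaries\<close>

lemma UNIV_arm: "(UNIV :: arm set) = {Arm1, Arm2, Arm3}"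
  using arm.exhaust by blast

lemma finite_UNIV_arm [simp]: "finite (UNIV :: arm set)"
  by (simp add: UNIV_arm)

lemma sum_arms: "(\<Sum>s\<in>UNIV. f s) = f Arm1 + f Arm2 + f Arm3" for f :: "arm \<Rightarrow> 'a::comm_monoid_add"
  by (simp add: UNIV_arm add.assoc)

text \<open>
  Triangularity: the functional belonging to \<open>x\<close> may be nonzero on vectors of lower level, since the
  coefficients of those are known to vanish by then. Levels form a relation, not a function, so
  that one can assign them to descriptions of vectors before knowing that different descriptions
  give different vectors.
\<close>

lemma independent_by_levels:
  fixes E :: "'v::real_vector set" and level :: "'v \<Rightarrow> nat \<Rightarrow> bool"
  assumes fin: "finite E"
    and has_level: "\<And>x. x \<in> E \<Longrightarrow> \<exists>n. level x n"
    and separate: "\<And>x n. x \<in> E \<Longrightarrow> level x n \<Longrightarrow>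
      \<exists>f :: 'v \<Rightarrow> real. linear f \<and> f x \<noteq> 0 \<and> (\<forall>y\<in>E. y \<noteq> x \<longrightarrow> f y = 0 \<or> (\<exists>m<n. level y m))"
  shows "independent E"
proof (rule independent_if_scalars_zero[OF fin])
  fix u x
  assume sum0: "(\<Sum>x\<in>E. u x *\<^sub>R x) = 0" and "x \<in> E"
  have "u x = 0" if "level x n" "x \<in> E" for n x
    using that
  proof (induction n arbitrary: x rule: less_induct)
    case (less n)
    obtain f :: "'v \<Rightarrow> real" where f: "linear f" "f x \<noteq> 0"
      "\<And>y. y \<in> E \<Longrightarrow> y \<noteq> x \<Longrightarrow> f y = 0 \<or> (\<exists>m<n. level y m)"
      using separate[OF less.prems(2,1)] by blast
    have "0 = f (\<Sum>y\<in>E. u y *\<^sub>R y)"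
      using f(1) by (simp add: sum0 linear_0)
    also have "\<dots> = (\<Sum>y\<in>E. u y * f y)"
      using f(1) by (simp add: linear_sum linear_scale)
    also have "\<dots> = (\<Sum>y\<in>E. if y = x then u x * f x else 0)"
    proof (rule sum.cong)
      fix y assume y: "y \<in> E"
      show "u y * f y = (if y = x then u x * f x else 0)"
        using f(3)[OF y] less.IH y by auto
    qed simp
    also have "\<dots> = u x * f x"
      using fin less.prems(2) by simp
    finally show ?case using f(2) by simp
  qed
  then show "u x = 0" using has_level \<open>x \<in> E\<close> by blast
qed

lemma sym_prod_apply: "(v \<or>\<^sub>V w) (p, q) = v p * w q + w p * v q"
  by (simp add: sym_prod_def tensor_def)

lemma sym_prod_commute: "v \<or>\<^sub>V w = w \<or>\<^sub>V v"
  by (simp add: sym_prod_def add.commute)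

lemma sym_prod_add_right: "u \<or>\<^sub>V (v + w) = (u \<or>\<^sub>V v) + (u \<or>\<^sub>V w)"
  by (auto simp: fun_eq_iff sym_prod_apply algebra_simps)

lemma sym_prod_scaleR_right: "u \<or>\<^sub>V (r *\<^sub>R v) = r *\<^sub>R (u \<or>\<^sub>V v)"
  by (auto simp: fun_eq_iff sym_prod_apply scaleR_fun_def algebra_simps)

lemma sym_prod_minus_right: "u \<or>\<^sub>V (- v) = - (u \<or>\<^sub>V v)"
  by (auto simp: fun_eq_iff sym_prod_apply algebra_simps)

lemma sym_prod_minus_left: "(- u) \<or>\<^sub>V v = - (u \<or>\<^sub>V v)"
  by (auto simp: fun_eq_iff sym_prod_apply algebra_simps)

lemma adj_path_ends: "adj h i \<Longrightarrow> adj i j \<Longrightarrow> h \<noteq> j \<Longrightarrow> cartan h j = 0"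
  by (cases h; cases i; cases j) (auto simp: cartan_def)

lemma cartan_0_iff: "cartan i j = 0 \<longleftrightarrow> i \<noteq> j \<and> \<not> adj i j"
  by (simp add: cartan_def)

text \<open>
  The neighbour on the side of the branch vertex.
\<close>

definition parent :: "arm \<Rightarrow> nat \<Rightarrow> vertex" where
  "parent s p = (case p of 0 \<Rightarrow> Branch | Suc r \<Rightarrow> Node s r)"

lemma adj_Node_iff: "adj (Node s p) x \<longleftrightarrow> x = parent s p \<or> x = Node s (Suc p)"
  by (cases x; cases p) (auto simp: parent_def)

lemma adj_Branch_iff: "adj Branch x \<longleftrightarrow> (\<exists>s. x = Node s 0)"
  by (cases x) auto

lemma parent_neq [simp]: "parent s p \<noteq> Node s p" "parent s p \<noteq> Node s (Suc p)"
  "Node s p \<noteq> parent s p" "Node s (Suc p) \<noteq> parent s p"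
  by (cases p; simp add: parent_def)+

locale Y_diagram =
  fixes a b c :: nat
  assumes arms_nonempty: "a \<ge> 1" "b \<ge> 1" "c \<ge> 1"
begin

abbreviation "V \<equiv> verts a b c"
abbreviation "L \<equiv> arm_length a b c"
abbreviation "B \<equiv> cartan_form a b c"
abbreviation "sref \<equiv> reflection a b c"
abbreviation "act \<equiv> word_act a b c"
abbreviation word_equiv (infix "\<approx>" 50) where "xs \<approx> ys \<equiv> word_eq a b c xs ys"

lemma L_pos: "L s \<ge> 1"
  using arms_nonempty by (cases s) auto

lemma Branch_in_V [simp]: "Branch \<in> V"
  by (simp add: verts_def)

lemma Node_in_V [simp]: "Node s p \<in> V \<longleftrightarrow> p < L s"
  by (simp add: verts_def)

lemma sum_V: "(\<Sum>v\<in>V. f v) = f Branch + (\<Sum>s\<in>UNIV. \<Sum>p<L s. f (Node s p))"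
  for f :: "vertex \<Rightarrow> 'z::comm_monoid_add"
proof -
  let ?N = "(\<lambda>(s, p). Node s p) ` (SIGMA s:UNIV. {..<L s})"
  have V: "V = insert Branch ?N"
    by (auto simp: verts_def)
  have "sum f ?N = (\<Sum>z\<in>(SIGMA s:UNIV. {..<L s}). f (case z of (s, p) \<Rightarrow> Node s p))"
    by (subst sum.reindex) (auto simp: inj_on_def)
  also have "\<dots> = (\<Sum>s\<in>UNIV. \<Sum>p<L s. f (Node s p))"
    by (subst sum.Sigma) (auto intro: sum.cong)
  finally show ?thesis
    unfolding V by (subst sum.insert) auto
qed

lemma root_space_iff: "v \<in> root_space a b c \<longleftrightarrow> (\<forall>x. x \<notin> V \<longrightarrow> v x = 0)"
proof
  assume "v \<in> root_space a b c"
  then have *: "v x = (\<Sum>p\<in>V. v p *\<^sub>R simple_root p) x" for x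
    by (rule fun_cong[OF root_space_expand])
  have "(\<Sum>p\<in>V. v p *\<^sub>R simple_root p) x = 0" if "x \<notin> V" for x
    using that by (auto simp: sum_fun_apply scaleR_fun_def simple_root_def intro!: sum.neutral)
  then show "\<forall>x. x \<notin> V \<longrightarrow> v x = 0"
    using * by metis
next
  assume *: "\<forall>x. x \<notin> V \<longrightarrow> v x = 0"
  have "v = (\<Sum>p\<in>V. v p *\<^sub>R simple_root p)"
  proof
    fix x
    have "(\<Sum>p\<in>V. v p *\<^sub>R simple_root p) x = (\<Sum>p\<in>V. if x = p then v p else 0)"
      unfolding sum_fun_apply by (intro sum.cong) (auto simp: scaleR_fun_def simple_root_def)
    also have "\<dots> = v x"
      using * by simp
    finally show "v x = (\<Sum>p\<in>V. v p *\<^sub>R simple_root p) x"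
      by (rule HOL.sym)
  qed
  then show "v \<in> root_space a b c"
    unfolding root_space_def
    by (rule ssubst[where P = "\<lambda>u. u \<in> span (simple_root ` V)"])
      (intro span_sum span_scale span_base imageI)
qed

lemma root_spaceD: "v \<in> root_space a b c \<Longrightarrow> x \<notin> V \<Longrightarrow> v x = 0"
  by (simp add: root_space_iff)

lemma simple_root_in_root_space: "i \<in> V \<Longrightarrow> simple_root i \<in> root_space a b c"
  by (auto simp: root_space_iff simple_root_def)

section \<open>Coordinates adapted to the three arms\<close>

text \<open>
  Indexing the coefficients on an arm by the distance to the branch vertex, with the branch vertex
  at \<open>0\<close>, lets the three arms share that vertex.
\<close>

definition arm_coeff :: "(vertex \<Rightarrow> real) \<Rightarrow> arm \<Rightarrow> nat \<Rightarrow> real" where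
  "arm_coeff v s k = (case k of 0 \<Rightarrow> v Branch | Suc p \<Rightarrow> v (Node s p))"

text \<open>
  The drops of a vector diagonalize the form up to one square, as the coordinates
  \<open>\<epsilon>\<^sub>1, \<dots>, \<epsilon>\<^sub>n\<close> do in type \<open>A\<close>.
\<close>

definition drop_at :: "(vertex \<Rightarrow> real) \<Rightarrow> arm \<Rightarrow> nat \<Rightarrow> real" where
  "drop_at v s k = arm_coeff v s k - arm_coeff v s (Suc k)"

lemma arm_coeff_0 [simp]: "arm_coeff v s 0 = v Branch"
  and arm_coeff_Suc [simp]: "arm_coeff v s (Suc p) = v (Node s p)"
  by (simp_all add: arm_coeff_def)

lemma arm_coeff_beyond:
  "v \<in> root_space a b c \<Longrightarrow> k > L s \<Longrightarrow> arm_coeff v s k = 0"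
  by (cases k) (auto simp: root_space_iff)

lemma arm_coeff_eq_sum:
  assumes "v \<in> root_space a b c" "k \<le> Suc (L s)"
  shows "arm_coeff v s k = (\<Sum>l=k..L s. drop_at v s l)"
proof -
  have "(\<Sum>l=k..L s. drop_at v s l) = arm_coeff v s k - arm_coeff v s (Suc (L s))"
    using assms(2)
  proof (induction k rule: inc_induct)
    case (step k)
    then show ?case by (simp add: sum.atLeast_Suc_atMost drop_at_def)
  qed simp
  then show ?thesis using assms(1) by (simp add: arm_coeff_beyond del: arm_coeff_Suc)
qed

lemma B_simple_Node:
  assumes "v \<in> root_space a b c" "p < L s"
  shows "B (simple_root (Node s p)) v = drop_at v s (Suc p) - drop_at v s p"
proof -
  define N where "N = {Node s p, Node s (Suc p), (case p of 0 \<Rightarrow> Branch | Suc r \<Rightarrow> Node s r)}"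
  have "B (simple_root (Node s p)) v = (\<Sum>q\<in>V. cartan (Node s p) q * v q)"
    using assms by (simp add: cartan_form_simple_left)
  also have "\<dots> = (\<Sum>q\<in>N. cartan (Node s p) q * v q)"
  proof (rule sum.mono_neutral_cong)
    show "finite N" by (simp add: N_def)
    show "cartan (Node s p) q * v q = 0" if "q \<in> N - V" for q
      using that assms(1) by (simp add: root_spaceD)
    show "cartan (Node s p) q * v q = 0" if "q \<in> V - N" for q
      using that by (cases q; cases p) (auto simp: N_def cartan_def)
  qed auto
  also have "\<dots> = drop_at v s (Suc p) - drop_at v s p"
    by (cases p) (auto simp: N_def cartan_def drop_at_def)
  finally show ?thesis .
qed

lemma B_simple_Branch:
  assumes "v \<in> root_space a b c"
  shows "B (simple_root Branch) v = (\<Sum>s\<in>UNIV. drop_at v s 0) - v Branch"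
proof -
  define N where "N = {Branch, Node Arm1 0, Node Arm2 0, Node Arm3 0}"
  have "B (simple_root Branch) v = (\<Sum>q\<in>V. cartan Branch q * v q)"
    using assms by (simp add: cartan_form_simple_left)
  also have "\<dots> = (\<Sum>q\<in>N. cartan Branch q * v q)"
  proof (rule sum.mono_neutral_cong)
    show "finite N" by (simp add: N_def)
    show "cartan Branch q * v q = 0" if "q \<in> N - V" for q
      using that assms(1) by (simp add: root_spaceD)
    show "cartan Branch q * v q = 0" if "q \<in> V - N" for q
    proof (cases q)
      case (Node s p)
      with that show ?thesis by (cases s) (auto simp: N_def cartan_def)
    qed (use that in \<open>auto simp: N_def\<close>)
  qed auto
  also have "\<dots> = (\<Sum>s\<in>UNIV. drop_at v s 0) - v Branch"
    by (auto simp: N_def cartan_def drop_at_def sum_arms)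
  finally show ?thesis .
qed

text \<open>
  Summation by parts along each arm. The branch vertex contributes a square for each of the three
  arms, one more than the two in its own norm; this is the negative term.
\<close>

lemma B_eq_drops:
  assumes "v \<in> root_space a b c" "w \<in> root_space a b c"
  shows "B v w = (\<Sum>s\<in>UNIV. \<Sum>k\<le>L s. drop_at v s k * drop_at w s k) - v Branch * w Branch"
proof -
  have "B v w = (\<Sum>p\<in>V. v p * B (simple_root p) w)"
    unfolding cartan_form_def[of a b c v w]
  proof (rule sum.cong)
    show "(\<Sum>q\<in>V. cartan p q * v p * w q) = v p * B (simple_root p) w" if "p \<in> V" for p
      using that by (simp only: cartan_form_simple_left sum_distrib_left) (simp add: mult_ac)
  qed simp
  also have "\<dots> = v Branch * ((\<Sum>s\<in>UNIV. drop_at w s 0) - w Branch) +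
      (\<Sum>s\<in>UNIV. \<Sum>p<L s. v (Node s p) * (drop_at w s (Suc p) - drop_at w s p))"
    using assms by (simp add: sum_V B_simple_Branch B_simple_Node)
  also have "(\<Sum>s\<in>UNIV. \<Sum>p<L s. v (Node s p) * (drop_at w s (Suc p) - drop_at w s p)) =
      (\<Sum>s\<in>UNIV. (\<Sum>k\<le>L s. drop_at v s k * drop_at w s k) - v Branch * drop_at w s 0)"
  proof (rule sum.cong)
    fix s :: arm
    have "(\<Sum>k\<le>n. drop_at v s k * drop_at w s k) = v Branch * drop_at w s 0 +
      (\<Sum>p<n. v (Node s p) * (drop_at w s (Suc p) - drop_at w s p))
      - arm_coeff v s (Suc n) * drop_at w s n" for n
      by (induction n) (simp_all add: drop_at_def algebra_simps)
    from this[of "L s"] show "(\<Sum>p<L s. v (Node s p) * (drop_at w s (Suc p) - drop_at w s p)) =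
      (\<Sum>k\<le>L s. drop_at v s k * drop_at w s k) - v Branch * drop_at w s 0"
      using arm_coeff_beyond[OF assms(1), of s "Suc (L s)"] by simp
  qed simp
  finally show ?thesis
    by (simp add: sum_subtractf sum_distrib_left algebra_simps)
qed

lemma B_sym: "B v w = B w v"
  unfolding cartan_form_def
  by (subst sum.swap) (simp add: cartan_sym mult_ac)

lemma B_diff_left: "B (v - w) u = B v u - B w u"
  by (metis B_sym cartan_form_diff_right)

lemma B_scaleR_left: "B (r *\<^sub>R v) u = r * B v u"
  by (metis B_sym cartan_form_scaleR_right)

lemma B_reflection:
  assumes "i \<in> V"
  shows "B (sref i v) (sref i w) = B v w"
proof -
  have "B (simple_root i) (simple_root i) = 2"
    using assms by (simp add: cartan_form_simple_simple cartan_def)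
  then show ?thesis
    by (simp add: reflection_def B_diff_left cartan_form_diff_right B_scaleR_left
        cartan_form_scaleR_right B_sym[of v "simple_root i"])
qed

lemma act_Nil [simp]: "act [] v = v"
  and act_Cons [simp]: "act (i # xs) v = sref i (act xs v)"
  and act_append [simp]: "act (xs @ ys) v = act xs (act ys v)"
  by (simp_all add: word_act_def)

lemma B_act: "xs \<in> lists V \<Longrightarrow> B (act xs v) (act xs w) = B v w"
  by (induction xs) (auto simp: B_reflection)

lemma reflection_apply: "sref i v x = v x - (if x = i then B (simple_root i) v else 0)"
  by (simp add: reflection_def scaleR_fun_def simple_root_def)

lemma reflection_in_root_space: "i \<in> V \<Longrightarrow> v \<in> root_space a b c \<Longrightarrow> sref i v \<in> root_space a b c"
  by (auto simp: root_space_iff reflection_apply)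

lemma act_in_root_space:
  "xs \<in> lists V \<Longrightarrow> v \<in> root_space a b c \<Longrightarrow> act xs v \<in> root_space a b c"
  by (induction xs) (auto simp: reflection_in_root_space)

lemma reflection_simple_self: "i \<in> V \<Longrightarrow> sref i (simple_root i) = - simple_root i"
proof
  show "sref i (simple_root i) x = (- simple_root i) x" if "i \<in> V" for x
    using that cartan_form_simple_simple[of i a b c i]
    by (cases "x = i") (simp_all add: reflection_apply cartan_def, simp_all add: simple_root_def)
qed

lemma reflection_simple:
  "i \<in> V \<Longrightarrow> j \<in> V \<Longrightarrow> sref i (simple_root j) = simple_root j - cartan i j *\<^sub>R simple_root i"
  by (simp add: reflection_def cartan_form_simple_simple)

text \<open>
  The vertices of an arm act by adjacent transpositions of the drops on that arm. All later
  arguments that move a drop along its arm rest on this.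
\<close>

lemma drop_at_reflection_Node:
  assumes "v \<in> root_space a b c" "p < L s"
  shows "drop_at (sref (Node s p) v) t k =
    (if t = s \<and> k = p then drop_at v s (Suc p)
     else if t = s \<and> k = Suc p then drop_at v s p else drop_at v t k)"
proof -
  have "arm_coeff (sref (Node s p) v) t k =
      arm_coeff v t k - (if t = s \<and> k = Suc p then drop_at v s (Suc p) - drop_at v s p else 0)" for k
    using assms by (cases k) (auto simp: reflection_apply B_simple_Node)
  then show ?thesis
    unfolding drop_at_def[of "sref (Node s p) v"] by (simp add: drop_at_def del: arm_coeff_Suc)
qed

lemma drop_at_reflection_Branch:
  assumes "v \<in> root_space a b c"
  shows "drop_at (sref Branch v) t k =
    (if k = 0 then drop_at v t 0 - ((\<Sum>s\<in>UNIV. drop_at v s 0) - v Branch) else drop_at v t k)"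
proof -
  have "arm_coeff (sref Branch v) t k =
      arm_coeff v t k - (if k = 0 then (\<Sum>s\<in>UNIV. drop_at v s 0) - v Branch else 0)" for k
    using assms by (cases k) (auto simp: reflection_apply B_simple_Branch)
  then show ?thesis
    unfolding drop_at_def[of "sref Branch v"] by (simp add: drop_at_def del: arm_coeff_Suc)
qed

section \<open>Sign coherence of real roots\<close>

definition word_length :: "vertex list \<Rightarrow> nat" where
  "word_length xs = (LEAST n. \<exists>ys. xs \<approx> ys \<and> length ys = n)"

lemma word_equiv_lists: "xs \<approx> ys \<Longrightarrow> xs \<in> lists V \<and> ys \<in> lists V"
  by (rule word_eq_lists)

lemma word_equiv_append_right: "xs \<approx> ys \<Longrightarrow> zs \<in> lists V \<Longrightarrow> xs @ zs \<approx> ys @ zs"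
  by (intro word_eq.append word_eq.refl)

lemma word_equiv_append_left: "xs \<approx> ys \<Longrightarrow> zs \<in> lists V \<Longrightarrow> zs @ xs \<approx> zs @ ys"
  by (intro word_eq.append word_eq.refl)

lemma word_equiv_parity: "xs \<approx> ys \<Longrightarrow> even (length xs) = even (length ys)"
  by (induction rule: word_eq.induct) auto

lemma reduced_word:
  assumes "xs \<in> lists V"
  obtains ys where "xs \<approx> ys" "length ys = word_length xs"
  using LeastI_ex[of "\<lambda>n. \<exists>ys. xs \<approx> ys \<and> length ys = n"] word_eq.refl[OF assms]
  unfolding word_length_def by blast

lemma word_length_le: "xs \<approx> ys \<Longrightarrow> word_length xs \<le> length ys"
  unfolding word_length_def by (rule Least_le) blast

lemma word_length_cong:
  assumes "xs \<approx> ys"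
  shows "word_length xs = word_length ys"
proof -
  have "xs \<approx> zs \<longleftrightarrow> ys \<approx> zs" for zs
    using assms by (meson word_eq.sym word_eq.trans)
  then show ?thesis unfolding word_length_def by simp
qed

lemma word_length_parity: "xs \<in> lists V \<Longrightarrow> even (word_length xs) = even (length xs)"
  by (metis reduced_word word_equiv_parity)

lemma word_length_snoc_le:
  assumes "xs \<in> lists V" "i \<in> V"
  shows "word_length (xs @ [i]) \<le> Suc (word_length xs)"
proof -
  obtain ys where "xs \<approx> ys" "length ys = word_length xs"
    using assms(1) by (rule reduced_word)
  then show ?thesis
    using word_length_le[OF word_equiv_append_right[of xs ys "[i]"]] assms(2) by simp
qed

lemma snoc_snoc_equiv:
  assumes "xs \<in> lists V" "i \<in> V"
  shows "xs @ [i, i] \<approx> xs"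
  using word_equiv_append_left[OF word_eq.involution[OF assms(2)] assms(1)] by simp

lemma word_length_le_snoc:
  assumes "xs \<in> lists V" "i \<in> V"
  shows "word_length xs \<le> Suc (word_length (xs @ [i]))"
  using word_length_snoc_le[of "xs @ [i]" i] word_length_cong[OF snoc_snoc_equiv[OF assms]] assms
  by simp

text \<open>
  The Coxeter relations preserve the parity of the length of a word, so multiplication by a
  generator changes the length by exactly one.
\<close>

lemma word_length_snoc:
  assumes "xs \<in> lists V" "i \<in> V"
  shows "word_length (xs @ [i]) = Suc (word_length xs) \<or> word_length xs = Suc (word_length (xs @ [i]))"
proof -
  have "word_length (xs @ [i]) \<noteq> word_length xs"
    using word_length_parity[of xs] word_length_parity[of "xs @ [i]"] assms by auto
  then show ?thesis
    using word_length_snoc_le[OF assms] word_length_le_snoc[OF assms] by linarith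
qed

definition nonneg :: "(vertex \<Rightarrow> real) \<Rightarrow> bool" where
  "nonneg v \<longleftrightarrow> (\<forall>x. v x \<ge> 0)"

lemma nonneg_add: "nonneg v \<Longrightarrow> nonneg w \<Longrightarrow> nonneg (v + w)"
  by (simp add: nonneg_def)

lemma act_add: "act xs (v + w) = act xs v + act xs w"
  using linear_word_act by (rule linear_add)

lemma act_minus: "act xs (- v) = - act xs v"
  using linear_word_act by (rule linear_neg)

text \<open>
  The classical induction on the length of \<open>w\<close>. Let \<open>s\<^sub>j\<close> be the last letter of a reduced word for
  \<open>w = v s\<^sub>j\<close>. If \<open>s\<^sub>i\<close> and \<open>s\<^sub>j\<close> commute, then \<open>w \<alpha>\<^sub>i = v \<alpha>\<^sub>i\<close>. Otherwise
  \<open>w \<alpha>\<^sub>i = v \<alpha>\<^sub>i + v \<alpha>\<^sub>j\<close>, which settles the case that \<open>v s\<^sub>i\<close> is longer than \<open>v\<close>; if it is shorter, so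
  that \<open>v = u s\<^sub>i\<close>, then \<open>w \<alpha>\<^sub>i = u \<alpha>\<^sub>j\<close>, and the braid relation shows that \<open>u s\<^sub>j\<close> is longer than \<open>u\<close>.
\<close>

lemma act_simple_nonneg:
  assumes "xs \<in> lists V" "i \<in> V" "word_length xs < word_length (xs @ [i])"
  shows "nonneg (act xs (simple_root i))"
  using assms
proof (induction "word_length xs" arbitrary: xs i rule: less_induct)
  case less
  note xs = less.prems(1) and i = less.prems(2) and up = less.prems(3)
  obtain zs where zs: "xs \<approx> zs" "length zs = word_length xs"
    using xs by (rule reduced_word)
  have act_zs: "act xs = act zs"
    using zs(1) by (rule word_act_cong)
  show ?case
  proof (cases zs rule: rev_cases)
    case Nil
    then show ?thesis by (simp add: act_zs nonneg_def simple_root_def)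
  next
    case (snoc ys j)
    have ys: "ys \<in> lists V" and j: "j \<in> V"
      using word_equiv_lists[OF zs(1)] snoc by auto
    have len_zs: "word_length (ys @ [j]) = word_length xs"
      using word_length_cong[OF zs(1)] snoc by simp
    have len_zsi: "word_length (ys @ [j, i]) = Suc (word_length xs)"
    proof -
      have "word_length (ys @ [j, i]) = word_length (xs @ [i])"
        using word_length_cong[OF word_equiv_append_right[OF zs(1), of "[i]"]] i snoc by simp
      then show ?thesis
        using word_length_snoc[OF xs i] up by simp
    qed
    have len_ys: "Suc (word_length ys) = word_length xs"
      using word_length_le[OF word_eq.refl[OF ys]] zs(2) snoc word_length_snoc[OF ys j] len_zs
      by simp
    have pos: "nonneg (act us (simple_root k))"
      if "us \<in> lists V" "k \<in> V" "word_length us < word_length xs"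
        "word_length us < word_length (us @ [k])" for us k
      using less.hyps that by blast
    have act_xs: "act xs v = act ys (sref j v)" for v
      by (simp add: act_zs snoc)
    have "i \<noteq> j"
    proof
      assume "i = j"
      then have "word_length (ys @ [j, i]) = word_length ys"
        using word_length_cong[OF snoc_snoc_equiv[OF ys j]] by simp
      with len_zsi len_ys show False by simp
    qed
    then have "cartan j i = 0 \<or> cartan j i = - 1"
      by (auto simp: cartan_def)
    then show ?thesis
    proof
      assume 0: "cartan j i = 0"
      have "ys @ [j, i] \<approx> ys @ [i, j]"
        using word_equiv_append_left[OF word_eq.commutation[OF j i 0] ys] .
      then have "word_length (ys @ [i, j]) = Suc (word_length xs)"
        using len_zsi word_length_cong by simp
      then have "word_length xs \<le> word_length (ys @ [i])"
        using word_length_snoc_le[of "ys @ [i]" j] ys i j by simp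
      then have "nonneg (act ys (simple_root i))"
        using pos[OF ys i] len_ys by simp
      then show ?thesis
        using 0 i j by (simp add: act_xs reflection_simple)
    next
      assume m1: "cartan j i = - 1"
      then have m1': "cartan i j = - 1" by (simp add: cartan_sym)
      have sj: "act xs (simple_root i) = act ys (simple_root i) + act ys (simple_root j)"
        using m1 i j by (simp add: act_xs reflection_simple act_add)
      have nj: "nonneg (act ys (simple_root j))"
        using pos[OF ys j] len_ys len_zs by simp
      show ?thesis
      proof (cases "word_length ys < word_length (ys @ [i])")
        case True
        then show ?thesis
          unfolding sj using pos[OF ys i] len_ys nj by (simp add: nonneg_add)
      next
        case False
        define us where "us = ys @ [i]"
        have us: "us \<in> lists V" using ys i by (simp add: us_def)
        have len_us: "Suc (word_length us) = word_length ys"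
          using False word_length_snoc[OF ys i] by (auto simp: us_def)
        have "act ys v = act us (sref i v)" for v
          using word_act_cong[OF snoc_snoc_equiv[OF ys i]] by (simp add: us_def fun_eq_iff)
        then have eq: "act xs (simple_root i) = act us (simple_root j)"
          using m1' i j unfolding sj
          by (simp add: reflection_simple[of i j] reflection_simple_self act_add act_minus)
        have braid: "us @ [j, i, j] \<approx> ys @ [j, i]"
        proof -
          have "us @ [j, i, j] \<approx> us @ [i, j, i]"
            by (intro word_equiv_append_left word_eq.braid i j us m1)
          moreover have "us @ [i, j, i] \<approx> ys @ [j, i]"
            using word_equiv_append_right[OF snoc_snoc_equiv[OF ys i], of "[j, i]"] i j
            by (simp add: us_def)
          ultimately show ?thesis by (rule word_eq.trans)
        qed
        have "word_length (us @ [j, i, j]) = Suc (word_length xs)"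
          using word_length_cong[OF braid] len_zsi by simp
        then have "word_length us < word_length (us @ [j])"
          using word_length_snoc_le[of "us @ [j, i]" j] word_length_snoc_le[of "us @ [j]" i]
            us i j len_us len_ys by simp
        then show ?thesis
          unfolding eq using pos[OF us j] len_us len_ys by simp
      qed
    qed
  qed
qed

definition real_roots :: "(vertex \<Rightarrow> real) set" where
  "real_roots = {act xs (simple_root i) | xs i. xs \<in> lists V \<and> i \<in> V}"

lemma real_rootE:
  assumes "\<alpha> \<in> real_roots"
  obtains xs i where "\<alpha> = act xs (simple_root i)" "xs \<in> lists V" "i \<in> V"
  using assms unfolding real_roots_def by blast

lemma simple_root_real: "i \<in> V \<Longrightarrow> simple_root i \<in> real_roots"
  unfolding real_roots_def by (rule CollectI, rule exI[of _ "[]"]) auto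

lemma act_real_root:
  assumes "xs \<in> lists V" "\<alpha> \<in> real_roots"
  shows "act xs \<alpha> \<in> real_roots"
proof -
  obtain ys i where "\<alpha> = act ys (simple_root i)" "ys \<in> lists V" "i \<in> V"
    using assms(2) by (rule real_rootE)
  then have "act xs \<alpha> = act (xs @ ys) (simple_root i)" "xs @ ys \<in> lists V" "i \<in> V"
    using assms(1) by auto
  then show ?thesis unfolding real_roots_def by blast
qed

lemma reflection_real_root: "i \<in> V \<Longrightarrow> \<alpha> \<in> real_roots \<Longrightarrow> sref i \<alpha> \<in> real_roots"
  using act_real_root[of "[i]" \<alpha>] by simp

lemma minus_real_root:
  assumes "\<alpha> \<in> real_roots"
  shows "- \<alpha> \<in> real_roots"
proof -
  obtain ys i where ys: "\<alpha> = act ys (simple_root i)" "ys \<in> lists V" "i \<in> V"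
    using assms by (rule real_rootE)
  then have "- \<alpha> = act (ys @ [i]) (simple_root i)" "ys @ [i] \<in> lists V"
    by (simp_all add: reflection_simple_self act_minus)
  then show ?thesis using ys(3) unfolding real_roots_def by blast
qed

lemma real_root_in_root_space: "\<alpha> \<in> real_roots \<Longrightarrow> \<alpha> \<in> root_space a b c"
  by (erule real_rootE) (simp only: act_in_root_space simple_root_in_root_space)

lemma real_root_norm: "\<alpha> \<in> real_roots \<Longrightarrow> B \<alpha> \<alpha> = 2"
  by (erule real_rootE) (simp only: B_act cartan_form_simple_simple, simp add: cartan_def)

lemma real_root_sign:
  assumes "\<alpha> \<in> real_roots"
  shows "nonneg \<alpha> \<or> nonneg (- \<alpha>)"
proof -
  obtain ys i where ys: "\<alpha> = act ys (simple_root i)" "ys \<in> lists V" "i \<in> V"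
    using assms by (rule real_rootE)
  show ?thesis
  proof (cases "word_length ys < word_length (ys @ [i])")
    case True
    then show ?thesis using ys act_simple_nonneg by blast
  next
    case False
    have "word_length ((ys @ [i]) @ [i]) = word_length ys"
      using word_length_cong[OF snoc_snoc_equiv[OF ys(2,3)]] by simp
    moreover have "word_length (ys @ [i]) < word_length ys"
      using False word_length_snoc[OF ys(2,3)] by auto
    ultimately have "nonneg (act (ys @ [i]) (simple_root i))"
      using ys by (intro act_simple_nonneg) auto
    then show ?thesis
      using ys by (simp add: reflection_simple_self act_minus)
  qed
qed

lemma real_root_integral:
  assumes "\<alpha> \<in> real_roots"
  shows "\<alpha> x \<in> \<int>"
proof -
  have cart: "cartan p q \<in> \<int>" for p q by (simp add: cartan_def)
  have "act xs (simple_root i) x \<in> \<int>" if "xs \<in> lists V" for xs i x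
    using that
  proof (induction xs arbitrary: x rule: list.induct)
    case (Cons j xs)
    then have IH: "act xs (simple_root i) y \<in> \<int>" for y by auto
    have "B (simple_root j) (act xs (simple_root i)) \<in> \<int>"
    proof -
      have "j \<in> V" using Cons.prems by simp
      then show ?thesis
        by (simp add: cartan_form_simple_left Ints_sum Ints_mult cart IH)
    qed
    then show ?case
      by (auto simp: reflection_apply intro!: IH Ints_diff)
  qed (simp add: simple_root_def)
  with assms show ?thesis by (metis real_rootE)
qed

section \<open>Real roots in the adapted coordinates\<close>

lemma sum_drops:
  assumes "v \<in> root_space a b c"
  shows "(\<Sum>k\<le>L s. drop_at v s k) = v Branch"
  using arm_coeff_eq_sum[OF assms, of 0 s] by (simp add: atLeast0AtMost)

lemma drop_at_minus: "drop_at (- v) s k = - drop_at v s k"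
  by (cases k) (simp_all add: drop_at_def)

lemma drop_at_integral: "\<alpha> \<in> real_roots \<Longrightarrow> drop_at \<alpha> s k \<in> \<int>"
  by (cases k) (simp_all add: drop_at_def Ints_diff real_root_integral)

lemma reflection_Node_Branch: "sref (Node s p) v Branch = v Branch"
  by (simp add: reflection_apply)

lemma reflection_Branch_Branch:
  "v \<in> root_space a b c \<Longrightarrow> sref Branch v Branch = 2 * v Branch - (\<Sum>s\<in>UNIV. drop_at v s 0)"
  by (simp add: reflection_apply B_simple_Branch)

lemma third_arm:
  fixes s t :: arm
  assumes "s \<noteq> t"
  obtains u where "u \<noteq> s" "u \<noteq> t"
    "\<And>f :: arm \<Rightarrow> real. (\<Sum>r\<in>UNIV. f r) = f s + f t + f u"
proof -
  have "\<exists>u. u \<noteq> s \<and> u \<noteq> t"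
    by (cases s; cases t) (metis arm.distinct)+
  then obtain u where u: "u \<noteq> s" "u \<noteq> t" by blast
  have "(\<Sum>r\<in>UNIV. f r) = f s + f t + f u" for f :: "arm \<Rightarrow> real"
    using assms u by (cases s; cases t; cases u) (simp_all add: sum_arms)
  with u show ?thesis using that by blast
qed

text \<open>
  At the leaf the drop is a coefficient of \<open>\<alpha>\<close>, and \<open>\<alpha>\<close> is a positive root. Any other drop is moved
  towards the leaf by reflections that do not change the branch coefficient.
\<close>

lemma drop_nonneg:
  assumes "\<alpha> \<in> real_roots" "\<alpha> Branch > 0" "k \<le> L s"
  shows "drop_at \<alpha> s k \<ge> 0"
  using assms(3,1,2)
proof (induction k arbitrary: \<alpha> rule: inc_induct)
  case base
  have "nonneg \<alpha>"
  proof -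
    have "\<not> nonneg (- \<alpha>)"
      using base(2) by (auto simp: nonneg_def not_le intro!: exI[of _ Branch])
    then show ?thesis using real_root_sign[OF base(1)] by blast
  qed
  then have "arm_coeff \<alpha> s (L s) \<ge> 0"
    by (cases "L s") (auto simp: nonneg_def)
  then show ?case
    using arm_coeff_beyond[OF real_root_in_root_space[OF base(1)], of s "Suc (L s)"]
    by (simp add: drop_at_def)
next
  case (step k)
  let ?\<beta> = "sref (Node s k) \<alpha>"
  have "drop_at ?\<beta> s (Suc k) \<ge> 0"
    using step.prems step.hyps
    by (intro step.IH reflection_real_root) (simp_all add: reflection_Node_Branch)
  then show ?case
    using step by (simp add: drop_at_reflection_Node real_root_in_root_space)
qed

lemma Ints_le_power2:
  fixes x :: real
  assumes "x \<in> \<int>"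
  shows "x \<le> x\<^sup>2"
proof -
  obtain n where n: "x = of_int n" using assms by (rule Ints_cases)
  have "n \<le> n\<^sup>2"
    by (smt (verit) mult_le_cancel_left1 power2_eq_square zero_le_power2)
  then have "real_of_int n \<le> real_of_int (n\<^sup>2)"
    by (simp only: of_int_le_iff)
  then show ?thesis by (simp add: n)
qed

lemma Ints_pos_ge1: "(x::real) \<in> \<int> \<Longrightarrow> x > 0 \<Longrightarrow> x \<ge> 1"
  by (elim Ints_cases) simp

text \<open>
  Let \<open>u\<close> be the third arm and \<open>\<beta> = s\<^sub>0 \<alpha>\<close>, where \<open>s\<^sub>0\<close> is the reflection in the branch vertex. The
  first drop of \<open>\<beta>\<close> on \<open>u\<close> is at most \<open>-1\<close>, and the drops on \<open>u\<close> add up to \<open>0\<close>, so this arm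
  already accounts for the whole norm \<open>2\<close>. Hence the drops on the other two arms vanish.
\<close>

lemma exceptional_base_height0:
  assumes \<alpha>: "\<alpha> \<in> real_roots" and A: "\<alpha> Branch > 0" and "s \<noteq> t"
    and big: "drop_at \<alpha> s 0 + drop_at \<alpha> t 0 > \<alpha> Branch"
    and zero: "sref Branch \<alpha> Branch = 0"
  shows "\<alpha> Branch = 1 \<and> drop_at \<alpha> s 0 = 1 \<and> drop_at \<alpha> t 0 = 1"
proof -
  obtain u where u: "u \<noteq> s" "u \<noteq> t"
    and sum3: "\<And>f :: arm \<Rightarrow> real. (\<Sum>r\<in>UNIV. f r) = f s + f t + f u"
    using third_arm[OF \<open>s \<noteq> t\<close>] by metis
  note rs = real_root_in_root_space
  define \<beta> where "\<beta> = sref Branch \<alpha>"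
  have \<beta>: "\<beta> \<in> real_roots" unfolding \<beta>_def using \<alpha> by (simp add: reflection_real_root)
  have drop0: "drop_at \<beta> r 0 = drop_at \<alpha> r 0 - \<alpha> Branch" for r
    using zero \<alpha> unfolding \<beta>_def
    by (simp add: drop_at_reflection_Branch reflection_Branch_Branch rs)
  have total: "drop_at \<alpha> s 0 + drop_at \<alpha> t 0 + drop_at \<alpha> u 0 = 2 * \<alpha> Branch"
    using zero \<alpha> by (simp add: reflection_Branch_Branch rs sum3)
  define N where "N r = (\<Sum>k\<le>L r. (drop_at \<beta> r k)\<^sup>2)" for r
  have norm: "N s + N t + N u = 2"
    using real_root_norm[OF \<beta>] zero \<beta>
    by (simp add: B_eq_drops rs N_def sum3 power2_eq_square flip: \<beta>_def)
  have split: "(\<Sum>k\<le>L r. f k) = f 0 + (\<Sum>k=1..L r. f k)" for r and f :: "nat \<Rightarrow> real"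
    by (simp add: atMost_atLeast0 sum.atLeast_Suc_atMost)
  have N0: "N r \<ge> (drop_at \<beta> r 0)\<^sup>2" for r
    unfolding N_def split by (simp add: sum_nonneg)
  have le: "drop_at \<beta> u 0 \<le> - 1"
  proof -
    have "- drop_at \<beta> u 0 > 0" using big total by (simp add: drop0)
    moreover have "- drop_at \<beta> u 0 \<in> \<int>" using drop_at_integral[OF \<beta>] by (rule Ints_minus)
    ultimately show ?thesis using Ints_pos_ge1[of "- drop_at \<beta> u 0"] by linarith
  qed
  have "(\<Sum>k=1..L u. drop_at \<beta> u k) = - drop_at \<beta> u 0"
    using sum_drops[OF rs[OF \<beta>], of u] zero unfolding split by (simp flip: \<beta>_def)
  moreover have "(\<Sum>k=1..L u. drop_at \<beta> u k) \<le> (\<Sum>k=1..L u. (drop_at \<beta> u k)\<^sup>2)"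
    by (intro sum_mono Ints_le_power2 drop_at_integral \<beta>)
  ultimately have Nu: "N u \<ge> (drop_at \<beta> u 0)\<^sup>2 - drop_at \<beta> u 0"
    unfolding N_def split by simp
  have sq1: "(drop_at \<beta> u 0)\<^sup>2 \<ge> 1"
    using le mult_mono[of 1 "- drop_at \<beta> u 0" 1 "- drop_at \<beta> u 0"] by (simp add: power2_eq_square)
  have "(drop_at \<beta> s 0)\<^sup>2 \<le> 0" "(drop_at \<beta> t 0)\<^sup>2 \<le> 0" and u1: "drop_at \<beta> u 0 \<ge> - 1"
    using norm Nu N0[of s] N0[of t] le sq1 zero_le_power2[of "drop_at \<beta> s 0"]
      zero_le_power2[of "drop_at \<beta> t 0"]
    by linarith+
  then have "drop_at \<beta> s 0 = 0" "drop_at \<beta> t 0 = 0" by simp_all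
  then show ?thesis
    using u1 le total by (simp add: drop0)
qed

text \<open>
  The reflected root has a negative first drop on the third arm \<open>u\<close>, so its branch coefficient is not
  positive. If it is negative, all other drops on \<open>u\<close> vanish; swapping the first two drops on \<open>u\<close>,
  which is possible because the arm is nonempty, leads to a root with the same properties whose
  reflection has branch coefficient \<open>0\<close>.
\<close>

lemma exceptional_base:
  assumes \<alpha>: "\<alpha> \<in> real_roots" and A: "\<alpha> Branch > 0" and "s \<noteq> t"
    and big: "drop_at \<alpha> s 0 + drop_at \<alpha> t 0 > \<alpha> Branch"
  shows "\<alpha> Branch = 1 \<and> drop_at \<alpha> s 0 = 1 \<and> drop_at \<alpha> t 0 = 1"
proof (cases "sref Branch \<alpha> Branch = 0")
  case True
  then show ?thesis using exceptional_base_height0 assms by blast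
next
  case False
  obtain u where u: "u \<noteq> s" "u \<noteq> t"
    and sum3: "\<And>f :: arm \<Rightarrow> real. (\<Sum>r\<in>UNIV. f r) = f s + f t + f u"
    using third_arm[OF \<open>s \<noteq> t\<close>] by metis
  note rs = real_root_in_root_space
  have Branch_neg: "\<not> sref Branch \<gamma> Branch > 0"
    if "\<gamma> \<in> real_roots" "drop_at \<gamma> s 0 + drop_at \<gamma> t 0 > \<gamma> Branch" for \<gamma>
  proof
    assume "sref Branch \<gamma> Branch > 0"
    then have "drop_at (sref Branch \<gamma>) u 0 \<ge> 0"
      using that by (intro drop_nonneg reflection_real_root) auto
    then show False
      using that by (simp add: drop_at_reflection_Branch rs sum3)
  qed
  have neg: "sref Branch \<gamma> Branch < 0 \<Longrightarrow> drop_at \<gamma> u k \<le> 0"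
    if "\<gamma> \<in> real_roots" "k \<ge> 1" "k \<le> L u" for \<gamma> k
  proof -
    assume "sref Branch \<gamma> Branch < 0"
    then have "drop_at (- sref Branch \<gamma>) u k \<ge> 0"
      using that by (intro drop_nonneg minus_real_root reflection_real_root) auto
    then show ?thesis
      using that by (simp add: drop_at_reflection_Branch rs drop_at_minus)
  qed
  have lt: "sref Branch \<alpha> Branch < 0"
    using Branch_neg[OF \<alpha> big] False by linarith
  have "drop_at \<alpha> u k = 0" if "k \<ge> 1" "k \<le> L u" for k
    using neg[OF \<alpha> that lt] drop_nonneg[OF \<alpha> A that(2)] by simp
  moreover have "(\<Sum>k\<le>L u. drop_at \<alpha> u k) = drop_at \<alpha> u 0 + (\<Sum>k=1..L u. drop_at \<alpha> u k)"
    by (simp add: atMost_atLeast0 sum.atLeast_Suc_atMost)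
  ultimately have u0: "drop_at \<alpha> u 0 = \<alpha> Branch"
    using sum_drops[OF rs[OF \<alpha>], of u] by simp
  define \<gamma> where "\<gamma> = sref (Node u 0) \<alpha>"
  have u_pos: "0 < L u" using L_pos[of u] by simp
  have \<gamma>: "\<gamma> \<in> real_roots" unfolding \<gamma>_def using \<alpha> u_pos by (simp add: reflection_real_root)
  have \<gamma>_Branch: "\<gamma> Branch = \<alpha> Branch"
    by (simp add: \<gamma>_def reflection_Node_Branch)
  have \<gamma>_drop: "drop_at \<gamma> s 0 = drop_at \<alpha> s 0" "drop_at \<gamma> t 0 = drop_at \<alpha> t 0"
    "drop_at \<gamma> u 1 = \<alpha> Branch"
    using \<alpha> u u_pos u0 by (simp_all add: \<gamma>_def drop_at_reflection_Node rs)
  have big': "drop_at \<gamma> s 0 + drop_at \<gamma> t 0 > \<gamma> Branch"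
    using big by (simp add: \<gamma>_Branch \<gamma>_drop)
  have "\<not> sref Branch \<gamma> Branch < 0"
    using neg[OF \<gamma>, of 1] u_pos A \<gamma>_drop(3) by auto
  then have "sref Branch \<gamma> Branch = 0"
    using Branch_neg[OF \<gamma> big'] by simp
  then show ?thesis
    using exceptional_base_height0[OF \<gamma> _ \<open>s \<noteq> t\<close> big'] A by (simp add: \<gamma>_Branch \<gamma>_drop)
qed

text \<open>
  The exceptional roots have branch coefficient \<open>1\<close> and a single nonzero drop on each arm, equal to
  \<open>1\<close>; the simple root of the branch vertex is one of them. The two drops in question are moved to
  the branch vertex.
\<close>

lemma exceptional:
  assumes "\<alpha> \<in> real_roots" "\<alpha> Branch > 0" and "s \<noteq> t" "l \<le> L s" "m \<le> L t"
    and "drop_at \<alpha> s l + drop_at \<alpha> t m > \<alpha> Branch"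
  shows "\<alpha> Branch = 1 \<and> drop_at \<alpha> s l = 1 \<and> drop_at \<alpha> t m = 1"
  using assms
proof (induction l arbitrary: \<alpha>)
  case 0
  then show ?case
  proof (induction m arbitrary: \<alpha>)
    case 0
    then show ?case using exceptional_base by blast
  next
    case (Suc m)
    then show ?case
      using Suc.IH[of "sref (Node t m) \<alpha>"]
      by (simp add: drop_at_reflection_Node real_root_in_root_space reflection_real_root
          reflection_Node_Branch)
  qed
next
  case (Suc l)
  then show ?case
    using Suc.IH[of "sref (Node s l) \<alpha>"]
    by (simp add: drop_at_reflection_Node real_root_in_root_space reflection_real_root
        reflection_Node_Branch)
qed

text \<open>
  The drops are integers with sum of squares \<open>2\<close> and sum \<open>0\<close> on each arm: as in type \<open>A\<close> the root is
  \<open>\<epsilon>\<^sub>i - \<epsilon>\<^sub>j\<close> on one arm. The negative drop lies closer to the branch vertex since the coefficients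
  of \<open>\<alpha>\<close> are nonnegative.
\<close>

lemma height0_root:
  assumes \<alpha>: "\<alpha> \<in> real_roots" and "nonneg \<alpha>" and zero: "\<alpha> Branch = 0"
  obtains s i j where "j < i" "i \<le> L s"
    "\<And>t k. k \<le> L t \<Longrightarrow> drop_at \<alpha> t k =
      (if t = s then if k = i then 1 else if k = j then - 1 else 0 else 0)"
proof -
  note rs = real_root_in_root_space[OF \<alpha>]
  define S where "S = (SIGMA s:(UNIV :: arm set). {..L s})"
  define x where "x z = drop_at \<alpha> (fst z) (snd z)" for z
  have fin: "finite S" by (simp add: S_def)
  have norm: "(\<Sum>z\<in>S. (x z)\<^sup>2) = 2"
    using real_root_norm[OF \<alpha>] zero
    by (simp add: B_eq_drops rs S_def x_def power2_eq_square sum.Sigma case_prod_unfold)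
  have sum0: "(\<Sum>k\<le>L s. x (s, k)) = 0" for s
    using sum_drops[OF rs, of s] zero by (simp add: x_def)
  have int: "x z \<in> \<int>" for z by (simp add: x_def drop_at_integral \<alpha>)
  have sq: "(x z)\<^sup>2 \<ge> 1" if "x z \<noteq> 0" for z
  proof -
    have "(x z)\<^sup>2 \<in> \<int>" using int by (simp add: Ints_power)
    then show ?thesis using that by (intro Ints_pos_ge1) auto
  qed
  have "\<exists>z\<in>S. x z \<noteq> 0"
    using norm by (metis (no_types, lifting) power_zero_numeral sum.neutral zero_neq_numeral)
  then obtain s k where k: "k \<le> L s" "x (s, k) \<noteq> 0"
    by (auto simp: S_def)
  have "\<exists>i\<le>L s. x (s, i) > 0"
  proof (rule ccontr)
    assume "\<not> ?thesis"
    then have "\<forall>i\<le>L s. x (s, i) = 0"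
      using sum0[of s] sum_nonneg_eq_0_iff[of "{..L s}" "\<lambda>i. - x (s, i)"]
      by (auto simp: sum_negf not_less)
    with k show False by blast
  qed
  then obtain i where i: "i \<le> L s" "x (s, i) > 0" by blast
  have "\<exists>j\<le>L s. x (s, j) < 0"
  proof (rule ccontr)
    assume "\<not> ?thesis"
    then have "\<forall>i\<le>L s. x (s, i) = 0"
      using sum0[of s] sum_nonneg_eq_0_iff[of "{..L s}" "\<lambda>i. x (s, i)"]
      by (auto simp: not_less)
    with k show False by blast
  qed
  then obtain j where j: "j \<le> L s" "x (s, j) < 0" by blast
  have ij: "i \<noteq> j" using i j by auto
  have others: "x z = 0" if "z \<in> S" "z \<noteq> (s, i)" "z \<noteq> (s, j)" for z
  proof (rule ccontr)
    assume "x z \<noteq> 0"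
    have "(x z)\<^sup>2 + (x (s, i))\<^sup>2 + (x (s, j))\<^sup>2 = (\<Sum>z\<in>{z, (s, i), (s, j)}. (x z)\<^sup>2)"
      using that ij by simp
    also have "\<dots> \<le> (\<Sum>z\<in>S. (x z)\<^sup>2)"
      using that i j fin by (intro sum_mono2) (auto simp: S_def)
    finally show False
      using sq[of z] sq[of "(s, i)"] sq[of "(s, j)"] i j \<open>x z \<noteq> 0\<close> norm by simp
  qed
  have "(\<Sum>z\<in>{(s, i), (s, j)}. (x z)\<^sup>2) = (\<Sum>z\<in>S. (x z)\<^sup>2)"
    using fin others i j by (intro sum.mono_neutral_left) (auto simp: S_def)
  then have norm2: "(x (s, i))\<^sup>2 + (x (s, j))\<^sup>2 = 2"
    using ij norm by simp
  have "(\<Sum>k\<in>{i, j}. x (s, k)) = (\<Sum>k\<le>L s. x (s, k))"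
    using others i j by (intro sum.mono_neutral_left) (auto simp: S_def)
  then have "x (s, i) + x (s, j) = 0" using ij sum0 by simp
  then have xj: "x (s, j) = - x (s, i)" by simp
  have xi: "x (s, i) = 1"
    using norm2 i by (simp add: xj power2_eq_1_iff)
  have vals: "drop_at \<alpha> t k =
      (if t = s then if k = i then 1 else if k = j then - 1 else 0 else 0)" if "k \<le> L t" for t k
    using others[of "(t, k)"] xi xj that by (auto simp: x_def S_def)
  have "j < i"
  proof (rule ccontr)
    assume "\<not> j < i"
    then have "i < j" using ij by simp
    have "arm_coeff \<alpha> s j = (\<Sum>l=j..L s. drop_at \<alpha> s l)"
      using j by (intro arm_coeff_eq_sum rs) simp
    also have "\<dots> = (\<Sum>l=j..L s. if l = j then - 1 else 0)"
      using \<open>i < j\<close> by (intro sum.cong) (auto simp: vals)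
    also have "\<dots> = - 1" using j by simp
    finally have "arm_coeff \<alpha> s j < 0" by simp
    moreover have "arm_coeff \<alpha> s j \<ge> 0"
      using \<open>nonneg \<alpha>\<close> by (cases j) (auto simp: nonneg_def)
    ultimately show False by simp
  qed
  then show ?thesis using that vals i(1) by blast
qed

abbreviation "CB \<equiv> canonical_basis a b c"

section \<open>The canonical basis, listed\<close>

definition triple :: "arm \<Rightarrow> nat \<Rightarrow> vertex \<Rightarrow> real" where
  "triple s p = simple_root (parent s p) + simple_root (Node s p) + simple_root (Node s (Suc p))"

text \<open>
  The paths through the branch vertex are indexed by the arm that they avoid.
\<close>

definition fork :: "arm \<Rightarrow> vertex \<Rightarrow> real" where
  "fork u = simple_root Branch + (\<Sum>s\<in>UNIV - {u}. simple_root (Node s 0))"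

definition theta :: "arm \<Rightarrow> nat \<Rightarrow> vertex \<Rightarrow> real" where
  "theta s p = D_highest_root (D_verts a b c s p)"

lemma parent_in_V: "p < L s \<Longrightarrow> parent s p \<in> V"
  by (cases p) (auto simp: parent_def)

lemma triple_apply:
  "triple s p x = (if x = parent s p \<or> x = Node s p \<or> x = Node s (Suc p) then 1 else 0)"
  by (auto simp: triple_def simple_root_def)

lemma fork_apply: "fork u x = (if x = Branch \<or> (\<exists>s. s \<noteq> u \<and> x = Node s 0) then 1 else 0)"
proof (cases x)
  case (Node t q)
  have "(\<Sum>s\<in>UNIV - {u}. simple_root (Node s 0)) (Node t q)
    = (\<Sum>s\<in>UNIV - {u}. if s = t then (if q = 0 then 1 else 0) else 0)"
    unfolding sum_fun_apply by (intro sum.cong) (auto simp: simple_root_def)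
  with Node show ?thesis
    by (auto simp: fork_def simple_root_def)
qed (simp add: fork_def simple_root_def sum_fun_apply)

lemma theta_apply:
  assumes "p < L s"
  shows "theta s p x = (case x of Branch \<Rightarrow> 2 | Node t q \<Rightarrow>
      if t = s then if q < p then 2 else if q = p then 1 else 0 else if q = 0 then 1 else 0)"
proof -
  define D where "D = D_verts a b c s p"
  have D: "y \<in> D \<longleftrightarrow> (case y of Branch \<Rightarrow> True | Node t q \<Rightarrow> if t = s then q \<le> p else q = 0)" for y
    using L_pos by (cases y) (auto simp: D_def D_verts_def Suc_le_eq)
  have "D \<subseteq> V"
    using assms L_pos by (auto simp: D_def D_verts_def)
  then have fin: "finite D" by (rule finite_subset) simp
  have "theta s p x = (\<Sum>j\<in>D. if j = x then (if endpoint D x then 1 else 2) else 0)"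
    unfolding theta_def D_highest_root_def D_def[symmetric] sum_fun_apply
    by (intro sum.cong) (auto simp: scaleR_fun_def simple_root_def)
  also have "\<dots> = (if x \<in> D then if endpoint D x then 1 else 2 else 0)"
    using fin by simp
  finally have val: "theta s p x = (if x \<in> D then if endpoint D x then 1 else 2 else 0)" .
  show ?thesis
  proof (cases x)
    case Branch
    have "{h \<in> D. adj h Branch} = {Node Arm1 0, Node Arm2 0, Node Arm3 0}"
    proof -
      have "h \<in> D \<and> adj h Branch \<longleftrightarrow> h = Node Arm1 0 \<or> h = Node Arm2 0 \<or> h = Node Arm3 0" for h
      proof (cases h)
        case (Node t q)
        then show ?thesis by (cases t) (auto simp: D)
      qed simp
      then show ?thesis by blast
    qed
    then show ?thesis using val by (simp add: Branch D endpoint_def)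
  next
    case (Node t q)
    have nb: "{h \<in> D. adj h x} = {h. (h = parent t q \<or> h = Node t (Suc q)) \<and> h \<in> D}"
      unfolding Node using adj_Node_iff adj_sym by blast
    have par: "x \<in> D \<Longrightarrow> parent t q \<in> D"
      by (cases q) (auto simp: Node D parent_def split: if_splits)
    show ?thesis
    proof (cases "t = s \<and> q < p")
      case True
      then have "x \<in> D" "Node t (Suc q) \<in> D" by (simp_all add: D Node)
      then have "{h \<in> D. adj h x} = {parent t q, Node t (Suc q)}"
        unfolding nb using par by blast
      then have "\<not> endpoint D x" by (simp add: endpoint_def)
      then show ?thesis using val True \<open>x \<in> D\<close> by (simp add: Node)
    next
      case False
      then have "x \<in> D \<Longrightarrow> Node t (Suc q) \<notin> D" by (auto simp: D Node split: if_splits)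
      then have "x \<in> D \<Longrightarrow> {h \<in> D. adj h x} = {parent t q}"
        unfolding nb using par by blast
      then have "x \<in> D \<Longrightarrow> endpoint D x" by (simp add: endpoint_def)
      then have "theta s p x = (if x \<in> D then 1 else 0)" using val by simp
      then show ?thesis using False by (auto simp: Node D)
    qed
  qed
qed

lemma sref_add: "sref i (v + w) = sref i v + sref i w"
  using linear_reflection by (rule linear_add)

lemma path_real:
  assumes "h \<in> V" "i \<in> V" "j \<in> V" "h \<noteq> j" "adj h i" "adj i j"
  shows "simple_root h + simple_root i + simple_root j \<in> real_roots"
proof -
  have c: "cartan h i = - 1" "cartan j i = - 1" "cartan h j = 0"
    using assms adj_path_ends[of h i j] adj_sym[of j i]
    by (auto simp: cartan_def split: if_splits)
  have "sref j (simple_root i) = simple_root i + simple_root j"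
    using c assms by (simp add: reflection_simple)
  moreover have "sref h (simple_root i + simple_root j)
      = simple_root h + simple_root i + simple_root j"
    using c assms by (simp add: sref_add reflection_simple)
  ultimately show ?thesis
    using assms by (metis reflection_real_root simple_root_real)
qed

lemma theta_support: "p < L s \<Longrightarrow> theta s p \<in> root_space a b c"
  using L_pos by (auto simp: root_space_iff theta_apply Suc_le_eq split: vertex.splits if_splits)

text \<open>
  With these drops, \<open>\<theta>\<^sub>i\<close> is orthogonal to \<open>\<alpha>\<^sub>i\<close> because the two drops next to \<open>i\<close> agree.
\<close>

lemma theta_drop:
  assumes "p < L s"
  shows "drop_at (theta s p) s k = (if k = p \<or> k = Suc p then 1 else 0)"
  using assms by (cases k) (auto simp: drop_at_def theta_apply)

lemma theta_0_real: "theta s 0 \<in> real_roots"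
proof -
  have pos: "Node t 0 \<in> V" for t using L_pos[of t] by simp
  have c: "cartan (Node t 0) Branch = - 1" "cartan Branch (Node t 0) = - 1"
    "t \<noteq> r \<Longrightarrow> cartan (Node t 0) (Node r 0) = 0" for t r
    by (auto simp: cartan_def)
  let ?\<gamma> = "simple_root Branch + simple_root (Node Arm1 0) + simple_root (Node Arm2 0)
    + simple_root (Node Arm3 0)"
  have r: "sref (Node t 0) (simple_root Branch) = simple_root Branch + simple_root (Node t 0)"
    "t \<noteq> r \<Longrightarrow> sref (Node t 0) (simple_root (Node r 0)) = simple_root (Node r 0)"
    "sref Branch (simple_root (Node t 0)) = simple_root (Node t 0) + simple_root Branch"
    "sref Branch (simple_root Branch) = - simple_root Branch" for t r
    using pos c by (simp_all add: reflection_simple_self) (simp_all add: reflection_simple)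
  have "act [Node Arm1 0, Node Arm2 0, Node Arm3 0] (simple_root Branch) = ?\<gamma>"
    by (simp add: sref_add r)
  then have "act [Branch, Node Arm1 0, Node Arm2 0, Node Arm3 0] (simple_root Branch)
    = sref Branch ?\<gamma>"
    by simp
  also have "\<dots> = - simple_root Branch + (simple_root (Node Arm1 0) + simple_root Branch)
      + (simple_root (Node Arm2 0) + simple_root Branch)
      + (simple_root (Node Arm3 0) + simple_root Branch)"
    by (simp only: sref_add r)
  also have "\<dots> = theta s 0"
  proof
    fix x show "(- simple_root Branch + (simple_root (Node Arm1 0) + simple_root Branch)
      + (simple_root (Node Arm2 0) + simple_root Branch)
      + (simple_root (Node Arm3 0) + simple_root Branch)) x = theta s 0 x"
    proof (cases x)
      case (Node t q)
      then show ?thesis using L_pos[of s] by (cases t) (auto simp: theta_apply simple_root_def)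
    qed (use L_pos[of s] in \<open>simp add: theta_apply simple_root_def\<close>)
  qed
  finally show ?thesis
    using act_real_root[of "[Branch, Node Arm1 0, Node Arm2 0, Node Arm3 0]"] pos
      simple_root_real[of Branch] by (metis Branch_in_V Cons_in_lists_iff lists.Nil)
qed

text \<open>
  Moving one step outwards along the arm adds the simple roots of the new and of the old end vertex,
  one reflection for each of them.
\<close>

lemma theta_real:
  assumes "p < L s"
  shows "theta s p \<in> real_roots"
  using assms
proof (induction p)
  case 0
  then show ?case by (simp add: theta_0_real)
next
  case (Suc p)
  let ?v = "sref (Node s (Suc p)) (theta s p)"
  note rs = theta_support[of p s]
  have v: "?v = theta s p + simple_root (Node s (Suc p))"
    using Suc.prems rs by (auto simp: reflection_def B_simple_Node theta_drop)
  have "drop_at ?v s (Suc p) - drop_at ?v s p = - 1"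
    using Suc.prems rs by (simp add: drop_at_reflection_Node theta_drop)
  then have "sref (Node s p) ?v = ?v + simple_root (Node s p)"
    using Suc.prems rs
    by (subst reflection_def) (simp add: B_simple_Node reflection_in_root_space)
  also have "\<dots> = theta s (Suc p)"
    unfolding v using Suc.prems
    by (auto simp: fun_eq_iff theta_apply simple_root_def split: vertex.splits)
  finally show ?case
    using Suc by (metis Node_in_V Suc_lessD reflection_real_root)
qed

lemma positive_root_iff: "positive_root a b c \<beta> \<longleftrightarrow> \<beta> \<in> real_roots \<and> nonneg \<beta>"
proof -
  have "(\<exists>w\<in>carrier (weyl_group a b c). P (weyl_act a b c w)) \<longleftrightarrow> (\<exists>xs\<in>lists V. P (act xs))" for P
  proof
    assume "\<exists>w\<in>carrier (weyl_group a b c). P (weyl_act a b c w)"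
    then obtain xs where "xs \<in> lists V" "P (weyl_act a b c (word_rel a b c `` {xs}))"
      by (auto simp: weyl_group_def elim!: quotientE)
    then show "\<exists>xs\<in>lists V. P (act xs)" by (metis weyl_act_class)
  next
    assume "\<exists>xs\<in>lists V. P (act xs)"
    then obtain xs where xs: "xs \<in> lists V" "P (act xs)" by blast
    then have "word_rel a b c `` {xs} \<in> carrier (weyl_group a b c)"
      by (auto simp: weyl_group_def intro: quotientI)
    then show "\<exists>w\<in>carrier (weyl_group a b c). P (weyl_act a b c w)"
      using xs by (metis weyl_act_class)
  qed
  from this[of "\<lambda>g. \<exists>i\<in>V. \<beta> = g (simple_root i)"] show ?thesis
    unfolding positive_root_def real_roots_def nonneg_def by blast
qed

lemma elementary_iff:
  assumes "i \<in> V"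
  shows "elementary a b c i \<beta> \<longleftrightarrow>
    (\<exists>j\<in>V. cartan i j = 0 \<and> \<beta> = simple_root j) \<or>
    (\<exists>h\<in>V. \<exists>j\<in>V. h \<noteq> j \<and> adj h i \<and> adj i j \<and>
       \<beta> = simple_root h + simple_root i + simple_root j) \<or>
    (\<exists>k p. i = Node k p \<and> \<beta> = theta k p)"
proof -
  have nn: "nonneg (simple_root j)" for j
    by (simp add: nonneg_def simple_root_def)
  have "positive_root a b c (simple_root j)" if "j \<in> V" for j
    using that nn by (simp add: positive_root_iff simple_root_real)
  moreover have "positive_root a b c (simple_root h + simple_root i + simple_root j)"
    if "h \<in> V" "j \<in> V" "h \<noteq> j" "adj h i" "adj i j" for h j
    using that assms path_real nn by (simp add: positive_root_iff nonneg_add)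
  moreover have "positive_root a b c (theta k p)" if "i = Node k p" for k p
    using that assms theta_real
    by (auto simp: positive_root_iff nonneg_def theta_apply split: vertex.splits)
  ultimately show ?thesis
    unfolding elementary_def theta_def[symmetric] by blast
qed

lemma CB_iff: "x \<in> CB \<longleftrightarrow> (\<exists>i\<in>V. \<exists>\<beta>. elementary a b c i \<beta> \<and> x = simple_root i \<or>\<^sub>V \<beta>)"
  unfolding canonical_basis_def by blast

lemma nonadjacent_in_CB:
  "i \<in> V \<Longrightarrow> j \<in> V \<Longrightarrow> cartan i j = 0 \<Longrightarrow> simple_root i \<or>\<^sub>V simple_root j \<in> CB"
  unfolding CB_iff using elementary_iff by blast

lemma triple_in_CB: "Suc p < L s \<Longrightarrow> simple_root (Node s p) \<or>\<^sub>V triple s p \<in> CB"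
proof -
  assume p: "Suc p < L s"
  have "elementary a b c (Node s p) (triple s p)"
  proof -
    have "adj (parent s p) (Node s p)" "adj (Node s p) (Node s (Suc p))"
      "parent s p \<noteq> Node s (Suc p)" "parent s p \<in> V" "Node s (Suc p) \<in> V" "Node s p \<in> V"
      using p adj_Node_iff[of s p "parent s p"] adj_sym by (auto simp: parent_in_V)
    then show ?thesis
      unfolding triple_def using elementary_iff by blast
  qed
  then show ?thesis unfolding CB_iff using p by (metis Node_in_V Suc_lessD)
qed

lemma fork_eq: "s \<noteq> t \<Longrightarrow> u \<noteq> s \<Longrightarrow> u \<noteq> t \<Longrightarrow>
    fork u = simple_root (Node s 0) + simple_root Branch + simple_root (Node t 0)"
  by (cases s; cases t; cases u) (auto simp: fork_def UNIV_arm insert_Diff_if)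

lemma fork_in_CB: "simple_root Branch \<or>\<^sub>V fork u \<in> CB"
proof -
  have "\<exists>s t. s \<noteq> t \<and> u \<noteq> s \<and> u \<noteq> t"
    by (cases u) (metis arm.distinct)+
  then obtain s t where st: "s \<noteq> t" "u \<noteq> s" "u \<noteq> t" by blast
  have "elementary a b c Branch (fork u)"
  proof -
    have "adj (Node s 0) Branch" "adj Branch (Node t 0)" "Node s 0 \<noteq> Node t 0"
      "Node s 0 \<in> V" "Node t 0 \<in> V" "Branch \<in> V"
      using st L_pos[of s] L_pos[of t] by auto
    then show ?thesis
      unfolding fork_eq[OF st] using elementary_iff by blast
  qed
  then show ?thesis unfolding CB_iff by (metis Branch_in_V)
qed

lemma theta_in_CB: "p < L s \<Longrightarrow> simple_root (Node s p) \<or>\<^sub>V theta s p \<in> CB"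
  unfolding CB_iff using elementary_iff[of "Node s p"] Node_in_V by blast

lemma CB_cases:
  assumes "x \<in> CB"
  obtains (nonadjacent) i j where "i \<in> V" "j \<in> V" "cartan i j = 0"
      "x = simple_root i \<or>\<^sub>V simple_root j"
    | (triple) s p where "Suc p < L s" "x = simple_root (Node s p) \<or>\<^sub>V triple s p"
    | (fork) u where "x = simple_root Branch \<or>\<^sub>V fork u"
    | (theta) s p where "p < L s" "x = simple_root (Node s p) \<or>\<^sub>V theta s p"
proof -
  obtain i \<beta> where i: "i \<in> V" "elementary a b c i \<beta>" and x: "x = simple_root i \<or>\<^sub>V \<beta>"
    using assms unfolding CB_iff by blast
  from i(2) show ?thesis
    unfolding elementary_iff[OF i(1)]
  proof (elim disjE bexE exE conjE)
    fix j assume "j \<in> V" "cartan i j = 0" "\<beta> = simple_root j"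
    then show ?thesis using nonadjacent i(1) x by blast
  next
    fix k p assume "i = Node k p" "\<beta> = theta k p"
    then show ?thesis using theta[of p k] i(1) x by simp
  next
    fix h j assume hj: "h \<in> V" "j \<in> V" "h \<noteq> j" "adj h i" "adj i j"
      and \<beta>: "\<beta> = simple_root h + simple_root i + simple_root j"
    show ?thesis
    proof (cases i)
      case Branch
      then obtain s t where st: "h = Node s 0" "j = Node t 0" "s \<noteq> t"
        using hj adj_Branch_iff adj_sym by metis
      obtain u where u: "u \<noteq> s" "u \<noteq> t" using third_arm[OF st(3)] by metis
      show ?thesis
        using fork[of u] st u x \<beta> fork_eq[of s t u] by (simp add: Branch)
    next
      case (Node s p)
      have "h = parent s p \<and> j = Node s (Suc p) \<or> j = parent s p \<and> h = Node s (Suc p)"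
        using hj adj_Node_iff[of s p] adj_sym[of h i] by (auto simp: Node)
      then have "\<beta> = triple s p \<and> Suc p < L s"
        using \<beta> hj by (auto simp: Node triple_def add_ac)
      then show ?thesis using triple[of p s] x by (simp add: Node)
    qed
  qed
qed

lemma finite_CB: "finite CB"
proof (rule finite_subset)
  let ?F = "(\<Union>i\<in>V. \<Union>j\<in>V. {simple_root i \<or>\<^sub>V simple_root j}) \<union>
      (\<Union>s. \<Union>p\<in>{..<L s}. {simple_root (Node s p) \<or>\<^sub>V triple s p}) \<union>
      (\<Union>u. {simple_root Branch \<or>\<^sub>V fork u}) \<union>
      (\<Union>s. \<Union>p\<in>{..<L s}. {simple_root (Node s p) \<or>\<^sub>V theta s p})"
  show "CB \<subseteq> ?F"
  proof
    fix x assume "x \<in> CB"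
    then show "x \<in> ?F"
    proof (cases rule: CB_cases)
      case (triple s p)
      then have "p \<in> {..<L s}" by simp
      with triple(2) show ?thesis by blast
    qed auto
  qed
  show "finite ?F" by simp
qed

section \<open>Linear independence\<close>

text \<open>
  The order in which coefficients of a vanishing combination are shown to be zero: from the leaves
  inwards, the element with factor \<open>\<theta>\<^sub>i\<close> directly before the path whose middle vertex is one step
  closer to the branch vertex than \<open>i\<close>; then the paths with the branch vertex in the middle; the
  products of orthogonal simple roots last.
\<close>

inductive basis_level :: "(vertex \<times> vertex \<Rightarrow> real) \<Rightarrow> nat \<Rightarrow> bool" where
  theta: "p < L s \<Longrightarrow> basis_level (simple_root (Node s p) \<or>\<^sub>V theta s p) (2 * (a + b + c - p))"
| triple: "Suc p < L s \<Longrightarrow>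
    basis_level (simple_root (Node s p) \<or>\<^sub>V triple s p) (2 * (a + b + c - p) - 1)"
| fork: "basis_level (simple_root Branch \<or>\<^sub>V fork u) (2 * (a + b + c) + 1)"
| nonadjacent: "i \<in> V \<Longrightarrow> j \<in> V \<Longrightarrow> cartan i j = 0 \<Longrightarrow>
    basis_level (simple_root i \<or>\<^sub>V simple_root j) (2 * (a + b + c) + 2)"

lemma linear_coordinate: "linear (\<lambda>t :: vertex \<times> vertex \<Rightarrow> real. t z)"
  by (rule linearI) (simp_all add: scaleR_fun_def)

lemma L_le: "L s \<le> a + b + c"
  by (cases s) auto

text \<open>
  The separating functionals are coordinates of tensors: the diagonal one at \<open>i\<close> for
  \<open>\<alpha>\<^sub>i \<or> \<theta>\<^sub>i\<close>, the one at \<open>i\<close> and its outer neighbour for the path with middle vertex \<open>i\<close>, and the one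
  at \<open>i\<close> and \<open>j\<close> for \<open>\<alpha>\<^sub>i \<or> \<alpha>\<^sub>j\<close>. The three paths through the branch vertex are told apart by
  a signed sum of the coordinates at the three edges there.
\<close>

lemma independent_CB: "independent CB"
proof (rule independent_by_levels[where level = basis_level, OF finite_CB])
  fix x assume "x \<in> CB"
  then show "\<exists>n. basis_level x n"
    by (cases rule: CB_cases) (blast intro: basis_level.intros)+
next
  fix x n assume "x \<in> CB" and "basis_level x n"
  from this(2) show "\<exists>f :: (vertex \<times> vertex \<Rightarrow> real) \<Rightarrow> real. linear f \<and> f x \<noteq> 0 \<and>
    (\<forall>y\<in>CB. y \<noteq> x \<longrightarrow> f y = 0 \<or> (\<exists>m<n. basis_level y m))"
  proof cases
    case (theta p s)
    let ?z = "(Node s p, Node s p)"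
    have "y ?z = 0 \<or> (\<exists>m<n. basis_level y m)" if "y \<in> CB" "y \<noteq> x" for y
      using that(1)
    proof (cases rule: CB_cases)
      case (triple t q)
      show ?thesis
      proof (cases "t = s \<and> q = p")
        case True
        have "2 * (a + b + c - p) - 1 < n"
          using theta L_le[of s] by auto
        then show ?thesis using basis_level.triple[OF triple(1)] triple(2) True by blast
      qed (auto simp: triple(2) sym_prod_apply simple_root_def)
    next
      case (theta t q)
      then show ?thesis
        using that(2) \<open>x = _\<close> by (auto simp: sym_prod_apply simple_root_def)
    qed (auto simp: sym_prod_apply simple_root_def cartan_0_iff)
    moreover have "x ?z \<noteq> 0"
      using theta by (simp add: sym_prod_apply theta_apply simple_root_def)
    ultimately show ?thesis using linear_coordinate[of ?z] by blast
  next
    case (triple p s)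
    let ?z = "(Node s p, Node s (Suc p))"
    have "y ?z = 0 \<or> (\<exists>m<n. basis_level y m)" if "y \<in> CB" "y \<noteq> x" for y
      using that(1)
    proof (cases rule: CB_cases)
      case y: (triple t q)
      show ?thesis
      proof (cases "t = s \<and> q = Suc p")
        case True
        have "2 * (a + b + c - Suc p) - 1 < n"
          using triple L_le[of s] by auto
        then show ?thesis using basis_level.triple[OF y(1)] y(2) True by blast
      next
        case False
        then show ?thesis
          using y that(2) triple by (auto simp: sym_prod_apply simple_root_def)
      qed
    next
      case y: (theta t q)
      show ?thesis
      proof (cases "t = s \<and> q = Suc p")
        case True
        have "2 * (a + b + c - Suc p) < n"
          using triple L_le[of s] by auto
        then show ?thesis using basis_level.theta[OF y(1)] y(2) True by blast
      qed (use y in \<open>auto simp: sym_prod_apply simple_root_def theta_apply\<close>)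
    next
      case y: (nonadjacent i j)
      have "\<not> (i = Node s p \<and> j = Node s (Suc p))" "\<not> (j = Node s p \<and> i = Node s (Suc p))"
        using y(3) by (auto simp: cartan_0_iff)
      then show ?thesis using y by (auto simp: sym_prod_apply simple_root_def)
    qed (auto simp: sym_prod_apply simple_root_def)
    moreover have "x ?z \<noteq> 0"
      using triple by (simp add: sym_prod_apply triple_apply simple_root_def)
    ultimately show ?thesis using linear_coordinate[of ?z] by blast
  next
    case (fork u)
    \<comment> \<open>Each path through the branch vertex uses two of the three edges; the sign at the edge of \<open>u\<close>
      cancels the two that use it.\<close>
    define f where "f t = (\<Sum>s\<in>UNIV. t (Branch, Node s 0)) - 2 * t (Branch, Node u 0)"
      for t :: "vertex \<times> vertex \<Rightarrow> real"
    have "linear f"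
      unfolding f_def
      by (rule linearI) (simp_all add: scaleR_fun_def sum.distrib sum_distrib_left algebra_simps)
    moreover have fork_val: "f (simple_root Branch \<or>\<^sub>V fork r) = (if r = u then 2 else 0)" for r
      unfolding f_def sum_arms
      by (cases r; cases u) (auto simp: sym_prod_apply simple_root_def fork_apply)
    have "f y = 0 \<or> (\<exists>m<n. basis_level y m)" if "y \<in> CB" "y \<noteq> x" for y
      using that(1)
    proof (cases rule: CB_cases)
      case y: (triple t q)
      have "2 * (a + b + c - q) - 1 < n" using fork by simp
      then show ?thesis using basis_level.triple[OF y(1)] y(2) by blast
    next
      case y: (theta t q)
      have "2 * (a + b + c - q) < n" using fork by simp
      then show ?thesis using basis_level.theta[OF y(1)] y(2) by blast
    next
      case y: (fork r)
      then show ?thesis using fork_val that(2) fork by auto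
    next
      case y: (nonadjacent i j)
      have "y (Branch, Node s 0) = 0" for s
      proof -
        have "\<not> (i = Branch \<and> j = Node s 0)" "\<not> (j = Branch \<and> i = Node s 0)"
          using y(3) by (auto simp: cartan_0_iff)
        then show ?thesis using y by (auto simp: sym_prod_apply simple_root_def)
      qed
      then show ?thesis by (simp add: f_def)
    qed
    moreover have "f x \<noteq> 0" using fork fork_val by simp
    ultimately show ?thesis by blast
  next
    case (nonadjacent i j)
    have "y (i, j) = 0 \<or> (\<exists>m<n. basis_level y m)" if "y \<in> CB" "y \<noteq> x" for y
      using that(1)
    proof (cases rule: CB_cases)
      case y: (triple t q)
      have "2 * (a + b + c - q) - 1 < n" using nonadjacent by simp
      then show ?thesis using basis_level.triple[OF y(1)] y(2) by blast
    next
      case y: (theta t q)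
      have "2 * (a + b + c - q) < n" using nonadjacent by simp
      then show ?thesis using basis_level.theta[OF y(1)] y(2) by blast
    next
      case y: (fork r)
      have "2 * (a + b + c) + 1 < n" using nonadjacent by simp
      then show ?thesis using basis_level.fork[of r] y by blast
    next
      case y: (nonadjacent k l)
      have "\<not> (k = i \<and> l = j)" "\<not> (l = i \<and> k = j)"
        using y that(2) nonadjacent sym_prod_commute by metis+
      then show ?thesis using y by (auto simp: sym_prod_apply simple_root_def)
    qed
    moreover have "x (i, j) \<noteq> 0"
      using nonadjacent by (auto simp: sym_prod_apply simple_root_def)
    ultimately show ?thesis using linear_coordinate[of "(i, j)"] by blast
  qed
qed

section \<open>The span of the canonical basis\<close>

lemma B_triple:
  assumes "Suc p < L s"
  shows "B (simple_root (Node s p)) (triple s p) = 0" "triple s p \<in> root_space a b c"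
proof -
  show rs: "triple s p \<in> root_space a b c"
    using assms parent_in_V[of p s] by (auto simp: root_space_iff triple_apply)
  have "arm_coeff (triple s p) s p = 1"
    by (cases p) (simp_all add: triple_apply parent_def)
  moreover have "triple s p (Node s p) = 1" "triple s p (Node s (Suc p)) = 1"
    by (simp_all add: triple_apply)
  ultimately show "B (simple_root (Node s p)) (triple s p) = 0"
    using assms rs by (simp add: B_simple_Node drop_at_def)
qed

lemma B_theta: "p < L s \<Longrightarrow> B (simple_root (Node s p)) (theta s p) = 0"
  by (simp add: B_simple_Node theta_support theta_drop)

lemma B_fork: "B (simple_root Branch) (fork u) = 0" "fork u \<in> root_space a b c"
proof -
  show rs: "fork u \<in> root_space a b c"
    using L_pos by (auto simp: root_space_iff fork_apply Suc_le_eq)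
  show "B (simple_root Branch) (fork u) = 0"
    using rs by (cases u) (simp_all add: B_simple_Branch drop_at_def sum_arms fork_apply)
qed

lemma CB_orthogonal:
  assumes "x \<in> CB"
  obtains i \<beta> where "i \<in> V" "\<beta> \<in> root_space a b c" "B (simple_root i) \<beta> = 0" "x = simple_root i \<or>\<^sub>V \<beta>"
  using assms
proof (cases rule: CB_cases)
  case (nonadjacent i j)
  then show ?thesis
    using that[of i "simple_root j"] by (simp add: cartan_form_simple_simple simple_root_in_root_space)
next
  case (triple s p)
  then show ?thesis using that[of "Node s p" "triple s p"] B_triple by simp
next
  case (fork u)
  then show ?thesis using that[of Branch "fork u"] B_fork by simp
next
  case (theta s p)
  then show ?thesis using that[of "Node s p" "theta s p"] B_theta theta_support by simp
qed

lemma sym_square_symmetric: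
  assumes "t \<in> sym_square a b c"
  shows "t (p, q) = t (q, p)" and "p \<notin> V \<or> q \<notin> V \<Longrightarrow> t (p, q) = 0"
proof -
  let ?S = "{t :: vertex \<times> vertex \<Rightarrow> real.
      (\<forall>p q. t (p, q) = t (q, p)) \<and> (\<forall>p q. p \<notin> V \<or> q \<notin> V \<longrightarrow> t (p, q) = 0)}"
  have "sym_square a b c \<subseteq> ?S"
    unfolding sym_square_def
  proof (rule span_minimal)
    show "subspace ?S"
      by (rule subspaceI) (auto simp: scaleR_fun_def)
  qed (auto simp: sym_prod_apply root_space_iff)
  then show "t (p, q) = t (q, p)" "p \<notin> V \<or> q \<notin> V \<Longrightarrow> t (p, q) = 0"
    using assms by blast+
qed

lemma sym_prod_in_sym_square:
  "v \<in> root_space a b c \<Longrightarrow> w \<in> root_space a b c \<Longrightarrow> v \<or>\<^sub>V w \<in> sym_square a b c"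
  unfolding sym_square_def by (rule span_base) blast

lemma subspace_sym_square: "subspace (sym_square a b c)"
  by (simp add: sym_square_def)

lemma sum_V_delta: "(\<Sum>i\<in>V. f i * simple_root i x) = (if x \<in> V then f x else 0)"
proof -
  have "(\<Sum>i\<in>V. f i * simple_root i x) = (\<Sum>i\<in>V. if x = i then f i else 0)"
    by (intro sum.cong) (auto simp: simple_root_def)
  then show ?thesis by simp
qed

lemma sum_V_delta2:
  "(\<Sum>p\<in>V. \<Sum>q\<in>V. g p q * (simple_root p x * simple_root q y + simple_root q x * simple_root p y))
    = (if x \<in> V \<and> y \<in> V then g x y + g y x else 0)"
proof -
  have "(\<Sum>q\<in>V. g p q * (simple_root p x * simple_root q y + simple_root q x * simple_root p y))
    = (\<Sum>q\<in>V. g p q * simple_root q y) * simple_root p x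
      + (\<Sum>q\<in>V. g p q * simple_root q x) * simple_root p y" for p
    unfolding sum_distrib_right sum.distrib[symmetric] by (simp add: algebra_simps)
  then show ?thesis
    by (simp only: sum.distrib sum_V_delta) auto
qed

lemma sym_square_expand:
  assumes "t \<in> sym_square a b c"
  shows "t = (\<Sum>p\<in>V. \<Sum>q\<in>V. (t (p, q) / 2) *\<^sub>R (simple_root p \<or>\<^sub>V simple_root q))"
proof
  fix z :: "vertex \<times> vertex"
  obtain x y where z: "z = (x, y)" by (cases z)
  have "(\<Sum>p\<in>V. \<Sum>q\<in>V. (t (p, q) / 2) *\<^sub>R (simple_root p \<or>\<^sub>V simple_root q)) z
    = (if x \<in> V \<and> y \<in> V then t (x, y) / 2 + t (y, x) / 2 else 0)"
    unfolding sum_V_delta2[where g = "\<lambda>p q. t (p, q) / 2", symmetric]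
    by (simp add: z sum_fun_apply scaleR_fun_def sym_prod_apply)
  also have "\<dots> = t z"
    using sym_square_symmetric[OF assms, of x y] sym_square_symmetric[OF assms, of y x]
    by (auto simp: z)
  finally show "t z = (\<Sum>p\<in>V. \<Sum>q\<in>V. (t (p, q) / 2) *\<^sub>R (simple_root p \<or>\<^sub>V simple_root q)) z"
    by (rule HOL.sym)
qed

text \<open>
  What is left of \<open>\<alpha>\<^sub>i \<or> \<alpha>\<^sub>j\<close> after subtracting the multiple of one fixed element with the same
  contraction. Spanning amounts to all defects lying in the span of the canonical basis.
\<close>

definition defect :: "vertex \<Rightarrow> vertex \<Rightarrow> vertex \<times> vertex \<Rightarrow> real" where
  "defect i j = (simple_root i \<or>\<^sub>V simple_root j)
    - (cartan i j / 2) *\<^sub>R (simple_root Branch \<or>\<^sub>V simple_root Branch)"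

lemma defect_sym: "defect i j = defect j i"
  by (simp add: defect_def sym_prod_commute cartan_sym)

lemma defect_nonadjacent: "i \<in> V \<Longrightarrow> j \<in> V \<Longrightarrow> cartan i j = 0 \<Longrightarrow> defect i j \<in> span CB"
  by (simp add: defect_def nonadjacent_in_CB span_base)

lemma sym_prod_eq_defects:
  assumes "i \<in> V" "w \<in> root_space a b c" "B (simple_root i) w = 0"
  shows "simple_root i \<or>\<^sub>V w = (\<Sum>j\<in>V. w j *\<^sub>R defect i j)"
proof -
  have "simple_root i \<or>\<^sub>V w = (\<Sum>j\<in>V. w j *\<^sub>R (simple_root i \<or>\<^sub>V simple_root j))"
  proof
    fix z :: "vertex \<times> vertex"
    obtain x y where z: "z = (x, y)" by (cases z)
    have "(\<Sum>j\<in>V. w j *\<^sub>R (simple_root i \<or>\<^sub>V simple_root j)) z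
      = (\<Sum>j\<in>V. w j * simple_root j y) * simple_root i x
        + (\<Sum>j\<in>V. w j * simple_root j x) * simple_root i y"
      unfolding sum_distrib_right sum.distrib[symmetric]
      by (simp add: z sum_fun_apply scaleR_fun_def sym_prod_apply algebra_simps)
    also have "\<dots> = (simple_root i \<or>\<^sub>V w) z"
      using assms(2) by (simp add: sum_V_delta z sym_prod_apply root_space_iff)
    finally show "(simple_root i \<or>\<^sub>V w) z = (\<Sum>j\<in>V. w j *\<^sub>R (simple_root i \<or>\<^sub>V simple_root j)) z"
      by (rule HOL.sym)
  qed
  also have "\<dots> = (\<Sum>j\<in>V. w j *\<^sub>R defect i j)
      + ((\<Sum>j\<in>V. cartan i j * w j) / 2) *\<^sub>R (simple_root Branch \<or>\<^sub>V simple_root Branch)"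
    by (simp add: defect_def scaleR_right_diff_distrib sum_subtractf scaleR_sum_left
        sum_divide_distrib mult.commute)
  also have "(\<Sum>j\<in>V. cartan i j * w j) = 0"
    using assms by (simp add: cartan_form_simple_left)
  finally show ?thesis by simp
qed

text \<open>
  A basis element is a combination of defects (\<open>sym_prod_eq_defects\<close>), because its two factors are
  orthogonal. If all but a few of these are known to be in the span, so is the sum of the others.
\<close>

lemma isolate_defects:
  assumes "simple_root i \<or>\<^sub>V w \<in> CB"
    and "i \<in> V" "w \<in> root_space a b c" "B (simple_root i) w = 0"
    and "N \<subseteq> V" "\<And>j. j \<in> V - N \<Longrightarrow> w j = 0 \<or> defect i j \<in> span CB"
  shows "(\<Sum>j\<in>N. w j *\<^sub>R defect i j) \<in> span CB"
proof -
  have "(\<Sum>j\<in>V. w j *\<^sub>R defect i j) \<in> span CB"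
    using assms(1) unfolding sym_prod_eq_defects[OF assms(2-4)] by (rule span_base)
  moreover have "(\<Sum>j\<in>V - N. w j *\<^sub>R defect i j) \<in> span CB"
  proof (rule span_sum)
    fix j assume "j \<in> V - N"
    then show "w j *\<^sub>R defect i j \<in> span CB"
      using assms(6)[of j] by (auto simp: span_scale span_zero)
  qed
  ultimately have "(\<Sum>j\<in>V. w j *\<^sub>R defect i j) - (\<Sum>j\<in>V - N. w j *\<^sub>R defect i j) \<in> span CB"
    by (rule span_diff)
  moreover have "(\<Sum>j\<in>V. w j *\<^sub>R defect i j)
    = (\<Sum>j\<in>V - N. w j *\<^sub>R defect i j) + (\<Sum>j\<in>N. w j *\<^sub>R defect i j)"
    using assms(5) by (simp add: sum.subset_diff)
  ultimately show ?thesis by simp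
qed

lemma defect_Branch: "defect Branch Branch \<in> span CB"
  by (simp add: defect_def cartan_def span_zero)

lemma defect_fork:
  assumes "s \<noteq> t"
  shows "defect Branch (Node s 0) + defect Branch (Node t 0) \<in> span CB"
proof -
  obtain u where u: "u \<noteq> s" "u \<noteq> t" using third_arm[OF assms] by metis
  have val: "fork u x = (if x = Branch \<or> x = Node s 0 \<or> x = Node t 0 then 1 else 0)" for x
    unfolding fork_eq[OF assms u] using assms by (auto simp: simple_root_def)
  have "(\<Sum>j\<in>{Node s 0, Node t 0}. fork u j *\<^sub>R defect Branch j) \<in> span CB"
  proof (rule isolate_defects[OF fork_in_CB Branch_in_V B_fork(2,1)])
    show "{Node s 0, Node t 0} \<subseteq> V"
      using L_pos[of s] L_pos[of t] by simp
    show "fork u j = 0 \<or> defect Branch j \<in> span CB" if "j \<in> V - {Node s 0, Node t 0}" for j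
      using that defect_Branch by (auto simp: val)
  qed
  then show ?thesis using assms by (simp add: val)
qed

text \<open>
  The sums of any two of the three edge defects at the branch vertex are known, hence so is each of
  them.
\<close>

lemma defect_Branch_Node: "defect Branch (Node s 0) \<in> span CB"
proof -
  have "\<exists>t u. s \<noteq> t \<and> s \<noteq> u \<and> t \<noteq> u"
    by (cases s) (metis arm.distinct)+
  then obtain t u where ne: "s \<noteq> t" "s \<noteq> u" "t \<noteq> u" by blast
  let ?d = "\<lambda>r. defect Branch (Node r 0)"
  have "(1 / 2) *\<^sub>R ((?d s + ?d t) + (?d s + ?d u) - (?d t + ?d u)) \<in> span CB"
    by (intro span_scale span_diff span_add defect_fork[OF ne(1)] defect_fork[OF ne(2)]
        defect_fork[OF ne(3)])
  moreover have "(?d s + ?d t) + (?d s + ?d u) - (?d t + ?d u) = 2 *\<^sub>R ?d s"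
    by (simp add: scaleR_2)
  ultimately show ?thesis by simp
qed

text \<open>
  Outwards along the arm: the element with factor \<open>\<theta>\<close> yields the diagonal defect of a vertex from
  that of its inner edge, and the path with this middle vertex then yields its outer edge.
\<close>

lemma defect_arm:
  assumes "p < L s"
  shows "defect (Node s p) (parent s p) \<in> span CB \<and> defect (Node s p) (Node s p) \<in> span CB"
proof -
  have loop: "defect (Node s p) (Node s p) \<in> span CB"
    if p: "p < L s" and d: "defect (Node s p) (parent s p) \<in> span CB" for p
  proof -
    have par: "theta s p (parent s p) = 2"
      using p by (cases p) (simp_all add: theta_apply parent_def)
    have "(\<Sum>j\<in>{Node s p}. theta s p j *\<^sub>R defect (Node s p) j) \<in> span CB"
    proof (rule isolate_defects)
      fix j assume j: "j \<in> V - {Node s p}"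
      show "theta s p j = 0 \<or> defect (Node s p) j \<in> span CB"
      proof (cases "cartan (Node s p) j = 0")
        case False
        then have "j = parent s p \<or> j = Node s (Suc p)"
          using j by (auto simp: cartan_0_iff adj_Node_iff)
        then show ?thesis using p d by (auto simp: theta_apply)
      qed (use p j in \<open>simp add: defect_nonadjacent\<close>)
    qed (use p in \<open>simp_all add: theta_in_CB theta_support B_theta\<close>)
    then show ?thesis using p by (simp add: theta_apply)
  qed
  from assms show ?thesis
  proof (induction p)
    case 0
    then show ?case
      using loop[of 0] defect_Branch_Node by (simp add: parent_def defect_sym)
  next
    case (Suc p)
    have "(\<Sum>j\<in>{Node s (Suc p)}. triple s p j *\<^sub>R defect (Node s p) j) \<in> span CB"
    proof (rule isolate_defects)
      fix j assume j: "j \<in> V - {Node s (Suc p)}"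
      show "triple s p j = 0 \<or> defect (Node s p) j \<in> span CB"
        using j Suc by (auto simp: triple_apply)
    qed (use Suc.prems B_triple in \<open>simp_all add: triple_in_CB\<close>)
    then have "defect (Node s (Suc p)) (Node s p) \<in> span CB"
      by (simp add: triple_apply defect_sym)
    then show ?case
      using loop[OF Suc.prems] by (simp add: parent_def)
  qed
qed

lemma defect_in_span:
  assumes "i \<in> V" "j \<in> V"
  shows "defect i j \<in> span CB"
proof (cases "cartan i j = 0")
  case False
  have *: "defect i j \<in> span CB" if "i = Node s p" "i \<in> V" "j \<in> V" "cartan i j \<noteq> 0" for i j s p
  proof -
    have "j = i \<or> j = parent s p \<or> j = Node s (Suc p)"
      using that by (auto simp: cartan_0_iff adj_Node_iff)
    then show ?thesis
      using that defect_arm[of p s] defect_arm[of "Suc p" s]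
      by (auto simp: parent_def defect_sym)
  qed
  show ?thesis
  proof (cases i)
    case Branch
    then show ?thesis
      using *[of j _ _ i] False assms defect_Branch by (cases j) (auto simp: cartan_sym defect_sym)
  qed (use * False assms in blast)
qed (use assms in \<open>simp add: defect_nonadjacent\<close>)

lemma linear_contraction: "linear (contraction a b c)"
  by (rule linearI)
    (simp_all add: contraction_def scaleR_fun_def algebra_simps sum.distrib sum_distrib_left)

lemma contraction_sym_prod: "contraction a b c (v \<or>\<^sub>V w) = 2 * B v w"
  using linear_add[OF linear_contraction]
  by (simp add: sym_prod_def contraction_tensor B_sym[of w v])

lemma subspace_module_M: "subspace (module_M a b c)"
  using subspace_sym_square unfolding module_M_def subspace_def
  by (simp add: linear_add[OF linear_contraction] linear_scale[OF linear_contraction]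
      linear_0[OF linear_contraction])

lemma CB_subset_M: "CB \<subseteq> module_M a b c"
proof
  fix x assume "x \<in> CB"
  then show "x \<in> module_M a b c"
    by (rule CB_orthogonal)
      (simp add: module_M_def sym_prod_in_sym_square simple_root_in_root_space contraction_sym_prod)
qed

text \<open>
  Replacing each product of simple roots by its defect changes a symmetric tensor by a multiple of
  one fixed element, and the factor is a quarter of the contraction, which vanishes on \<open>M\<close>.
\<close>

lemma span_CB: "span CB = module_M a b c"
proof
  show "span CB \<subseteq> module_M a b c"
    using CB_subset_M subspace_module_M by (rule span_minimal)
  show "module_M a b c \<subseteq> span CB"
  proof
    fix t assume "t \<in> module_M a b c"
    then have t: "t \<in> sym_square a b c" "contraction a b c t = 0"
      by (simp_all add: module_M_def)
    let ?z = "simple_root Branch \<or>\<^sub>V simple_root Branch"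
    have "(\<Sum>p\<in>V. \<Sum>q\<in>V. (t (p, q) / 2) *\<^sub>R (simple_root p \<or>\<^sub>V simple_root q))
      = (\<Sum>p\<in>V. \<Sum>q\<in>V. (t (p, q) / 2) *\<^sub>R (defect p q + (cartan p q / 2) *\<^sub>R ?z))"
      by (simp add: defect_def)
    also have "\<dots> = (\<Sum>p\<in>V. \<Sum>q\<in>V. (t (p, q) / 2) *\<^sub>R defect p q)
        + (\<Sum>p\<in>V. \<Sum>q\<in>V. t (p, q) * cartan p q / 4) *\<^sub>R ?z"
      by (simp add: scaleR_right_distrib sum.distrib scaleR_sum_left)
    also have "(\<Sum>p\<in>V. \<Sum>q\<in>V. t (p, q) * cartan p q / 4) = contraction a b c t / 4"
      by (simp add: contraction_def cartan_form_simple_simple sum_divide_distrib)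
    finally have "(\<Sum>p\<in>V. \<Sum>q\<in>V. (t (p, q) / 2) *\<^sub>R (simple_root p \<or>\<^sub>V simple_root q)) \<in> span CB"
      using t(2) by (simp add: span_sum span_scale defect_in_span)
    then show "t \<in> span CB"
      by (subst sym_square_expand[OF t(1)])
  qed
qed

section \<open>The nonnegative integer cone of the canonical basis\<close>

definition nat_cone :: "(vertex \<times> vertex \<Rightarrow> real) set" where
  "nat_cone = {\<Sum>x\<in>CB. real (f x) *\<^sub>R x | f. True}"

lemma nat_coneI: "t = (\<Sum>x\<in>CB. real (f x) *\<^sub>R x) \<Longrightarrow> t \<in> nat_cone"
  unfolding nat_cone_def by blast

lemma nat_coneE:
  assumes "t \<in> nat_cone"
  obtains f where "t = (\<Sum>x\<in>CB. real (f x) *\<^sub>R x)"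
  using assms unfolding nat_cone_def by blast

lemma nat_cone_add: "s \<in> nat_cone \<Longrightarrow> t \<in> nat_cone \<Longrightarrow> s + t \<in> nat_cone"
proof (elim nat_coneE)
  fix f g assume "s = (\<Sum>x\<in>CB. real (f x) *\<^sub>R x)" "t = (\<Sum>x\<in>CB. real (g x) *\<^sub>R x)"
  then show "s + t \<in> nat_cone"
    by (intro nat_coneI[where f = "\<lambda>x. f x + g x"]) (simp add: scaleR_left_distrib sum.distrib)
qed

lemma nat_cone_0: "0 \<in> nat_cone"
  by (rule nat_coneI[where f = "\<lambda>_. 0"]) simp

lemma nat_cone_scale:
  assumes "r \<in> \<nat>" "x \<in> CB"
  shows "r *\<^sub>R x \<in> nat_cone"
proof -
  obtain n where n: "r = real n" using assms(1) by (rule Nats_cases)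
  have "(\<Sum>y\<in>CB. real (if y = x then n else 0) *\<^sub>R y) = (\<Sum>y\<in>CB. if y = x then real n *\<^sub>R x else 0)"
    by (intro sum.cong) auto
  then show ?thesis
    using assms(2) finite_CB by (intro nat_coneI[where f = "\<lambda>y. if y = x then n else 0"]) (simp add: n)
qed

lemma nat_cone_sum: "(\<And>i. i \<in> I \<Longrightarrow> f i \<in> nat_cone) \<Longrightarrow> (\<Sum>i\<in>I. f i) \<in> nat_cone"
  by (induction I rule: infinite_finite_induct) (simp_all add: nat_cone_0 nat_cone_add)

text \<open>
  The expansion of a symmetric tensor over ordered pairs has half its entries as coefficients. To
  recover integers, the vertices are ordered and the two halves of each unordered pair
  are combined.
\<close>

lemma nonadjacent_in_nat_cone:
  assumes d: "d \<in> sym_square a b c"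
    and zero: "\<And>i j. i \<in> V \<Longrightarrow> j \<in> V \<Longrightarrow> cartan i j \<noteq> 0 \<Longrightarrow> d (i, j) = 0"
    and nat: "\<And>i j. i \<in> V \<Longrightarrow> j \<in> V \<Longrightarrow> cartan i j = 0 \<Longrightarrow> d (i, j) \<in> \<nat>"
  shows "d \<in> nat_cone"
proof -
  obtain f :: "vertex \<Rightarrow> nat" where f: "inj_on f V"
    using finite_imp_inj_to_nat_seg[OF finite_verts[of a b c]] by blast
  define g where "g = (\<lambda>(i, j). (d (i, j) / 2) *\<^sub>R (simple_root i \<or>\<^sub>V simple_root j))"
  define P where "P = {(i, j) \<in> V \<times> V. f i < f j}"
  define Q where "Q = {(i, j) \<in> V \<times> V. f j < f i}"
  have fin: "finite P" "finite Q"
    by (rule finite_subset[of _ "V \<times> V"]; auto simp: P_def Q_def)+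
  have "d = (\<Sum>p\<in>V. \<Sum>q\<in>V. g (p, q))"
    unfolding g_def case_prod_conv by (rule sym_square_expand[OF d])
  also have "\<dots> = (\<Sum>z\<in>V \<times> V. g z)"
    by (simp add: sum.cartesian_product)
  also have "\<dots> = (\<Sum>z\<in>P \<union> Q. g z)"
  proof (rule sum.mono_neutral_right)
    show "\<forall>z\<in>V \<times> V - (P \<union> Q). g z = 0"
    proof
      fix z assume z: "z \<in> V \<times> V - (P \<union> Q)"
      obtain i j where ij: "z = (i, j)" by (cases z)
      have "f i = f j" using z by (auto simp: P_def Q_def ij)
      then have "i = j" using f z by (auto simp: ij inj_on_def)
      then have "d (i, j) = 0" using zero[of i j] z by (auto simp: ij cartan_def)
      then show "g z = 0" by (simp add: g_def ij)
    qed
  qed (auto simp: P_def Q_def)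
  also have "\<dots> = (\<Sum>z\<in>P. g z) + (\<Sum>z\<in>Q. g z)"
    using fin by (intro sum.union_disjoint) (auto simp: P_def Q_def)
  also have "(\<Sum>z\<in>Q. g z) = (\<Sum>z\<in>P. g z)"
  proof (rule sum.reindex_bij_witness[where i = prod.swap and j = prod.swap])
    fix z assume "z \<in> Q"
    show "g (prod.swap z) = g z"
      using sym_square_symmetric(1)[OF d] sym_prod_commute
      by (cases z) (metis (mono_tags, lifting) case_prod_conv g_def swap_simp)
  qed (auto simp: P_def Q_def)
  also have "(\<Sum>z\<in>P. g z) + (\<Sum>z\<in>P. g z) = (\<Sum>z\<in>P. 2 *\<^sub>R g z)"
    by (simp only: scaleR_2 sum.distrib)
  finally have d_eq: "d = (\<Sum>z\<in>P. 2 *\<^sub>R g z)" .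
  have "2 *\<^sub>R g z \<in> nat_cone" if "z \<in> P" for z
  proof -
    obtain i j where ij: "z = (i, j)" by (cases z)
    have V: "i \<in> V" "j \<in> V" using that by (auto simp: P_def ij)
    have "2 *\<^sub>R g z = d (i, j) *\<^sub>R (simple_root i \<or>\<^sub>V simple_root j)"
      by (simp add: g_def ij)
    also have "\<dots> \<in> nat_cone"
      using zero[OF V] nat[OF V] nonadjacent_in_CB[OF V]
      by (cases "cartan i j = 0") (simp_all add: nat_cone_scale nat_cone_0)
    finally show ?thesis .
  qed
  then show ?thesis unfolding d_eq by (rule nat_cone_sum)
qed

section \<open>Expanding a product of orthogonal vectors\<close>

text \<open>
  The part of the form that comes from the drops at distance at least \<open>k\<close> on an arm.
\<close>

definition tail_prod :: "(vertex \<Rightarrow> real) \<Rightarrow> (vertex \<Rightarrow> real) \<Rightarrow> arm \<Rightarrow> nat \<Rightarrow> real" where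
  "tail_prod v w s k = (\<Sum>l=k..L s. drop_at v s l * drop_at w s l)"

definition path_coeff :: "(vertex \<Rightarrow> real) \<Rightarrow> (vertex \<Rightarrow> real) \<Rightarrow> arm \<Rightarrow> nat \<Rightarrow> real" where
  "path_coeff v w s p = v (Node s p) * w (Node s p) - tail_prod v w s (Suc p)"

text \<open>
  For each vertex \<open>i\<close>, the combination of the elements \<open>\<beta>\<close> of types path and \<open>\<theta>\<close> that multiplies
  \<open>\<alpha>\<^sub>i\<close> in the expansion of \<open>v \<or> w\<close>. These coefficients are forced by the coordinates at equal and at
  adjacent vertices.
\<close>

fun local_part :: "(vertex \<Rightarrow> real) \<Rightarrow> (vertex \<Rightarrow> real) \<Rightarrow> vertex \<Rightarrow> vertex \<Rightarrow> real" where
  "local_part v w Branch = (\<Sum>u\<in>UNIV. tail_prod v w u 0 *\<^sub>R fork u)"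
| "local_part v w (Node s p) =
    path_coeff v w s p *\<^sub>R triple s p + tail_prod v w s (Suc p) *\<^sub>R theta s p"

lemma tail_prod_commute: "tail_prod v w s k = tail_prod w v s k"
  by (simp add: tail_prod_def mult.commute)

lemma tail_prod_rec:
  "k \<le> L s \<Longrightarrow> tail_prod v w s k = drop_at v s k * drop_at w s k + tail_prod v w s (Suc k)"
  by (simp add: tail_prod_def sum.atLeast_Suc_atMost)

lemma B_eq_tail_prod:
  "v \<in> root_space a b c \<Longrightarrow> w \<in> root_space a b c \<Longrightarrow>
    B v w = (\<Sum>u\<in>UNIV. tail_prod v w u 0) - v Branch * w Branch"
  by (simp add: B_eq_drops tail_prod_def atMost_atLeast0)

text \<open>
  At a leaf there is no path with this middle vertex, so its coefficient has to vanish.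
\<close>

lemma path_coeff_leaf:
  assumes "v \<in> root_space a b c" "w \<in> root_space a b c" "Suc p = L s"
  shows "path_coeff v w s p = 0"
proof -
  have "drop_at v s (Suc p) = v (Node s p)" "drop_at w s (Suc p) = w (Node s p)"
    using assms(1,2) by (simp_all add: drop_at_def root_spaceD flip: assms(3))
  then show ?thesis by (simp add: path_coeff_def tail_prod_def flip: assms(3))
qed

lemma local_part_support:
  assumes "v \<in> root_space a b c" "w \<in> root_space a b c" "i \<in> V"
  shows "local_part v w i \<in> root_space a b c"
proof (cases i)
  case Branch
  then show ?thesis
    using B_fork(2) by (auto simp: root_space_iff sum_arms scaleR_fun_def)
next
  case (Node s p)
  then consider "Suc p < L s" | "Suc p = L s" using assms(3) by fastforce
  then show ?thesis
  proof cases
    case 1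
    then show ?thesis
      using Node B_triple(2)[OF 1] theta_support[of p s]
      by (auto simp: root_space_iff scaleR_fun_def)
  next
    case 2
    then show ?thesis
      using Node path_coeff_leaf[OF assms(1,2) 2] theta_support[of p s]
      by (auto simp: root_space_iff scaleR_fun_def)
  qed
qed

lemma local_part_Branch_apply:
  assumes "v \<in> root_space a b c" "w \<in> root_space a b c" "B v w = 0"
  shows "local_part v w Branch x = (case x of Branch \<Rightarrow> v Branch * w Branch
    | Node s p \<Rightarrow> if p = 0 then v Branch * w Branch - tail_prod v w s 0 else 0)"
proof -
  have total: "tail_prod v w Arm1 0 + tail_prod v w Arm2 0 + tail_prod v w Arm3 0
      = v Branch * w Branch"
    using B_eq_tail_prod[OF assms(1,2)] assms(3) by (simp add: sum_arms)
  show ?thesis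
  proof (cases x)
    case (Node s p)
    then show ?thesis
      using total by (cases s) (simp_all add: sum_arms scaleR_fun_def fork_apply)
  qed (use total in \<open>simp add: sum_arms scaleR_fun_def fork_apply\<close>)
qed

lemma local_part_Node_apply:
  assumes "p < L s"
  shows "local_part v w (Node s p) x =
    (if x = Node s p then v (Node s p) * w (Node s p)
     else if x = parent s p then v (Node s p) * w (Node s p) + tail_prod v w s (Suc p)
     else if x = Node s (Suc p) then path_coeff v w s p
     else tail_prod v w s (Suc p) * theta s p x)"
proof -
  have "theta s p (parent s p) = 2" "theta s p (Node s p) = 1" "theta s p (Node s (Suc p)) = 0"
    using assms by (cases p; simp add: theta_apply parent_def)+
  then show ?thesis
    by (auto simp: scaleR_fun_def triple_apply path_coeff_def)
qed

definition remainder :: "(vertex \<Rightarrow> real) \<Rightarrow> (vertex \<Rightarrow> real) \<Rightarrow> vertex \<times> vertex \<Rightarrow> real" where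
  "remainder v w = (v \<or>\<^sub>V w) - (\<Sum>i\<in>V. simple_root i \<or>\<^sub>V local_part v w i)"

lemma remainder_apply:
  assumes "i \<in> V" "j \<in> V"
  shows "remainder v w (i, j) = v i * w j + w i * v j - local_part v w i j - local_part v w j i"
proof -
  have "(\<Sum>k\<in>V. simple_root k \<or>\<^sub>V local_part v w k) (i, j)
    = (\<Sum>k\<in>V. local_part v w k j * simple_root k i) + (\<Sum>k\<in>V. local_part v w k i * simple_root k j)"
    unfolding sum.distrib[symmetric] by (simp add: sum_fun_apply sym_prod_apply mult.commute)
  then show ?thesis
    using assms by (simp only: remainder_def minus_apply sum_V_delta sym_prod_apply) simp
qed

lemma remainder_sym: "i \<in> V \<Longrightarrow> j \<in> V \<Longrightarrow> remainder v w (i, j) = remainder v w (j, i)"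
  by (simp add: remainder_apply algebra_simps)

lemma remainder_in_sym_square:
  assumes "v \<in> root_space a b c" "w \<in> root_space a b c"
  shows "remainder v w \<in> sym_square a b c"
  unfolding remainder_def
  using assms
  by (intro subspace_diff subspace_sum subspace_sym_square sym_prod_in_sym_square
      simple_root_in_root_space local_part_support)

text \<open>
  The telescoping identity \<open>a\<^sub>k\<^sub>-\<^sub>1 b\<^sub>k + a\<^sub>k b\<^sub>k\<^sub>-\<^sub>1 = a\<^sub>k\<^sub>-\<^sub>1 b\<^sub>k\<^sub>-\<^sub>1 + a\<^sub>k b\<^sub>k - x\<^sub>k\<^sub>-\<^sub>1 y\<^sub>k\<^sub>-\<^sub>1\<close>, where \<open>k = p + 1\<close>. If the
  parent is the branch vertex, orthogonality is used to evaluate its local part.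
\<close>

lemma remainder_Node_parent:
  assumes v: "v \<in> root_space a b c" and w: "w \<in> root_space a b c" and orth: "B v w = 0"
    and p: "p < L s"
  shows "remainder v w (Node s p, parent s p) = 0"
proof (cases p)
  case 0
  have "tail_prod v w s 0 = drop_at v s 0 * drop_at w s 0 + tail_prod v w s 1"
    using tail_prod_rec[of 0 s] by simp
  then show ?thesis
    using p local_part_Branch_apply[OF v w orth]
    by (simp add: remainder_apply parent_in_V local_part_Node_apply 0 parent_def drop_at_def
        del: local_part.simps)
      (simp add: algebra_simps)
next
  case (Suc r)
  have "tail_prod v w s p = drop_at v s p * drop_at w s p + tail_prod v w s (Suc p)"
    using tail_prod_rec[of p s] p by simp
  then show ?thesis
    using p
    by (simp add: remainder_apply local_part_Node_apply Suc parent_def drop_at_def path_coeff_def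
        del: local_part.simps split: nat.splits)
      (simp add: algebra_simps)
qed

lemma remainder_local:
  assumes v: "v \<in> root_space a b c" and w: "w \<in> root_space a b c" and orth: "B v w = 0"
    and V: "i \<in> V" "j \<in> V" and c: "cartan i j \<noteq> 0"
  shows "remainder v w (i, j) = 0"
proof -
  have arm: "remainder v w (i, j) = 0"
    if "i = Node s p" "i \<in> V" "j \<in> V" "cartan i j \<noteq> 0" for i j s p
  proof -
    have p: "p < L s" using that by simp
    have "j = i \<or> j = parent s p \<or> j = Node s (Suc p)"
      using that by (auto simp: cartan_0_iff adj_Node_iff)
    then show ?thesis
    proof (elim disjE)
      assume "j = i"
      then show ?thesis
        using that p by (simp add: remainder_apply local_part_Node_apply del: local_part.simps)
    next
      assume "j = parent s p"
      then show ?thesis using remainder_Node_parent[OF v w orth p] that by simp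
    next
      assume j: "j = Node s (Suc p)"
      then show ?thesis
        using remainder_Node_parent[OF v w orth, of "Suc p" s] remainder_sym[of i j] that
        by (simp add: parent_def)
    qed
  qed
  show ?thesis
  proof (cases i)
    case Branch
    show ?thesis
    proof (cases j)
      assume "j = Branch"
      then show ?thesis
        using Branch local_part_Branch_apply[OF v w orth]
        by (simp add: remainder_apply del: local_part.simps)
    next
      fix s p assume "j = Node s p"
      then show ?thesis
        using arm[of j s p i] V c remainder_sym[of i j] by (simp add: cartan_sym)
    qed
  qed (use arm V c in blast)
qed

text \<open>
  The inequalities that make all coefficients of the expansion nonnegative: those of the elements
  with factor \<open>\<theta>\<close> and of the paths through the branch vertex; those of the other paths; and those
  of \<open>\<alpha>\<^sub>i \<or> \<alpha>\<^sub>j\<close> for vertices on the same arm (\<open>\<theta>\<^sub>i\<close> has coefficient \<open>2\<close> at inner vertices), for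
  vertices on different arms with exactly one of them adjacent to the branch vertex, and for two
  neighbours of the branch vertex, where both \<open>\<theta>\<^sub>i\<close> and \<open>\<theta>\<^sub>j\<close> contribute.
\<close>

definition dominant_pair :: "(vertex \<Rightarrow> real) \<Rightarrow> (vertex \<Rightarrow> real) \<Rightarrow> bool" where
  "dominant_pair v w \<longleftrightarrow>
    (\<forall>s k. k \<le> L s \<longrightarrow> 0 \<le> tail_prod v w s k) \<and>
    (\<forall>s k. k \<le> L s \<longrightarrow> tail_prod v w s k \<le> arm_coeff v s k * arm_coeff w s k) \<and>
    (\<forall>s l k. l < k \<longrightarrow> k \<le> L s \<longrightarrow>
      2 * tail_prod v w s k \<le> arm_coeff v s l * arm_coeff w s k + arm_coeff w s l * arm_coeff v s k) \<and>
    (\<forall>s t k. s \<noteq> t \<longrightarrow> 1 \<le> k \<longrightarrow> k \<le> L s \<longrightarrow>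
      tail_prod v w s k \<le> arm_coeff v s k * arm_coeff w t 1 + arm_coeff w s k * arm_coeff v t 1) \<and>
    (\<forall>s t. s \<noteq> t \<longrightarrow> tail_prod v w s 1 + tail_prod v w t 1
      \<le> arm_coeff v s 1 * arm_coeff w t 1 + arm_coeff w s 1 * arm_coeff v t 1)"

lemma Ints_nonneg_Nats: "(x::real) \<in> \<int> \<Longrightarrow> 0 \<le> x \<Longrightarrow> x \<in> \<nat>"
  by (simp add: Nats_altdef2)

lemma dominant_pair_in_nat_cone:
  assumes v: "v \<in> root_space a b c" and w: "w \<in> root_space a b c" and orth: "B v w = 0"
    and nonneg: "nonneg v" "nonneg w"
    and int: "\<And>x. v x \<in> \<int>" "\<And>x. w x \<in> \<int>"
    and dom: "dominant_pair v w"
  shows "v \<or>\<^sub>V w \<in> nat_cone"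
proof -
  have v0: "v x \<ge> 0" and w0: "w x \<ge> 0" for x
    using nonneg by (simp_all add: nonneg_def)
  note coeffs = v0 w0
  have ac_int: "drop_at v s k \<in> \<int>" "drop_at w s k \<in> \<int>" for s k
    by (cases k; simp add: drop_at_def int Ints_diff)+
  have tail_int: "tail_prod v w s k \<in> \<int>" for s k
    unfolding tail_prod_def by (intro Ints_sum Ints_mult ac_int)
  have tail_pos: "0 \<le> tail_prod v w s k" if "k \<le> L s" for s k
    using dom that unfolding dominant_pair_def by blast
  have tail_nat: "tail_prod v w s k \<in> \<nat>" if "k \<le> L s" for s k
    using tail_pos[OF that] tail_int by (rule Ints_nonneg_Nats[rotated])
  have path_nat: "path_coeff v w s p \<in> \<nat>" if "p < L s" for s p
  proof -
    have "tail_prod v w s (Suc p) \<le> v (Node s p) * w (Node s p)"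
      using dom that unfolding dominant_pair_def by (metis Suc_leI arm_coeff_Suc)
    then show ?thesis
      unfolding path_coeff_def
      by (intro Ints_nonneg_Nats Ints_diff Ints_mult int tail_int) simp
  qed
  have local: "simple_root i \<or>\<^sub>V local_part v w i \<in> nat_cone" if "i \<in> V" for i
  proof (cases i)
    case Branch
    have "simple_root Branch \<or>\<^sub>V local_part v w Branch
      = (\<Sum>u\<in>UNIV. tail_prod v w u 0 *\<^sub>R (simple_root Branch \<or>\<^sub>V fork u))"
      by (simp add: sum_arms sym_prod_add_right sym_prod_scaleR_right)
    then show ?thesis
      using Branch by (simp only:) (intro nat_cone_sum nat_cone_scale fork_in_CB tail_nat, simp)
  next
    case (Node s p)
    then have p: "p < L s" using that by simp
    have "path_coeff v w s p *\<^sub>R (simple_root (Node s p) \<or>\<^sub>V triple s p) \<in> nat_cone"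
    proof (cases "Suc p = L s")
      case True
      then show ?thesis by (simp add: path_coeff_leaf v w nat_cone_0)
    next
      case False
      then show ?thesis
        using p by (intro nat_cone_scale path_nat triple_in_CB) auto
    qed
    moreover have "tail_prod v w s (Suc p) *\<^sub>R (simple_root (Node s p) \<or>\<^sub>V theta s p) \<in> nat_cone"
      using p by (intro nat_cone_scale tail_nat theta_in_CB) auto
    ultimately show ?thesis
      by (simp add: Node sym_prod_add_right sym_prod_scaleR_right nat_cone_add)
  qed
  have rem_pos: "remainder v w (i, j) \<ge> 0" if V: "i \<in> V" "j \<in> V" and c: "cartan i j = 0" for i j
  proof -
    have same: "remainder v w (Node s p, j) \<ge> 0"
      if "p < L s" "j = Branch \<or> (\<exists>r<p. j = Node s r)" "cartan (Node s p) j = 0" for s p j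
    proof -
      obtain l where l: "l < Suc p" "arm_coeff v s l = v j" "arm_coeff w s l = w j" "j \<in> V"
      proof (cases j)
        case Branch
        then show ?thesis using that[of 0] by simp
      next
        case (Node t r)
        then show ?thesis
          using that[of "Suc r"] \<open>p < L s\<close> \<open>j = Branch \<or> (\<exists>r<p. j = Node s r)\<close> by auto
      qed
      have "2 * tail_prod v w s (Suc p) \<le> v j * w (Node s p) + w j * v (Node s p)"
        using dom l \<open>p < L s\<close> unfolding dominant_pair_def
        by (metis Suc_leI arm_coeff_Suc)
      moreover have "j \<noteq> parent s p" "j \<noteq> Node s p" "j \<noteq> Node s (Suc p)"
        using that(3) by (auto simp: cartan_0_iff adj_Node_iff)
      then have "local_part v w (Node s p) j = 2 * tail_prod v w s (Suc p)"
        using that(1,2) by (auto simp: local_part_Node_apply theta_apply simp del: local_part.simps)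
      moreover have "local_part v w j (Node s p) = 0"
      proof (cases j)
        case Branch
        then show ?thesis
          using local_part_Branch_apply[OF v w orth] that(3)
          by (cases p) (simp_all add: cartan_def del: local_part.simps)
      next
        case (Node t r)
        then have r: "t = s" "r < p" using that(2) by auto
        have "parent s r \<noteq> Node s p" using r by (cases r) (auto simp: parent_def)
        moreover have "p \<noteq> Suc r" using that(3) Node r by (auto simp: cartan_def)
        ultimately show ?thesis
          using Node r that(1)
          by (simp add: local_part_Node_apply theta_apply del: local_part.simps)
      qed
      ultimately show ?thesis
        using l that(1) by (simp add: remainder_apply mult.commute del: local_part.simps)
    qed
    have cross: "remainder v w (Node s p, Node t q) \<ge> 0"
      if st: "s \<noteq> t" and p: "p < L s" and q: "q < L t" for s t p q
    proof -
      have lp: "local_part v w (Node s p) (Node t q) = (if q = 0 then tail_prod v w s (Suc p) else 0)"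
        if "s \<noteq> t" "p < L s" for s t p q
      proof -
        have "parent s p \<noteq> Node t q" using that by (cases p) (auto simp: parent_def)
        then show ?thesis
          using that by (simp add: local_part_Node_apply theta_apply del: local_part.simps)
      qed
      have one: "tail_prod v w s (Suc p) \<le> v (Node s p) * w (Node t 0) + w (Node s p) * v (Node t 0)"
        if "s \<noteq> t" "p < L s" for s t p
      proof -
        have "tail_prod v w s (Suc p) \<le> arm_coeff v s (Suc p) * arm_coeff w t 1
            + arm_coeff w s (Suc p) * arm_coeff v t 1"
          using dom that unfolding dominant_pair_def by (metis Suc_leI Suc_eq_plus1 le_add2)
        then show ?thesis by simp
      qed
      have two: "tail_prod v w s 1 + tail_prod v w t 1
          \<le> v (Node s 0) * w (Node t 0) + w (Node s 0) * v (Node t 0)"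
      proof -
        have "tail_prod v w s 1 + tail_prod v w t 1
          \<le> arm_coeff v s 1 * arm_coeff w t 1 + arm_coeff w s 1 * arm_coeff v t 1"
          using dom st unfolding dominant_pair_def by blast
        then show ?thesis by simp
      qed
      have prods: "0 \<le> v x * w y" for x y using coeffs by simp
      show ?thesis
        using lp[OF st p, of q] lp[OF st[symmetric] q, of p] one[OF st p] one[OF st[symmetric] q]
          two prods[of "Node s p" "Node t q"] prods[of "Node t q" "Node s p"] p q
        by (cases "p = 0"; cases "q = 0")
          (simp_all add: remainder_apply mult.commute del: local_part.simps)
    qed
    have half: "remainder v w (Node s p, j) \<ge> 0"
      if "p < L s" "j \<in> V" "cartan (Node s p) j = 0" for s p j
    proof (cases j)
      case Branch
      then show ?thesis using same that by blast
    next
      case (Node t r)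
      then have r: "r < L t" using that by simp
      show ?thesis
      proof (cases "t = s")
        case True
        show ?thesis
        proof (cases "r < p")
          case True
          then show ?thesis using same that Node \<open>t = s\<close> by blast
        next
          case False
          then have "p < r" using that(3) Node \<open>t = s\<close> by (auto simp: cartan_0_iff)
          then have "remainder v w (Node s r, Node s p) \<ge> 0"
            using same[of r s "Node s p"] that(3) r Node \<open>t = s\<close> by (simp add: cartan_sym)
          then show ?thesis
            using remainder_sym[of "Node s r" "Node s p"] r that(1) Node \<open>t = s\<close> by simp
        qed
      next
        case False
        then show ?thesis using cross[of s t p r] that r Node by simp
      qed
    qed
    show ?thesis
    proof (cases i)
      case (Node s p)
      then show ?thesis using half V c by simp
    next
      case Branch
      then have "j \<noteq> Branch" using c by (auto simp: cartan_0_iff)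
      then obtain s p where j: "j = Node s p" by (cases j) auto
      then have "remainder v w (j, i) \<ge> 0"
        using half[of p s i] V c by (simp add: cartan_sym)
      then show ?thesis using remainder_sym V by simp
    qed
  qed
  have fork_int: "fork u x \<in> \<int>" and triple_int: "triple s p x \<in> \<int>" for u s p x
    by (simp_all add: fork_apply triple_apply)
  have theta_int: "theta s p x \<in> \<int>" if "p < L s" for s p x
    using that by (simp add: theta_apply split: vertex.split)
  have local_int: "local_part v w i x \<in> \<int>" if "i \<in> V" for i x
  proof (cases i)
    case Branch
    then show ?thesis
      by (auto simp: sum_fun_apply scaleR_fun_def intro!: Ints_sum Ints_mult tail_int fork_int)
  next
    case (Node s p)
    then show ?thesis
      using that unfolding path_coeff_def
      by (auto simp: scaleR_fun_def path_coeff_def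
          intro!: Ints_add Ints_mult Ints_diff tail_int triple_int theta_int int)
  qed
  have "remainder v w \<in> nat_cone"
  proof (rule nonadjacent_in_nat_cone)
    show "remainder v w \<in> sym_square a b c" using v w by (rule remainder_in_sym_square)
    show "remainder v w (i, j) = 0" if "i \<in> V" "j \<in> V" "cartan i j \<noteq> 0" for i j
      using remainder_local[OF v w orth] that by blast
    show "remainder v w (i, j) \<in> \<nat>" if "i \<in> V" "j \<in> V" "cartan i j = 0" for i j
    proof (rule Ints_nonneg_Nats)
      show "remainder v w (i, j) \<in> \<int>"
        using that by (simp only: remainder_apply Ints_add Ints_diff Ints_mult int local_int)
      show "0 \<le> remainder v w (i, j)" using rem_pos that by blast
    qed
  qed
  moreover have "(\<Sum>i\<in>V. simple_root i \<or>\<^sub>V local_part v w i) \<in> nat_cone"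
    by (intro nat_cone_sum local)
  ultimately have "remainder v w + (\<Sum>i\<in>V. simple_root i \<or>\<^sub>V local_part v w i) \<in> nat_cone"
    by (rule nat_cone_add)
  then show ?thesis by (simp add: remainder_def)
qed

section \<open>Orthogonal positive roots\<close>

lemma drop_ge0_arm_coeff_mono:
  assumes "v \<in> root_space a b c" "\<And>k. k \<le> L s \<Longrightarrow> drop_at v s k \<ge> 0" "k \<le> l" "l \<le> L s"
  shows "0 \<le> arm_coeff v s l" "arm_coeff v s l \<le> arm_coeff v s k"
proof -
  show "0 \<le> arm_coeff v s l"
    using assms by (subst arm_coeff_eq_sum) (auto intro: sum_nonneg)
  have "(\<Sum>m=l..L s. drop_at v s m) \<le> (\<Sum>m=k..L s. drop_at v s m)"
    using assms by (intro sum_mono2) auto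
  then show "arm_coeff v s l \<le> arm_coeff v s k"
    using assms by (simp add: arm_coeff_eq_sum)
qed

lemma drop_at_0: "drop_at v s 0 = v Branch - arm_coeff v s 1"
  by (simp add: drop_at_def)

text \<open>
  An exceptional root has a single nonzero drop on each arm, so orthogonality to it is a linear
  relation between three drops of \<open>\<beta>\<close>. The drop on the third arm is written as a tail product to
  avoid naming its position.
\<close>

lemma exceptional_orthogonal:
  assumes \<alpha>: "\<alpha> \<in> real_roots" and \<beta>: "\<beta> \<in> real_roots" and orth: "B \<alpha> \<beta> = 0"
    and A: "\<alpha> Branch > 0"
    and st: "s \<noteq> t" "u \<noteq> s" "u \<noteq> t" and l: "l \<le> L s" and m: "m \<le> L t"
    and exc: "drop_at \<alpha> s l + drop_at \<alpha> t m > \<alpha> Branch"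
  shows "\<alpha> Branch = 1" "drop_at \<alpha> s l = 1" "drop_at \<alpha> t m = 1"
    "\<beta> Branch - drop_at \<beta> s l - drop_at \<beta> t m = tail_prod \<alpha> \<beta> u 0"
proof -
  show 1: "\<alpha> Branch = 1" "drop_at \<alpha> s l = 1" "drop_at \<alpha> t m = 1"
    using exceptional[OF \<alpha> A st(1) l m exc] by auto
  have tail: "tail_prod \<alpha> \<beta> r 0 = drop_at \<beta> r k" if "k \<le> L r" "drop_at \<alpha> r k = 1" for r k
  proof -
    have "(\<Sum>i\<in>{..L r} - {k}. drop_at \<alpha> r i) = 0"
      using sum_drops[OF real_root_in_root_space[OF \<alpha>], of r] that 1(1)
      by (simp add: sum.remove[of "{..L r}" k])
    then have zero: "drop_at \<alpha> r i = 0" if "i \<le> L r" "i \<noteq> k" for i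
      using that drop_nonneg[OF \<alpha> A] by (subst (asm) sum_nonneg_eq_0_iff) auto
    have "tail_prod \<alpha> \<beta> r 0 = (\<Sum>i=0..L r. if i = k then drop_at \<beta> r k else 0)"
      unfolding tail_prod_def using zero that(2) by (intro sum.cong) auto
    then show ?thesis using that(1) by simp
  qed
  have sum3: "(\<Sum>r\<in>UNIV. f r) = f s + f t + f u" for f :: "arm \<Rightarrow> real"
    using st by (cases s; cases t; cases u) (simp_all add: sum_arms)
  have "(\<Sum>r\<in>UNIV. tail_prod \<alpha> \<beta> r 0) = \<beta> Branch"
    using B_eq_tail_prod[of \<alpha> \<beta>] orth \<alpha> \<beta> 1(1) by (simp add: real_root_in_root_space)
  then show "\<beta> Branch - drop_at \<beta> s l - drop_at \<beta> t m = tail_prod \<alpha> \<beta> u 0"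
    using tail[OF l 1(2)] tail[OF m 1(3)] by (simp add: sum3)
qed

text \<open>
  All drops are nonnegative here, which gives the inequalities for a single arm at once. Those for
  two arms use that the sum of two drops is at most the branch coefficient, apart from the exceptional
  roots.
\<close>

lemma dominant_pair_positive_heights:
  assumes \<alpha>: "\<alpha> \<in> real_roots" and \<beta>: "\<beta> \<in> real_roots" and orth: "B \<alpha> \<beta> = 0"
    and A: "\<alpha> Branch > 0" and B: "\<beta> Branch > 0"
  shows "dominant_pair \<alpha> \<beta>"
proof -
  note rs = real_root_in_root_space[OF \<alpha>] real_root_in_root_space[OF \<beta>]
  have x0: "drop_at \<alpha> s k \<ge> 0" if "k \<le> L s" for s k using drop_nonneg[OF \<alpha> A that] .
  have y0: "drop_at \<beta> s k \<ge> 0" if "k \<le> L s" for s k using drop_nonneg[OF \<beta> B that] .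
  note xmono = drop_ge0_arm_coeff_mono[OF rs(1) x0] and ymono = drop_ge0_arm_coeff_mono[OF rs(2) y0]
  have tail0: "0 \<le> tail_prod \<alpha> \<beta> s k" for s k
    unfolding tail_prod_def by (intro sum_nonneg mult_nonneg_nonneg x0 y0) auto
  have tail_le: "tail_prod \<alpha> \<beta> s k \<le> arm_coeff \<alpha> s k * arm_coeff \<beta> s k" if "k \<le> L s" for s k
  proof -
    have "tail_prod \<alpha> \<beta> s k \<le> (\<Sum>l=k..L s. drop_at \<alpha> s l * arm_coeff \<beta> s k)"
      unfolding tail_prod_def
    proof (intro sum_mono mult_left_mono x0)
      fix l assume l: "l \<in> {k..L s}"
      show "drop_at \<beta> s l \<le> arm_coeff \<beta> s k"
        using that l member_le_sum[of l "{k..L s}" "drop_at \<beta> s"] y0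
        by (subst arm_coeff_eq_sum[OF rs(2)]) auto
    qed simp
    also have "\<dots> = arm_coeff \<alpha> s k * arm_coeff \<beta> s k"
      using that by (simp add: arm_coeff_eq_sum[OF rs(1)] sum_distrib_right)
    finally show ?thesis .
  qed
  have same: "2 * tail_prod \<alpha> \<beta> s k
      \<le> arm_coeff \<alpha> s l * arm_coeff \<beta> s k + arm_coeff \<beta> s l * arm_coeff \<alpha> s k"
    if "l < k" "k \<le> L s" for s l k
  proof -
    have "arm_coeff \<alpha> s k * arm_coeff \<beta> s k \<le> arm_coeff \<alpha> s l * arm_coeff \<beta> s k"
      using that xmono(2)[where k = l and l = k and s = s] ymono(1)[where k = l and l = k and s = s] by (intro mult_right_mono) auto
    moreover have "arm_coeff \<beta> s k * arm_coeff \<alpha> s k \<le> arm_coeff \<beta> s l * arm_coeff \<alpha> s k"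
      using that ymono(2)[where k = l and l = k and s = s] xmono(1)[where k = l and l = k and s = s] by (intro mult_right_mono) auto
    ultimately show ?thesis using tail_le[OF that(2)] by (simp add: mult.commute)
  qed
  have cross: "tail_prod \<alpha> \<beta> s k
      \<le> arm_coeff \<alpha> s k * arm_coeff \<beta> t 1 + arm_coeff \<beta> s k * arm_coeff \<alpha> t 1"
    if st: "s \<noteq> t" and k: "k \<le> L s" for s t k
  proof -
    obtain u where u: "u \<noteq> s" "u \<noteq> t" using third_arm[OF st] by metis
    have a1: "arm_coeff \<alpha> t 1 \<ge> 0" "arm_coeff \<beta> t 1 \<ge> 0"
      using xmono(1)[where k = 0 and l = 1 and s = t] ymono(1)[where k = 0 and l = 1 and s = t] L_pos[of t] by auto
    \<comment> \<open>The inequality holds summand by summand, for every drop \<open>l\<close> of the tail.\<close>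
    have term_le: "drop_at \<alpha> s l * drop_at \<beta> s l
        \<le> drop_at \<alpha> s l * arm_coeff \<beta> t 1 + drop_at \<beta> s l * arm_coeff \<alpha> t 1" if l: "l \<le> L s" for l
    proof (cases "drop_at \<alpha> s l + drop_at \<alpha> t 0 > \<alpha> Branch")
      case True
      note exc = exceptional_orthogonal[OF \<alpha> \<beta> orth A st u l le0 True]
      have "drop_at \<beta> s l \<le> arm_coeff \<beta> t 1"
        using exc(4) tail0[of u 0] by (simp add: drop_at_0)
      then show ?thesis using exc(2) a1 y0[OF l] by (simp add: add_increasing2)
    next
      case False
      then have "drop_at \<alpha> s l \<le> arm_coeff \<alpha> t 1" by (simp add: drop_at_0)
      then have "drop_at \<alpha> s l * drop_at \<beta> s l \<le> drop_at \<beta> s l * arm_coeff \<alpha> t 1"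
        using y0[OF l] by (subst mult.commute) (intro mult_left_mono)
      then show ?thesis using x0[OF l] a1 by (simp add: add_increasing)
    qed
    have "tail_prod \<alpha> \<beta> s k \<le> (\<Sum>l=k..L s. drop_at \<alpha> s l * arm_coeff \<beta> t 1
        + drop_at \<beta> s l * arm_coeff \<alpha> t 1)"
      unfolding tail_prod_def by (intro sum_mono term_le) simp
    also have "\<dots> = arm_coeff \<alpha> s k * arm_coeff \<beta> t 1 + arm_coeff \<beta> s k * arm_coeff \<alpha> t 1"
      using k by (simp add: arm_coeff_eq_sum[OF rs(1), of k] arm_coeff_eq_sum[OF rs(2), of k]
          sum.distrib sum_distrib_right)
    finally show ?thesis .
  qed
  have ends: "tail_prod \<alpha> \<beta> s 1 + tail_prod \<alpha> \<beta> t 1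
      \<le> arm_coeff \<alpha> s 1 * arm_coeff \<beta> t 1 + arm_coeff \<beta> s 1 * arm_coeff \<alpha> t 1"
    if st: "s \<noteq> t" for s t
  proof -
    obtain u where u: "u \<noteq> s" "u \<noteq> t"
      and sum3: "\<And>f :: arm \<Rightarrow> real. (\<Sum>r\<in>UNIV. f r) = f s + f t + f u"
      using third_arm[OF st] by metis
    define X where "X = \<alpha> Branch - drop_at \<alpha> s 0 - drop_at \<alpha> t 0"
    define Y where "Y = \<beta> Branch - drop_at \<beta> s 0 - drop_at \<beta> t 0"
    \<comment> \<open>With orthogonality the claim becomes this inequality. In the exceptional case one factor is \<open>-1\<close>
      and the other equals the tail product.\<close>
    have "X * Y + tail_prod \<alpha> \<beta> u 0 \<ge> 0"
    proof -
      consider "drop_at \<alpha> s 0 + drop_at \<alpha> t 0 > \<alpha> Branch"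
        | "drop_at \<beta> s 0 + drop_at \<beta> t 0 > \<beta> Branch" | "X \<ge> 0" "Y \<ge> 0"
        unfolding X_def Y_def by linarith
      then show ?thesis
      proof cases
        case 1
        note exc = exceptional_orthogonal[OF \<alpha> \<beta> orth A st u le0 le0 1]
        show ?thesis using exc by (simp add: X_def Y_def)
      next
        case 2
        have "B \<beta> \<alpha> = 0" using orth by (simp add: B_sym)
        note exc = exceptional_orthogonal[OF \<beta> \<alpha> this B st u le0 le0 2]
        show ?thesis using exc by (simp add: X_def Y_def tail_prod_commute)
      next
        case 3
        then show ?thesis using tail0[of u 0] by simp
      qed
    qed
    moreover have "tail_prod \<alpha> \<beta> s 0 + tail_prod \<alpha> \<beta> t 0 + tail_prod \<alpha> \<beta> u 0 = \<alpha> Branch * \<beta> Branch"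
      using B_eq_tail_prod[OF rs] orth by (simp add: sum3)
    ultimately show ?thesis
      using tail_prod_rec[of 0 s \<alpha> \<beta>] tail_prod_rec[of 0 t \<alpha> \<beta>]
      by (simp add: X_def Y_def drop_at_0 algebra_simps)
  qed
  show ?thesis
    unfolding dominant_pair_def using tail0 tail_le same cross ends by blast
qed

text \<open>
  Orthogonality to \<open>\<epsilon>\<^sub>i - \<epsilon>\<^sub>j\<close> says that \<open>\<beta>\<close> has the same drop \<open>y\<close> at \<open>i\<close> and at \<open>j\<close>. The
  coefficients of \<open>\<alpha>\<close> are \<open>0\<close> or \<open>1\<close>, the tail product is \<open>y\<close> times such a coefficient, and every
  inequality reduces to a bound for \<open>y\<close> by a coefficient of \<open>\<beta>\<close>.
\<close>

lemma dominant_pair_left_height0: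
  assumes \<alpha>: "\<alpha> \<in> real_roots" and \<beta>: "\<beta> \<in> real_roots" and orth: "B \<alpha> \<beta> = 0"
    and pos: "nonneg \<alpha>" "nonneg \<beta>" and A: "\<alpha> Branch = 0"
  shows "dominant_pair \<alpha> \<beta>"
proof -
  note rs = real_root_in_root_space[OF \<alpha>] real_root_in_root_space[OF \<beta>]
  obtain s i j where ij: "j < i" "i \<le> L s"
    and x: "\<And>t k. k \<le> L t \<Longrightarrow> drop_at \<alpha> t k =
      (if t = s then if k = i then 1 else if k = j then - 1 else 0 else 0)"
    by (rule height0_root[OF \<alpha> pos(1) A]) (rule that; assumption)
  define y where "y = drop_at \<beta> s i"
  have b0: "arm_coeff \<beta> t k \<ge> 0" for t k
    using pos(2) by (cases k) (auto simp: nonneg_def)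
  have two: "(\<Sum>l=k..L s. (if l = i then f i else if l = j then - f j else 0))
      = (if k \<le> i then f i else 0) - (if k \<le> j then f j else 0)" for k and f :: "nat \<Rightarrow> real"
  proof -
    have "(\<Sum>l=k..L s. (if l = i then f i else if l = j then - f j else 0))
      = (\<Sum>l=k..L s. (if l = i then f i else 0) - (if l = j then f j else 0))"
      using ij by (intro sum.cong) auto
    also have "\<dots> = (\<Sum>l=k..L s. if l = i then f i else 0) - (\<Sum>l=k..L s. if l = j then f j else 0)"
      by (rule sum_subtractf)
    finally show ?thesis using ij by simp
  qed
  have a: "arm_coeff \<alpha> t k = (if t = s \<and> j < k \<and> k \<le> i then 1 else 0)" if "k \<le> L t" for t k
  proof (cases "t = s")
    case True
    have "arm_coeff \<alpha> s k = (\<Sum>l=k..L s. (if l = i then 1 else if l = j then - 1 else 0))"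
      using that True by (simp add: arm_coeff_eq_sum[OF rs(1)] x)
    then show ?thesis using two[where k = k and f = "\<lambda>_. 1"] ij True by auto
  next
    case False
    then show ?thesis using that by (simp add: arm_coeff_eq_sum[OF rs(1)] x)
  qed
  have tail: "tail_prod \<alpha> \<beta> t k = (if t = s then (if k \<le> i then y else 0)
      - (if k \<le> j then drop_at \<beta> s j else 0) else 0)" for t k
  proof (cases "t = s")
    case True
    have "tail_prod \<alpha> \<beta> s k
      = (\<Sum>l=k..L s. (if l = i then drop_at \<beta> s i else if l = j then - drop_at \<beta> s j else 0))"
      unfolding tail_prod_def using ij by (intro sum.cong) (auto simp: x)
    then show ?thesis using two[where k = k and f = "drop_at \<beta> s"] True by (simp add: y_def)
  qed (simp add: tail_prod_def x)
  have "(\<Sum>t\<in>UNIV. tail_prod \<alpha> \<beta> t 0) = tail_prod \<alpha> \<beta> s 0"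
    by (cases s) (simp_all add: sum_arms tail)
  then have "tail_prod \<alpha> \<beta> s 0 = 0"
    using B_eq_tail_prod[OF rs] orth A by simp
  then have yj: "drop_at \<beta> s j = y"
    by (simp add: tail)
  have tail': "tail_prod \<alpha> \<beta> t k = arm_coeff \<alpha> t k * y" if "k \<le> L t" for t k
    using a[OF that] ij by (auto simp: tail yj)
  \<comment> \<open>If \<open>\<beta>\<close> also has branch coefficient \<open>0\<close>, its nonzero drops are \<open>1\<close> and \<open>-1\<close>, so \<open>y\<close> vanishes.\<close>
  have y: "0 \<le> y \<and> (\<forall>k\<le>i. y \<le> arm_coeff \<beta> s k) \<and> (\<forall>k\<le>j. 2 * y \<le> arm_coeff \<beta> s k) \<and>
      (\<forall>t. t \<noteq> s \<longrightarrow> y \<le> arm_coeff \<beta> t 1)"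
  proof (cases "\<beta> Branch = 0")
    case True
    obtain s' i' j' where ij': "j' < i'" "i' \<le> L s'"
      and x': "\<And>t k. k \<le> L t \<Longrightarrow> drop_at \<beta> t k =
        (if t = s' then if k = i' then 1 else if k = j' then - 1 else 0 else 0)"
      by (rule height0_root[OF \<beta> pos(2) True]) (rule that; assumption)
    have "y = 0"
      using x'[of i s] x'[of j s] ij ij' yj by (auto simp: y_def split: if_splits)
    then show ?thesis using b0 by (simp del: arm_coeff_Suc One_nat_def)
  next
    case False
    then have Bp: "\<beta> Branch > 0" using pos(2) by (simp add: nonneg_def less_le)
    note y0 = drop_nonneg[OF \<beta> Bp]
    have "0 \<le> y" using y0 ij by (simp add: y_def)
    moreover have "y \<le> arm_coeff \<beta> s k" if "k \<le> i" for k
      using that ij member_le_sum[of i "{k..L s}" "drop_at \<beta> s"] y0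
      by (subst arm_coeff_eq_sum[OF rs(2)]) (auto simp: y_def)
    moreover have "2 * y \<le> arm_coeff \<beta> s k" if "k \<le> j" for k
    proof -
      have "(\<Sum>l\<in>{i, j}. drop_at \<beta> s l) \<le> (\<Sum>l=k..L s. drop_at \<beta> s l)"
        using that ij y0 by (intro sum_mono2) auto
      then show ?thesis
        using that ij yj by (simp add: arm_coeff_eq_sum[OF rs(2)] y_def)
    qed
    moreover have "y \<le> arm_coeff \<beta> t 1" if "t \<noteq> s" for t
    proof (rule ccontr)
      assume "\<not> y \<le> arm_coeff \<beta> t 1"
      then have "drop_at \<beta> s i + drop_at \<beta> t 0 > \<beta> Branch"
        by (simp add: drop_at_0 y_def)
      then have "\<beta> Branch = 1" "y = 1"
        using exceptional[OF \<beta> Bp that[symmetric] ij(2) le0] by (simp_all add: y_def)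
      moreover have "(\<Sum>l\<in>{i, j}. drop_at \<beta> s l) \<le> (\<Sum>l\<le>L s. drop_at \<beta> s l)"
        using ij y0 by (intro sum_mono2) auto
      ultimately show False
        using ij yj sum_drops[OF rs(2), of s] by (simp add: y_def)
    qed
    ultimately show ?thesis by blast
  qed
  have y_other: "y \<le> arm_coeff \<beta> t 1" if "t \<noteq> s" for t
    using y[THEN conjunct2, THEN conjunct2, THEN conjunct2, rule_format, OF that] .
  have a0: "arm_coeff \<alpha> t k \<ge> 0" if "k \<le> L t" for t k using a[OF that] by simp
  have same: "2 * tail_prod \<alpha> \<beta> t k
      \<le> arm_coeff \<alpha> t l * arm_coeff \<beta> t k + arm_coeff \<beta> t l * arm_coeff \<alpha> t k"
    if "l < k" "k \<le> L t" for t l k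
  proof (cases "t = s \<and> j < k \<and> k \<le> i")
    case True
    then have k: "arm_coeff \<alpha> t k = 1" using a[OF that(2)] by simp
    have l: "arm_coeff \<alpha> t l = (if j < l then 1 else 0)" using a[of l t] that True by simp
    have tk: "tail_prod \<alpha> \<beta> t k = y" using tail'[OF that(2)] k by simp
    have "y \<le> arm_coeff \<beta> t k" "y \<le> arm_coeff \<beta> t l" "l \<le> j \<Longrightarrow> 2 * y \<le> arm_coeff \<beta> t l"
      using y True that by simp_all
    then show ?thesis
      unfolding tk k l by (cases "j < l") simp_all
  next
    case False
    then have "arm_coeff \<alpha> t k = 0" using a[OF that(2)] by simp
    moreover have "0 \<le> arm_coeff \<alpha> t l" using a0[of l t] that by simp
    ultimately show ?thesis using b0[of t k] by (simp add: tail'[OF that(2)])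
  qed
  have le: "tail_prod \<alpha> \<beta> t k \<le> arm_coeff \<alpha> t k * arm_coeff \<beta> t k" if "k \<le> L t" for t k
  proof (cases "t = s \<and> j < k \<and> k \<le> i")
    case True
    then have "arm_coeff \<alpha> t k = 1" "y \<le> arm_coeff \<beta> t k" using a[OF that] y by simp_all
    then show ?thesis by (simp only: tail'[OF that] mult_1)
  next
    case False
    then have "arm_coeff \<alpha> t k = 0" using a[OF that] by simp
    then show ?thesis by (simp add: tail'[OF that])
  qed
  have cross: "tail_prod \<alpha> \<beta> t k \<le> arm_coeff \<alpha> t k * arm_coeff \<beta> r 1"
    if "t \<noteq> r" "k \<le> L t" for t r k
  proof (cases "t = s \<and> j < k \<and> k \<le> i")
    case True
    then have "r \<noteq> s" using that by simp
    have "arm_coeff \<alpha> t k = 1" using True a[OF that(2)] by simp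
    then have "tail_prod \<alpha> \<beta> t k = y" "arm_coeff \<alpha> t k * arm_coeff \<beta> r 1 = arm_coeff \<beta> r 1"
      by (simp_all only: tail'[OF that(2)] mult_1)
    then show ?thesis using y_other[OF \<open>r \<noteq> s\<close>] by (simp only:)
  next
    case False
    then have "arm_coeff \<alpha> t k = 0" using a[OF that(2)] by simp
    then show ?thesis by (simp add: tail'[OF that(2)])
  qed
  have cross': "tail_prod \<alpha> \<beta> t k
      \<le> arm_coeff \<alpha> t k * arm_coeff \<beta> r 1 + arm_coeff \<beta> t k * arm_coeff \<alpha> r 1"
    if "t \<noteq> r" "k \<le> L t" for t r k
    using cross[OF that] mult_nonneg_nonneg[OF b0[of t k] a0[OF L_pos[of r]]] by linarith
  have ends: "tail_prod \<alpha> \<beta> t 1 + tail_prod \<alpha> \<beta> r 1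
      \<le> arm_coeff \<alpha> t 1 * arm_coeff \<beta> r 1 + arm_coeff \<beta> t 1 * arm_coeff \<alpha> r 1"
    if "t \<noteq> r" for t r
    using cross[OF that L_pos] cross[OF that[symmetric] L_pos]
      mult.commute[of "arm_coeff \<alpha> r 1" "arm_coeff \<beta> t 1"] by linarith
  have pos_tail: "0 \<le> tail_prod \<alpha> \<beta> t k" if "k \<le> L t" for t k
    using a0[OF that] y by (simp add: tail'[OF that])
  show ?thesis
    unfolding dominant_pair_def
    by (intro conjI allI impI) (simp_all only: pos_tail le same cross' ends not_False_eq_True)
qed

text \<open>
  The symmetry of the product allows one to assume that a root with branch coefficient \<open>0\<close> is the
  first factor.
\<close>

lemma orthogonal_positive_roots_in_nat_cone:
  assumes \<alpha>: "\<alpha> \<in> real_roots" and \<beta>: "\<beta> \<in> real_roots" and orth: "B \<alpha> \<beta> = 0"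
    and pos: "nonneg \<alpha>" "nonneg \<beta>"
  shows "\<alpha> \<or>\<^sub>V \<beta> \<in> nat_cone"
proof -
  note rs = real_root_in_root_space[OF \<alpha>] real_root_in_root_space[OF \<beta>]
  have orth': "B \<beta> \<alpha> = 0" using orth by (simp add: B_sym)
  consider "\<alpha> Branch = 0" | "\<beta> Branch = 0" | "\<alpha> Branch > 0" "\<beta> Branch > 0"
    using pos by (auto simp: nonneg_def less_le)
  then show ?thesis
  proof cases
    case 1
    then show ?thesis
      using dominant_pair_left_height0[OF \<alpha> \<beta> orth pos]
      by (intro dominant_pair_in_nat_cone rs orth pos real_root_integral \<alpha> \<beta>)
  next
    case 2
    then have "\<beta> \<or>\<^sub>V \<alpha> \<in> nat_cone"
      using dominant_pair_left_height0[OF \<beta> \<alpha> orth' pos(2,1)]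
      by (intro dominant_pair_in_nat_cone rs orth' pos real_root_integral \<alpha> \<beta>)
    then show ?thesis by (simp add: sym_prod_commute)
  next
    case 3
    then show ?thesis
      using dominant_pair_positive_heights[OF \<alpha> \<beta> orth]
      by (intro dominant_pair_in_nat_cone rs orth pos real_root_integral \<alpha> \<beta>)
  qed
qed

section \<open>The representation on the module\<close>

lemma weyl_group_cases:
  assumes "g \<in> carrier (weyl_group a b c)"
  obtains xs where "xs \<in> lists V" "g = word_rel a b c `` {xs}" "weyl_act a b c g = act xs"
proof -
  obtain xs where "xs \<in> lists V" "g = word_rel a b c `` {xs}"
    using assms unfolding weyl_group_def by (auto elim!: quotientE)
  then show ?thesis using that weyl_act_class by metis
qed

lemma linear_diagonal_act: "linear (diagonal_act a b c g)"
  by (rule linearI)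
    (simp_all add: diagonal_act_def fun_eq_iff sum_fun_apply scaleR_fun_def algebra_simps
      sum.distrib sum_distrib_left)

lemma diagonal_act_sym_prod:
  assumes "g \<in> carrier (weyl_group a b c)" "v \<in> root_space a b c" "w \<in> root_space a b c"
  shows "diagonal_act a b c g (v \<or>\<^sub>V w) = weyl_act a b c g v \<or>\<^sub>V weyl_act a b c g w"
  using assms by (simp add: sym_prod_def linear_add[OF linear_diagonal_act] diagonal_act_tensor)

text \<open>
  Symmetric tensors are only spanned by products, so the property proved has to be linear.
\<close>

lemma sym_square_induct [consumes 1, case_names linear sym_prod]:
  assumes "t \<in> sym_square a b c" "subspace {t. P t}"
    and "\<And>v w. v \<in> root_space a b c \<Longrightarrow> w \<in> root_space a b c \<Longrightarrow> P (v \<or>\<^sub>V w)"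
  shows "P t"
proof -
  have "sym_square a b c \<subseteq> {t. P t}"
    unfolding sym_square_def using assms(2,3) by (intro span_minimal) auto
  with assms(1) show ?thesis by blast
qed

lemma subspace_equalizer: "linear f \<Longrightarrow> linear g \<Longrightarrow> subspace {t. f t = g t}"
  by (rule subspaceI) (simp_all add: linear_0 linear_add linear_scale)

lemma diagonal_act_in_module_M:
  assumes g: "g \<in> carrier (weyl_group a b c)" and t: "t \<in> module_M a b c"
  shows "diagonal_act a b c g t \<in> module_M a b c"
proof -
  obtain xs where xs: "xs \<in> lists V" "weyl_act a b c g = act xs"
    using g by (rule weyl_group_cases)
  have t': "t \<in> sym_square a b c" "contraction a b c t = 0"
    using t by (simp_all add: module_M_def)
  have "diagonal_act a b c g t \<in> sym_square a b c"
    using t'(1)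
  proof (induction rule: sym_square_induct)
    case linear
    show ?case
      using linear_subspace_vimage[OF linear_diagonal_act[of g] subspace_sym_square]
      by (simp add: vimage_def)
  next
    case (sym_prod v w)
    then show ?case
      using xs by (simp only: diagonal_act_sym_prod[OF g] sym_prod_in_sym_square act_in_root_space)
  qed
  moreover have "contraction a b c (diagonal_act a b c g t) = contraction a b c t"
    using t'(1)
  proof (induction rule: sym_square_induct)
    case linear
    show ?case
      using linear_compose[OF linear_diagonal_act[of g] linear_contraction]
      by (intro subspace_equalizer linear_contraction) (simp add: o_def)
  next
    case (sym_prod v w)
    then show ?case
      using xs by (simp only: diagonal_act_sym_prod[OF g] contraction_sym_prod B_act)
  qed
  ultimately show ?thesis using t'(2) by (simp add: module_M_def)
qed

lemma group_representation_M:
  "group_representation (weyl_group a b c) (diagonal_act a b c) (module_M a b c)"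
  unfolding group_representation_def
proof (intro conjI ballI allI)
  show "group (weyl_group a b c)" by (rule weyl_group_group)
  show "subspace (module_M a b c)" by (rule subspace_module_M)
  show "diagonal_act a b c g ` module_M a b c \<subseteq> module_M a b c"
    if "g \<in> carrier (weyl_group a b c)" for g
    using diagonal_act_in_module_M[OF that] by blast
  show "diagonal_act a b c g (x + y) = diagonal_act a b c g x + diagonal_act a b c g y" for g x y
    by (rule linear_add[OF linear_diagonal_act])
  show "diagonal_act a b c g (r *\<^sub>R x) = r *\<^sub>R diagonal_act a b c g x" for g r x
    by (rule linear_scale[OF linear_diagonal_act])
  have one: "\<one>\<^bsub>weyl_group a b c\<^esub> = word_rel a b c `` {[]}"
    by (simp add: weyl_group_def)
  have one_act: "weyl_act a b c \<one>\<^bsub>weyl_group a b c\<^esub> = act []"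
    unfolding one by (rule weyl_act_class) simp
  have one_in: "\<one>\<^bsub>weyl_group a b c\<^esub> \<in> carrier (weyl_group a b c)"
    using weyl_group_group[of a b c] by (meson group.is_monoid monoid.one_closed)
  show "diagonal_act a b c \<one>\<^bsub>weyl_group a b c\<^esub> x = x" if "x \<in> module_M a b c" for x
  proof -
    have "x \<in> sym_square a b c" using that by (simp add: module_M_def)
    then show ?thesis
    proof (induction rule: sym_square_induct)
      case linear
      show ?case by (intro subspace_equalizer linear_diagonal_act linear_ident)
    next
      case (sym_prod v w)
      then show ?case by (simp add: diagonal_act_sym_prod[OF one_in] one_act)
    qed
  qed
  show "diagonal_act a b c (g \<otimes>\<^bsub>weyl_group a b c\<^esub> h) x
      = diagonal_act a b c g (diagonal_act a b c h x)"
    if g: "g \<in> carrier (weyl_group a b c)" and h: "h \<in> carrier (weyl_group a b c)"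
      and x: "x \<in> module_M a b c" for g h x
  proof -
    obtain xs where xs: "xs \<in> lists V" "g = word_rel a b c `` {xs}" "weyl_act a b c g = act xs"
      using g by (rule weyl_group_cases)
    obtain ys where ys: "ys \<in> lists V" "h = word_rel a b c `` {ys}" "weyl_act a b c h = act ys"
      using h by (rule weyl_group_cases)
    have gh: "g \<otimes>\<^bsub>weyl_group a b c\<^esub> h \<in> carrier (weyl_group a b c)"
      using weyl_group_group[of a b c] g h by (meson group.is_monoid monoid.m_closed)
    have act_gh: "weyl_act a b c (g \<otimes>\<^bsub>weyl_group a b c\<^esub> h) = act (xs @ ys)"
      using xs(1,2) ys(1,2) by (simp only: weyl_group_mult_class weyl_act_class append_in_lists_conv)
    have "x \<in> sym_square a b c" using x by (simp add: module_M_def)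
    then show ?thesis
    proof (induction rule: sym_square_induct)
      case linear
      show ?case
        using linear_compose[OF linear_diagonal_act[of h] linear_diagonal_act[of g]]
        by (intro subspace_equalizer linear_diagonal_act) (simp add: o_def)
    next
      case (sym_prod v w)
      then have "act ys v \<in> root_space a b c" "act ys w \<in> root_space a b c"
        using ys(1) by (simp_all only: act_in_root_space)
      with sym_prod show ?case
        by (simp only: diagonal_act_sym_prod[OF gh] diagonal_act_sym_prod[OF g]
            diagonal_act_sym_prod[OF h] act_gh xs(3) ys(3) act_append)
    qed
  qed
qed

lemma CB_roots:
  assumes "x \<in> CB"
  obtains \<alpha> \<beta> where "\<alpha> \<in> real_roots" "\<beta> \<in> real_roots" "B \<alpha> \<beta> = 0" "x = \<alpha> \<or>\<^sub>V \<beta>"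
  using assms
proof (cases rule: CB_cases)
  case (nonadjacent i j)
  then show ?thesis
    using that[of "simple_root i" "simple_root j"]
    by (simp add: simple_root_real cartan_form_simple_simple)
next
  case (triple s p)
  have "adj (parent s p) (Node s p)" "adj (Node s p) (Node s (Suc p))"
    using adj_Node_iff[of s p "parent s p"] adj_sym by auto
  then have "triple s p \<in> real_roots"
    unfolding triple_def using triple(1) by (intro path_real) (simp_all add: parent_in_V)
  then show ?thesis
    using that[of "simple_root (Node s p)" "triple s p"] triple B_triple(1)
    by (simp add: simple_root_real)
next
  case (fork u)
  have "\<exists>s t. s \<noteq> t \<and> u \<noteq> s \<and> u \<noteq> t"
    by (cases u) (metis arm.distinct)+
  then obtain s t where st: "s \<noteq> t" "u \<noteq> s" "u \<noteq> t" by blast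
  have "fork u \<in> real_roots"
    unfolding fork_eq[OF st] using st L_pos[of s] L_pos[of t] by (intro path_real) auto
  then show ?thesis
    using that[of "simple_root Branch" "fork u"] fork B_fork(1) by (simp add: simple_root_real)
next
  case (theta s p)
  then show ?thesis
    using that[of "simple_root (Node s p)" "theta s p"] theta_real B_theta
    by (simp add: simple_root_real)
qed

lemma diagonal_act_CB:
  assumes g: "g \<in> carrier (weyl_group a b c)" and x: "x \<in> CB"
  shows "diagonal_act a b c g x \<in> nat_cone \<or> - diagonal_act a b c g x \<in> nat_cone"
proof -
  obtain xs where xs: "xs \<in> lists V" "weyl_act a b c g = act xs"
    using g by (rule weyl_group_cases)
  obtain \<alpha> \<beta> where ab: "\<alpha> \<in> real_roots" "\<beta> \<in> real_roots" "B \<alpha> \<beta> = 0" "x = \<alpha> \<or>\<^sub>V \<beta>"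
    using x by (rule CB_roots)
  define \<alpha>' \<beta>' where "\<alpha>' = act xs \<alpha>" and "\<beta>' = act xs \<beta>"
  have roots: "\<alpha>' \<in> real_roots" "\<beta>' \<in> real_roots" "B \<alpha>' \<beta>' = 0"
    unfolding \<alpha>'_def \<beta>'_def using ab xs(1) by (simp_all only: act_real_root B_act)
  have eq: "diagonal_act a b c g x = \<alpha>' \<or>\<^sub>V \<beta>'"
    using ab g by (simp add: diagonal_act_sym_prod real_root_in_root_space xs(2) \<alpha>'_def \<beta>'_def)
  have B_minus: "B (- v) w = - B v w" "B v (- w) = - B v w" for v w
    using B_scaleR_left[of "- 1" v w] cartan_form_scaleR_right[of a b c v "- 1" w] by simp_all
  note cone = orthogonal_positive_roots_in_nat_cone
  show ?thesis
    using real_root_sign[OF roots(1)] real_root_sign[OF roots(2)] roots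
      cone[of \<alpha>' \<beta>'] cone[of "- \<alpha>'" \<beta>'] cone[of \<alpha>' "- \<beta>'"] cone[of "- \<alpha>'" "- \<beta>'"]
    by (auto simp: eq minus_real_root B_minus sym_prod_minus_left sym_prod_minus_right)
qed

lemma representation_nat_cone:
  assumes "t = (\<Sum>x\<in>CB. r x *\<^sub>R x)" "y \<in> CB"
  shows "representation CB t y = r y"
proof -
  have "representation CB t y = (\<Sum>x\<in>CB. representation CB (r x *\<^sub>R x) y)"
    unfolding assms(1) by (subst representation_sum[OF independent_CB]) (simp_all add: span_base span_scale)
  also have "\<dots> = (\<Sum>x\<in>CB. if x = y then r x else 0)"
  proof (rule sum.cong)
    fix x assume "x \<in> CB"
    then show "representation CB (r x *\<^sub>R x) y = (if x = y then r x else 0)"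
      by (subst representation_scale[OF independent_CB])
        (simp_all add: span_base representation_basis[OF independent_CB])
  qed simp
  also have "\<dots> = r y" using assms(2) finite_CB by simp
  finally show ?thesis .
qed

lemma matrix_CB_column:
  assumes "g \<in> carrier (weyl_group a b c)" "y \<in> CB"
  obtains f :: "_ \<Rightarrow> nat" and e :: real where "e = 1 \<or> e = - 1"
    "\<And>x. x \<in> CB \<Longrightarrow> matrix_wrt CB (diagonal_act a b c g) x y = e * real (f x)"
  using diagonal_act_CB[OF assms]
proof (rule disjE)
  assume "diagonal_act a b c g y \<in> nat_cone"
  then obtain f where f: "diagonal_act a b c g y = (\<Sum>x\<in>CB. real (f x) *\<^sub>R x)"
    by (rule nat_coneE)
  show ?thesis
  proof (rule that)
    show "matrix_wrt CB (diagonal_act a b c g) x y = 1 * real (f x)" if "x \<in> CB" for x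
      using representation_nat_cone[OF f that] by (simp add: matrix_wrt_def)
  qed simp
next
  assume "- diagonal_act a b c g y \<in> nat_cone"
  then obtain f where f: "- diagonal_act a b c g y = (\<Sum>x\<in>CB. real (f x) *\<^sub>R x)"
    by (rule nat_coneE)
  have "(\<Sum>x\<in>CB. (- real (f x)) *\<^sub>R x) = - (\<Sum>x\<in>CB. real (f x) *\<^sub>R x)"
    by (simp only: scaleR_minus_left sum_negf)
  also have "\<dots> = diagonal_act a b c g y"
    unfolding f[symmetric] by (rule minus_minus)
  finally have eq: "diagonal_act a b c g y = (\<Sum>x\<in>CB. (- real (f x)) *\<^sub>R x)"
    by (rule HOL.sym)
  show ?thesis
  proof (rule that)
    show "matrix_wrt CB (diagonal_act a b c g) x y = - 1 * real (f x)" if "x \<in> CB" for x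
      using representation_nat_cone[OF eq that] by (simp add: matrix_wrt_def)
  qed simp
qed

lemma sign_coherent_integer_matrix_CB:
  assumes "g \<in> carrier (weyl_group a b c)"
  shows "sign_coherent_matrix CB (matrix_wrt CB (diagonal_act a b c g)) \<and>
    integer_matrix CB (matrix_wrt CB (diagonal_act a b c g))"
proof -
  let ?X = "matrix_wrt CB (diagonal_act a b c g)"
  have "?X x y \<in> \<int> \<and> (?X x y \<noteq> 0 \<longrightarrow> ?X z y \<noteq> 0 \<longrightarrow> sgn (?X x y) = sgn (?X z y))"
    if "x \<in> CB" "y \<in> CB" "z \<in> CB" for x y z
  proof -
    obtain f :: "_ \<Rightarrow> nat" and e :: real where e: "e = 1 \<or> e = - 1"
      and X: "\<And>x. x \<in> CB \<Longrightarrow> ?X x y = e * real (f x)"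
      using matrix_CB_column[OF assms \<open>y \<in> CB\<close>] by metis
    show ?thesis
      using e that by (auto simp: X sgn_mult)
  qed
  then show ?thesis
    unfolding sign_coherent_matrix_def integer_matrix_def by blast
qed

end

section \<open>Sign coherence of the canonical basis\<close>

theorem theorem5p1:
  fixes a b c :: nat
  assumes "a \<ge> 1" and "b \<ge> 1" and "c \<ge> 1"
  shows "sign_coherent_basis (weyl_group a b c) (diagonal_act a b c) (module_M a b c)
           (canonical_basis a b c) \<and>
         (\<forall>w\<in>carrier (weyl_group a b c).
           let X = matrix_wrt (canonical_basis a b c) (diagonal_act a b c w)
           in sign_coherent_matrix (canonical_basis a b c) X \<and>
              integer_matrix (canonical_basis a b c) X)"
proof -
  interpret Y_diagram a b c
    using assms by unfold_locales
  show ?thesis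
    using group_representation_M finite_CB independent_CB span_CB sign_coherent_integer_matrix_CB
    by (simp add: sign_coherent_basis_def is_basis_def Let_def)
qed

end
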